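(* Let $(M^{2m+1},\theta,J,h)$ be a pseudo-Hermitian manifold. Given any $H^{1,0}(M)$-valued $(1,1)$-form $\Psi$ on $M$, there is a unique pseudo-Hermitian connection $\nabla$ on $M$ such that $$\Theta^{(1,1)}=\Psi$$ and $$h(\sigma(X),Y)=-h(X,\sigma(Y))\qquad\text{for all } X,Y\in T(M),$$ where $\tau(X)=T_\nabla(\xi,X)$, $\sigma=\tau\circ J+J\circ\tau$, and $\Theta^{(1,1)}$ is the $(1,1)$-part of $\Theta=\pi_+(T_\nabla(\cdot,\cdot))$.
   Context: All objects are smooth. For a $1$-form, $2d\theta(X,Y)=X(\theta(Y))-Y(\theta(X))-\theta([X,Y])$. A CR structure on an orientable manifold $M$ of dimension $2m+1$ is a complex rank-$m$ subbundle $H^{1,0}(M)\subset T(M)\otimes\mathbb C$ with $H^{1,0}(M)\cap H^{0,1}(M)=\{0\}$, where $H^{0,1}(M)=\overline{H^{1,0}(M)}$, and $[\Gamma(H^{1,0}(M)),\Gamma(H^{1,0}(M))]\subseteq\Gamma(H^{1,0}(M))$. Put $H(M)=\mathrm{Re}(H^{1,0}(M)\oplus H^{0,1}(M))$ and $J_b(Z+\overline Z)=\sqrt{-1}(Z-\overline Z)$ for $Z\in H^{1,0}(M)$. A pseudo-Hermitian $1$-form is a nowhere vanishing real $1$-form $\theta$ with $\ker\theta=H(M)$; its Levi form is $L_\theta(X,Y)=d\theta(X,J_bY)$ on $H(M)$. The CR manifold is non-degenerate if $L_\theta$ is non-degenerate. Then there is a unique (Reeb) vector field $\xi$ with $\theta(\xi)=1$,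 $i_\xi d\theta=0$; $T(M)=H(M)\oplus\mathbb R\xi$ with projection $\pi_H:T(M)\to H(M)$, and $J$ is the endomorphism of $T(M)$ with $J|_{H(M)}=J_b$, $J\xi=0$. A pseudo-Hermitian manifold $(M,\theta,J,h)$ is a non-degenerate CR manifold with a fixed pseudo-Hermitian $1$-form $\theta$ and a (positive definite) fiber metric $h$ on $H(M)$ with $h(J_bX,J_bY)=h(X,Y)$. The symbol $h$ also denotes the tensor $h(\pi_H\cdot,\pi_H\cdot)$ on $M$; $g_{h,\theta}=h+\theta\otimes\theta$ is a Riemannian metric. There is the decomposition $T(M)\otimes\mathbb C=H^{1,0}(M)\oplus H^{0,1}(M)\oplus\mathbb C\xi$ with projections $\pi_+,\pi_-,\pi_0$. A pseudo-Hermitian connection is a linear connection $\nabla$ on $M$ preserving this decomposition (each summand is preserved by covariant differentiation) and satisfying $\nabla g_{h,\theta}=0$. Its torsion is $T_\nabla(X,Y)=\nabla_XY-\nabla_YX-[X,Y]$, extended complex bilinearly. With $\Theta=\pi_+(T_\nabla(\cdot,\cdot))$, set $\Theta^{(1,1)}(Z,W)=\Theta(\pi_+Z,\pi_-W)+\Theta(\pi_-Z,\pi_+W)$. A (vector-valued) complex $2$-form $\Psi$ is a $(1,1)$-form if $\Psi(\pi_+\cdot,\pi_+\cdot)=\Psi(\pi_-\cdot,\pi_-\cdot)=0$ and $i_\xi\Psi=0$. *)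

theory Defs
  imports "HOL-Analysis.Analysis" "HOL-Library.Function_Algebras"
begin

section \<open>Smooth manifolds\<close>

primrec Ck_on :: "nat \<Rightarrow> 'e::real_normed_vector set \<Rightarrow> ('e \<Rightarrow> 'f::real_normed_vector) \<Rightarrow> bool" where
  "Ck_on 0 S f \<longleftrightarrow> continuous_on S f"
| "Ck_on (Suc k) S f \<longleftrightarrow> (\<forall>x\<in>S. f differentiable (at x)) \<and>
     (\<forall>v. Ck_on k S (\<lambda>x. frechet_derivative f (at x) v))"

text \<open>Used for open \<open>S\<close> only.\<close>
definition smooth_on :: "'e::real_normed_vector set \<Rightarrow> ('e \<Rightarrow> 'f::real_normed_vector) \<Rightarrow> bool" where
  "smooth_on S f \<longleftrightarrow> (\<forall>k. Ck_on k S f)"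

text \<open>The manifold is the whole type \<open>'a\<close> (Hausdorff and second countable by its sort in
  \<open>smooth_atlas\<close>); a chart is a pair of a domain and a coordinate map, and the latter is
  meaningful on the domain only.\<close>
type_synonym ('a, 'n) chart = "'a set \<times> ('a \<Rightarrow> real ^ 'n)"

definition is_chart :: "('a::topological_space, 'n::finite) chart \<Rightarrow> bool" where
  "is_chart = (\<lambda>(U, \<phi>). open U \<and> open (\<phi> ` U) \<and> homeomorphism U (\<phi> ` U) \<phi> (inv_into U \<phi>))"

definition smooth_atlas ::
  "('a::{t2_space, second_countable_topology}, 'n::finite) chart set \<Rightarrow> bool" where
  "smooth_atlas A \<longleftrightarrow> (\<forall>c\<in>A. is_chart c) \<and> \<Union> (fst ` A) = UNIV \<and>
     (\<forall>(U, \<phi>)\<in>A. \<forall>(V, \<psi>)\<in>A. smooth_on (\<phi> ` (U \<inter> V)) (\<psi> \<circ> inv_into U \<phi>))"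

definition orientable ::
  "('a::{t2_space, second_countable_topology}, 'n::finite) chart set \<Rightarrow> bool" where
  "orientable A \<longleftrightarrow> (\<exists>B. smooth_atlas B \<and> smooth_atlas (A \<union> B) \<and>
     (\<forall>(U, \<phi>)\<in>B. \<forall>(V, \<psi>)\<in>B. \<forall>x\<in>\<phi> ` (U \<inter> V).
        det (matrix (frechet_derivative (\<psi> \<circ> inv_into U \<phi>) (at x))) > 0))"

definition smooth_fun_on ::
  "('a, 'n::finite) chart set \<Rightarrow> 'a set \<Rightarrow> ('a \<Rightarrow> 'f::real_normed_vector) \<Rightarrow> bool" where
  "smooth_fun_on A U f \<longleftrightarrow> (\<forall>(V, \<phi>)\<in>A. smooth_on (\<phi> ` (U \<inter> V)) (f \<circ> inv_into V \<phi>))"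

section \<open>Tangent vectors and vector fields\<close>

text \<open>A complex tangent vector acts on the real smooth functions by differentiation; it is set
  to \<open>0\<close> on all other functions, so that equality of vectors is equality of functions. The real
  tangent vectors are those complex ones whose values are real, so that the tangent space is
  literally a subset of its complexification. Addition is pointwise.\<close>
type_synonym 'a cvec = "('a \<Rightarrow> real) \<Rightarrow> complex"
type_synonym 'a cfield = "'a \<Rightarrow> 'a cvec"

definition tangent :: "('a, 'n::finite) chart set \<Rightarrow> 'a \<Rightarrow> 'a cvec set" where
  "tangent A p = {v. \<exists>(U, \<phi>)\<in>A. p \<in> U \<and> (\<exists>a. v =
     (\<lambda>f. if smooth_fun_on A UNIV f
          then complex_of_real (frechet_derivative (f \<circ> inv_into U \<phi>) (at (\<phi> p)) a) else 0))}"

definition cscale :: "complex \<Rightarrow> 'a cvec \<Rightarrow> 'a cvec" where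
  "cscale c v = (\<lambda>f. c * v f)"

definition ctangent :: "('a, 'n::finite) chart set \<Rightarrow> 'a \<Rightarrow> 'a cvec set" where
  "ctangent A p = {v + cscale \<i> w | v w. v \<in> tangent A p \<and> w \<in> tangent A p}"

definition cconj :: "'a cvec \<Rightarrow> 'a cvec" where
  "cconj v = (\<lambda>f. cnj (v f))"

definition fscale :: "('a \<Rightarrow> real) \<Rightarrow> 'a cfield \<Rightarrow> 'a cfield" where
  "fscale u X = (\<lambda>p. cscale (complex_of_real (u p)) (X p))"

definition ciscale :: "'a cfield \<Rightarrow> 'a cfield" where
  "ciscale X = (\<lambda>p. cscale \<i> (X p))"

definition smooth_field_on ::
  "('a, 'n::finite) chart set \<Rightarrow> 'a set \<Rightarrow> 'a cfield \<Rightarrow> bool" where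
  "smooth_field_on A U X \<longleftrightarrow> (\<forall>p\<in>U. X p \<in> ctangent A p) \<and>
     (\<forall>f. smooth_fun_on A UNIV f \<longrightarrow> smooth_fun_on A U (\<lambda>p. X p f))"

text \<open>Global smooth sections of a family of subspaces of the complexified tangent spaces.\<close>
definition sections ::
  "('a, 'n::finite) chart set \<Rightarrow> ('a \<Rightarrow> 'a cvec set) \<Rightarrow> 'a cfield set" where
  "sections A F = {X. smooth_field_on A UNIV X \<and> (\<forall>p. X p \<in> F p)}"

abbreviation vfields :: "('a, 'n::finite) chart set \<Rightarrow> 'a cfield set" where
  "vfields A \<equiv> sections A (tangent A)"

abbreviation cvfields :: "('a, 'n::finite) chart set \<Rightarrow> 'a cfield set" where
  "cvfields A \<equiv> sections A (ctangent A)"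

definition capply :: "'a cvec \<Rightarrow> ('a \<Rightarrow> complex) \<Rightarrow> complex" where
  "capply v u = v (\<lambda>q. Re (u q)) + \<i> * v (\<lambda>q. Im (u q))"

definition lie_bracket :: "'a cfield \<Rightarrow> 'a cfield \<Rightarrow> 'a cfield" where
  "lie_bracket X Y = (\<lambda>p f. capply (X p) (\<lambda>q. Y q f) - capply (Y p) (\<lambda>q. X q f))"

definition re_field :: "'a cfield \<Rightarrow> 'a cfield" where
  "re_field X = (\<lambda>p f. complex_of_real (Re (X p f)))"

definition im_field :: "'a cfield \<Rightarrow> 'a cfield" where
  "im_field X = (\<lambda>p f. complex_of_real (Im (X p f)))"

text \<open>Complex bilinear extension of an operation on real vector fields.\<close>
definition cbilinear_ext ::
  "('a cfield \<Rightarrow> 'a cfield \<Rightarrow> 'a cfield) \<Rightarrow> 'a cfield \<Rightarrow> 'a cfield \<Rightarrow> 'a cfield" where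
  "cbilinear_ext B Z W =
     B (re_field Z) (re_field W) - B (im_field Z) (im_field W) +
     ciscale (B (re_field Z) (im_field W) + B (im_field Z) (re_field W))"

section \<open>Pseudo-Hermitian manifolds\<close>

text \<open>Throughout, \<open>E p\<close> is the fibre at \<open>p\<close> of the bundle of type (1,0), and \<open>bar E\<close> its
  conjugate bundle.\<close>

definition bar :: "('a \<Rightarrow> 'a cvec set) \<Rightarrow> 'a \<Rightarrow> 'a cvec set" where
  "bar E p = cconj ` E p"

definition complex_subbundle ::
  "('a::topological_space, 'n::finite) chart set \<Rightarrow> nat \<Rightarrow> ('a \<Rightarrow> 'a cvec set) \<Rightarrow> bool" where
  "complex_subbundle A m E \<longleftrightarrow> (\<forall>p. E p \<subseteq> ctangent A p) \<and>
     (\<forall>p. \<exists>U Z. open U \<and> p \<in> U \<and> (\<forall>i<m. smooth_field_on A U (Z i)) \<and>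
        (\<forall>q\<in>U. E q = {(\<Sum>i<m. cscale (c i) (Z i q)) | c. True} \<and>
               (\<forall>c. (\<Sum>i<m. cscale (c i) (Z i q)) = 0 \<longrightarrow> (\<forall>i<m. c i = 0))))"

definition cr_structure ::
  "('a::{t2_space, second_countable_topology}, 'n::finite) chart set \<Rightarrow> nat \<Rightarrow>
     ('a \<Rightarrow> 'a cvec set) \<Rightarrow> bool" where
  "cr_structure A m E \<longleftrightarrow> smooth_atlas A \<and> CARD('n) = 2 * m + 1 \<and> orientable A \<and>
     complex_subbundle A m E \<and> (\<forall>p. E p \<inter> bar E p = {0}) \<and>
     (\<forall>Z\<in>sections A E. \<forall>W\<in>sections A E. lie_bracket Z W \<in> sections A E)"

text \<open>\<open>H(M)\<close>: the real vectors in the sum of the (1,0) and (0,1) bundles.\<close>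
definition Hreal :: "('a, 'n::finite) chart set \<Rightarrow> ('a \<Rightarrow> 'a cvec set) \<Rightarrow> 'a \<Rightarrow> 'a cvec set" where
  "Hreal A E p = {a + b | a b. a \<in> E p \<and> b \<in> bar E p} \<inter> tangent A p"

definition Jb :: "('a \<Rightarrow> 'a cvec set) \<Rightarrow> 'a \<Rightarrow> 'a cvec \<Rightarrow> 'a cvec" where
  "Jb E p v = (THE w. \<exists>z\<in>E p. v = z + cconj z \<and> w = cscale \<i> (z - cconj z))"

definition one_form :: "('a, 'n::finite) chart set \<Rightarrow> ('a \<Rightarrow> 'a cvec \<Rightarrow> real) \<Rightarrow> bool" where
  "one_form A \<theta> \<longleftrightarrow>
     (\<forall>p. \<forall>u\<in>tangent A p. \<forall>v\<in>tangent A p. \<theta> p (u + v) = \<theta> p u + \<theta> p v) \<and>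
     (\<forall>p c. \<forall>u\<in>tangent A p. \<theta> p (cscale (complex_of_real c) u) = c * \<theta> p u) \<and>
     (\<forall>X\<in>vfields A. smooth_fun_on A UNIV (\<lambda>p. \<theta> p (X p)))"

text \<open>The normalisation with the factor 1/2; \<open>Re\<close> only changes the type, as real vector fields
  have real values.\<close>
definition ext_deriv ::
  "('a \<Rightarrow> 'a cvec \<Rightarrow> real) \<Rightarrow> 'a cfield \<Rightarrow> 'a cfield \<Rightarrow> 'a \<Rightarrow> real" where
  "ext_deriv \<theta> X Y p =
     (Re (X p (\<lambda>q. \<theta> q (Y q))) - Re (Y p (\<lambda>q. \<theta> q (X q))) - \<theta> p (lie_bracket X Y p)) / 2"

definition pseudo_hermitian_form ::
  "('a, 'n::finite) chart set \<Rightarrow> ('a \<Rightarrow> 'a cvec set) \<Rightarrow> ('a \<Rightarrow> 'a cvec \<Rightarrow> real) \<Rightarrow> bool" where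
  "pseudo_hermitian_form A E \<theta> \<longleftrightarrow> one_form A \<theta> \<and>
     (\<forall>p. \<exists>v\<in>tangent A p. \<theta> p v \<noteq> 0) \<and>
     (\<forall>p. {v \<in> tangent A p. \<theta> p v = 0} = Hreal A E p)"

definition levi_form ::
  "('a \<Rightarrow> 'a cvec set) \<Rightarrow> ('a \<Rightarrow> 'a cvec \<Rightarrow> real) \<Rightarrow> 'a cfield \<Rightarrow> 'a cfield \<Rightarrow> 'a \<Rightarrow> real" where
  "levi_form E \<theta> X Y = ext_deriv \<theta> X (\<lambda>p. Jb E p (Y p))"

text \<open>Non-degeneracy at each point; the value of the Levi form at \<open>p\<close> depends on \<open>X p\<close> and
  \<open>Y p\<close> only, and every vector of \<open>H(M)\<close> at \<open>p\<close> extends to a section.\<close>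
definition levi_nondegenerate ::
  "('a, 'n::finite) chart set \<Rightarrow> ('a \<Rightarrow> 'a cvec set) \<Rightarrow> ('a \<Rightarrow> 'a cvec \<Rightarrow> real) \<Rightarrow> bool" where
  "levi_nondegenerate A E \<theta> \<longleftrightarrow> (\<forall>p. \<forall>X\<in>sections A (Hreal A E).
     (\<forall>Y\<in>sections A (Hreal A E). levi_form E \<theta> X Y p = 0) \<longrightarrow> X p = 0)"

definition fiber_metric ::
  "('a, 'n::finite) chart set \<Rightarrow> ('a \<Rightarrow> 'a cvec set) \<Rightarrow> ('a \<Rightarrow> 'a cvec \<Rightarrow> 'a cvec \<Rightarrow> real) \<Rightarrow> bool"
  where
  "fiber_metric A E h \<longleftrightarrow>
     (\<forall>p. \<forall>u\<in>Hreal A E p. \<forall>v\<in>Hreal A E p. \<forall>w\<in>Hreal A E p.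
        h p (u + v) w = h p u w + h p v w) \<and>
     (\<forall>p c. \<forall>u\<in>Hreal A E p. \<forall>v\<in>Hreal A E p.
        h p (cscale (complex_of_real c) u) v = c * h p u v) \<and>
     (\<forall>p. \<forall>u\<in>Hreal A E p. \<forall>v\<in>Hreal A E p. h p u v = h p v u) \<and>
     (\<forall>p. \<forall>u\<in>Hreal A E p. u \<noteq> 0 \<longrightarrow> h p u u > 0) \<and>
     (\<forall>X\<in>sections A (Hreal A E). \<forall>Y\<in>sections A (Hreal A E).
        smooth_fun_on A UNIV (\<lambda>p. h p (X p) (Y p)))"

definition pseudo_hermitian_manifold ::
  "('a::{t2_space, second_countable_topology}, 'n::finite) chart set \<Rightarrow> nat \<Rightarrow>
     ('a \<Rightarrow> 'a cvec set) \<Rightarrow> ('a \<Rightarrow> 'a cvec \<Rightarrow> real) \<Rightarrow>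
     ('a \<Rightarrow> 'a cvec \<Rightarrow> 'a cvec \<Rightarrow> real) \<Rightarrow> bool" where
  "pseudo_hermitian_manifold A m E \<theta> h \<longleftrightarrow>
     cr_structure A m E \<and> pseudo_hermitian_form A E \<theta> \<and> levi_nondegenerate A E \<theta> \<and>
     fiber_metric A E h \<and>
     (\<forall>p. \<forall>u\<in>Hreal A E p. \<forall>v\<in>Hreal A E p. h p (Jb E p u) (Jb E p v) = h p u v)"

definition reeb :: "('a, 'n::finite) chart set \<Rightarrow> ('a \<Rightarrow> 'a cvec \<Rightarrow> real) \<Rightarrow> 'a cfield" where
  "reeb A \<theta> = (THE \<xi>. \<xi> \<in> vfields A \<and> (\<forall>p. \<theta> p (\<xi> p) = 1) \<and>
     (\<forall>X\<in>vfields A. \<forall>p. ext_deriv \<theta> \<xi> X p = 0))"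

definition pi_H ::
  "('a, 'n::finite) chart set \<Rightarrow> ('a \<Rightarrow> 'a cvec set) \<Rightarrow> ('a \<Rightarrow> 'a cvec \<Rightarrow> real) \<Rightarrow>
     'a \<Rightarrow> 'a cvec \<Rightarrow> 'a cvec" where
  "pi_H A E \<theta> p v =
     (THE u. u \<in> Hreal A E p \<and> (\<exists>c. v = u + cscale (complex_of_real c) (reeb A \<theta> p)))"

definition J_endo ::
  "('a, 'n::finite) chart set \<Rightarrow> ('a \<Rightarrow> 'a cvec set) \<Rightarrow> ('a \<Rightarrow> 'a cvec \<Rightarrow> real) \<Rightarrow>
     'a \<Rightarrow> 'a cvec \<Rightarrow> 'a cvec" where
  "J_endo A E \<theta> p v = Jb E p (pi_H A E \<theta> p v)"

definition h_tensor ::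
  "('a, 'n::finite) chart set \<Rightarrow> ('a \<Rightarrow> 'a cvec set) \<Rightarrow> ('a \<Rightarrow> 'a cvec \<Rightarrow> real) \<Rightarrow>
     ('a \<Rightarrow> 'a cvec \<Rightarrow> 'a cvec \<Rightarrow> real) \<Rightarrow> 'a \<Rightarrow> 'a cvec \<Rightarrow> 'a cvec \<Rightarrow> real" where
  "h_tensor A E \<theta> h p u v = h p (pi_H A E \<theta> p u) (pi_H A E \<theta> p v)"

definition g_metric ::
  "('a, 'n::finite) chart set \<Rightarrow> ('a \<Rightarrow> 'a cvec set) \<Rightarrow> ('a \<Rightarrow> 'a cvec \<Rightarrow> real) \<Rightarrow>
     ('a \<Rightarrow> 'a cvec \<Rightarrow> 'a cvec \<Rightarrow> real) \<Rightarrow> 'a \<Rightarrow> 'a cvec \<Rightarrow> 'a cvec \<Rightarrow> real" where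
  "g_metric A E \<theta> h p u v = h_tensor A E \<theta> h p u v + \<theta> p u * \<theta> p v"

definition pi_plus ::
  "('a, 'n::finite) chart set \<Rightarrow> ('a \<Rightarrow> 'a cvec set) \<Rightarrow> ('a \<Rightarrow> 'a cvec \<Rightarrow> real) \<Rightarrow>
     'a \<Rightarrow> 'a cvec \<Rightarrow> 'a cvec" where
  "pi_plus A E \<theta> p v =
     (THE a. a \<in> E p \<and> (\<exists>b\<in>bar E p. \<exists>c. v = a + b + cscale c (reeb A \<theta> p)))"

definition pi_minus ::
  "('a, 'n::finite) chart set \<Rightarrow> ('a \<Rightarrow> 'a cvec set) \<Rightarrow> ('a \<Rightarrow> 'a cvec \<Rightarrow> real) \<Rightarrow>
     'a \<Rightarrow> 'a cvec \<Rightarrow> 'a cvec" where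
  "pi_minus A E \<theta> p v =
     (THE b. b \<in> bar E p \<and> (\<exists>a\<in>E p. \<exists>c. v = a + b + cscale c (reeb A \<theta> p)))"

section \<open>Pseudo-Hermitian connections\<close>

text \<open>A connection is an operator on pairs of smooth vector fields; its value is set to \<open>0\<close>
  elsewhere, so that equality of connections is equality of functions.\<close>
definition linear_connection ::
  "('a, 'n::finite) chart set \<Rightarrow> ('a cfield \<Rightarrow> 'a cfield \<Rightarrow> 'a cfield) \<Rightarrow> bool" where
  "linear_connection A D \<longleftrightarrow>
     (\<forall>X\<in>vfields A. \<forall>Y\<in>vfields A. D X Y \<in> vfields A) \<and>
     (\<forall>X Y. X \<notin> vfields A \<or> Y \<notin> vfields A \<longrightarrow> D X Y = 0) \<and>
     (\<forall>X\<in>vfields A. \<forall>X'\<in>vfields A. \<forall>Y\<in>vfields A. D (X + X') Y = D X Y + D X' Y) \<and>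
     (\<forall>u. smooth_fun_on A UNIV u \<longrightarrow>
        (\<forall>X\<in>vfields A. \<forall>Y\<in>vfields A. D (fscale u X) Y = fscale u (D X Y))) \<and>
     (\<forall>X\<in>vfields A. \<forall>Y\<in>vfields A. \<forall>Y'\<in>vfields A. D X (Y + Y') = D X Y + D X Y') \<and>
     (\<forall>u. smooth_fun_on A UNIV u \<longrightarrow>
        (\<forall>X\<in>vfields A. \<forall>Y\<in>vfields A.
           D X (fscale u Y) = fscale (\<lambda>p. Re (X p u)) Y + fscale u (D X Y)))"

definition preserves ::
  "('a, 'n::finite) chart set \<Rightarrow> ('a cfield \<Rightarrow> 'a cfield \<Rightarrow> 'a cfield) \<Rightarrow>
     ('a \<Rightarrow> 'a cvec set) \<Rightarrow> bool" where
  "preserves A D F \<longleftrightarrow>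
     (\<forall>X\<in>vfields A. \<forall>Z\<in>sections A F. cbilinear_ext D X Z \<in> sections A F)"

definition pseudo_hermitian_connection ::
  "('a, 'n::finite) chart set \<Rightarrow> ('a \<Rightarrow> 'a cvec set) \<Rightarrow> ('a \<Rightarrow> 'a cvec \<Rightarrow> real) \<Rightarrow>
     ('a \<Rightarrow> 'a cvec \<Rightarrow> 'a cvec \<Rightarrow> real) \<Rightarrow> ('a cfield \<Rightarrow> 'a cfield \<Rightarrow> 'a cfield) \<Rightarrow> bool" where
  "pseudo_hermitian_connection A E \<theta> h D \<longleftrightarrow> linear_connection A D \<and>
     preserves A D E \<and> preserves A D (bar E) \<and>
     preserves A D (\<lambda>p. {cscale c (reeb A \<theta> p) | c. True}) \<and>
     (\<forall>X\<in>vfields A. \<forall>Y\<in>vfields A. \<forall>Z\<in>vfields A. \<forall>p.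
        Re (X p (\<lambda>q. g_metric A E \<theta> h q (Y q) (Z q))) =
        g_metric A E \<theta> h p (D X Y p) (Z p) + g_metric A E \<theta> h p (Y p) (D X Z p))"

definition torsion ::
  "('a cfield \<Rightarrow> 'a cfield \<Rightarrow> 'a cfield) \<Rightarrow> 'a cfield \<Rightarrow> 'a cfield \<Rightarrow> 'a cfield" where
  "torsion D X Y = D X Y - D Y X - lie_bracket X Y"

definition Theta ::
  "('a, 'n::finite) chart set \<Rightarrow> ('a \<Rightarrow> 'a cvec set) \<Rightarrow> ('a \<Rightarrow> 'a cvec \<Rightarrow> real) \<Rightarrow>
     ('a cfield \<Rightarrow> 'a cfield \<Rightarrow> 'a cfield) \<Rightarrow> 'a cfield \<Rightarrow> 'a cfield \<Rightarrow> 'a cfield" where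
  "Theta A E \<theta> D Z W = (\<lambda>p. pi_plus A E \<theta> p (cbilinear_ext (torsion D) Z W p))"

definition Theta11 ::
  "('a, 'n::finite) chart set \<Rightarrow> ('a \<Rightarrow> 'a cvec set) \<Rightarrow> ('a \<Rightarrow> 'a cvec \<Rightarrow> real) \<Rightarrow>
     ('a cfield \<Rightarrow> 'a cfield \<Rightarrow> 'a cfield) \<Rightarrow> 'a cfield \<Rightarrow> 'a cfield \<Rightarrow> 'a cfield" where
  "Theta11 A E \<theta> D Z W =
     Theta A E \<theta> D (\<lambda>p. pi_plus A E \<theta> p (Z p)) (\<lambda>p. pi_minus A E \<theta> p (W p)) +
     Theta A E \<theta> D (\<lambda>p. pi_minus A E \<theta> p (Z p)) (\<lambda>p. pi_plus A E \<theta> p (W p))"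

definition tau_endo ::
  "('a, 'n::finite) chart set \<Rightarrow> ('a \<Rightarrow> 'a cvec \<Rightarrow> real) \<Rightarrow>
     ('a cfield \<Rightarrow> 'a cfield \<Rightarrow> 'a cfield) \<Rightarrow> 'a cfield \<Rightarrow> 'a cfield" where
  "tau_endo A \<theta> D X = torsion D (reeb A \<theta>) X"

definition sigma_endo ::
  "('a, 'n::finite) chart set \<Rightarrow> ('a \<Rightarrow> 'a cvec set) \<Rightarrow> ('a \<Rightarrow> 'a cvec \<Rightarrow> real) \<Rightarrow>
     ('a cfield \<Rightarrow> 'a cfield \<Rightarrow> 'a cfield) \<Rightarrow> 'a cfield \<Rightarrow> 'a cfield" where
  "sigma_endo A E \<theta> D X =
     tau_endo A \<theta> D (\<lambda>p. J_endo A E \<theta> p (X p)) + (\<lambda>p. J_endo A E \<theta> p (tau_endo A \<theta> D X p))"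

text \<open>Vector-valued complex 2-forms with values in the subbundle \<open>F\<close>.\<close>
definition complex_two_form ::
  "('a, 'n::finite) chart set \<Rightarrow> ('a \<Rightarrow> 'a cvec set) \<Rightarrow>
     ('a \<Rightarrow> 'a cvec \<Rightarrow> 'a cvec \<Rightarrow> 'a cvec) \<Rightarrow> bool" where
  "complex_two_form A F \<Psi> \<longleftrightarrow>
     (\<forall>p. \<forall>u\<in>ctangent A p. \<forall>v\<in>ctangent A p. \<Psi> p u v \<in> F p) \<and>
     (\<forall>p. \<forall>u\<in>ctangent A p. \<forall>v\<in>ctangent A p. \<forall>w\<in>ctangent A p.
        \<Psi> p (u + v) w = \<Psi> p u w + \<Psi> p v w) \<and>
     (\<forall>p c. \<forall>u\<in>ctangent A p. \<forall>v\<in>ctangent A p. \<Psi> p (cscale c u) v = cscale c (\<Psi> p u v)) \<and>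
     (\<forall>p. \<forall>u\<in>ctangent A p. \<forall>v\<in>ctangent A p. \<Psi> p u v = - \<Psi> p v u) \<and>
     (\<forall>Z\<in>cvfields A. \<forall>W\<in>cvfields A. (\<lambda>p. \<Psi> p (Z p) (W p)) \<in> sections A F)"

definition is_11_form ::
  "('a, 'n::finite) chart set \<Rightarrow> ('a \<Rightarrow> 'a cvec set) \<Rightarrow> ('a \<Rightarrow> 'a cvec \<Rightarrow> real) \<Rightarrow>
     ('a \<Rightarrow> 'a cvec \<Rightarrow> 'a cvec \<Rightarrow> 'a cvec) \<Rightarrow> bool" where
  "is_11_form A E \<theta> \<Psi> \<longleftrightarrow> (\<forall>p. \<forall>u\<in>ctangent A p. \<forall>v\<in>ctangent A p.
     \<Psi> p (pi_plus A E \<theta> p u) (pi_plus A E \<theta> p v) = 0 \<and>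
     \<Psi> p (pi_minus A E \<theta> p u) (pi_minus A E \<theta> p v) = 0 \<and>
     \<Psi> p (reeb A \<theta> p) v = 0)"

end

theory Submission
  imports Defs
begin

text \<open>The metric \<open>h\<close> induces a positive definite Hermitian form \<open>K\<close> on the (1,0) bundle, and a
  pseudo-Hermitian connection is the same as a covariant derivative of (1,0) sections that is
  compatible with \<open>K\<close>. For (1,0) sections \<open>Z\<close>, \<open>W\<close> the condition on the (1,1) part of the torsion
  reads \<open>\<nabla>_{Z^*} W = \<pi>_+ [Z^*, W] + \<Psi>(Z^*, W)\<close> with \<open>Z^*\<close> the conjugate of \<open>Z\<close>, and the condition on
  \<open>\<sigma>\<close> says that \<open>S W = \<nabla>_\<xi> W - \<pi>_+ [\<xi>, W]\<close> is \<open>K\<close>-symmetric. Together with compatibility these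
  express \<open>K(\<nabla>_X W, V)\<close> by known data, which gives uniqueness. Conversely that expression is
  conjugate linear in \<open>V\<close> over the smooth functions, so it is represented by a (1,0) section, and
  this defines the connection. Smoothness of the representing section comes from \<open>K\<close>-orthogonal
  local frames, that of the Reeb field from Cramer's rule; bump functions make local objects global.\<close>

section \<open>Smooth functions between vector spaces\<close>

text \<open>The torsion condition leaves the Reeb direction open, and there compatibility with
  \<open>K\<close> alone does not determine the connection. Write
  \<open>\<nabla>_\<xi> = L + S\<close> with \<open>L W = \<pi>_+ [\<xi>, W]\<close>. Compatibility
  prescribes the sum of S and its \<open>K\<close>-adjoint, so a symmetric S is fully determined.
  The endomorphism \<sigma> is built to isolate S: the (1,0) part of \<tau> is S, which is complex
  linear, plus a conjugate linear bracket term; in \<tau> J + J \<tau> the second cancels and the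
  first is multiplied by 2i. Because of this factor, skewness of \<sigma> means symmetry of S. In
  the (1,0) directions no derivative is prescribed, and a bracket formula would not be tensorial
  there; the product rule for \<open>K\<close> carries the derivative over to the conjugate
  direction. The second difficulty is one of format. Fields and connections are global, and vectors
  act on globally smooth functions. Hence local frames and local solutions have to be cut off before
  they can be used, and values at a point have to be shown to depend on data at that point.\<close>

lemma frechet_derivative_cong_open:
  assumes "open S" "x \<in> S" "\<And>y. y \<in> S \<Longrightarrow> f y = g y"
  shows "frechet_derivative f (at x) = frechet_derivative g (at x)"
proof -
  have "(f has_derivative f') (at x) \<longleftrightarrow> (g has_derivative f') (at x)" for f'
    using has_derivative_transform_within_open[OF _ assms(1,2)] assms(3) by metis
  then show ?thesis by (simp add: frechet_derivative_def)
qed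

lemma differentiable_cong_open:
  assumes "open S" "x \<in> S" "\<And>y. y \<in> S \<Longrightarrow> f y = g y"
  shows "f differentiable (at x) \<longleftrightarrow> g differentiable (at x)"
  using has_derivative_transform_within_open[OF _ assms(1,2)] assms(3)
  unfolding differentiable_def by metis

lemma Ck_on_cong:
  assumes "open S" "\<And>y. y \<in> S \<Longrightarrow> f y = g y"
  shows "Ck_on k S f \<longleftrightarrow> Ck_on k S g"
  using assms(2)
proof (induction k arbitrary: f g)
  case 0
  then show ?case by (auto intro: continuous_on_cong[THEN iffD1])
next
  case (Suc k)
  have d: "frechet_derivative f (at x) v = frechet_derivative g (at x) v" if "x \<in> S" for x v
    using frechet_derivative_cong_open[OF assms(1) that Suc.prems] by simp
  have "Ck_on k S (\<lambda>x. frechet_derivative f (at x) v) \<longleftrightarrow>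
    Ck_on k S (\<lambda>x. frechet_derivative g (at x) v)" for v
    using d by (intro Suc.IH)
  moreover have "f differentiable (at x) \<longleftrightarrow> g differentiable (at x)" if "x \<in> S" for x
    using differentiable_cong_open[OF assms(1) that Suc.prems] .
  ultimately show ?case by simp
qed

lemma Ck_on_subset: "Ck_on k S f \<Longrightarrow> T \<subseteq> S \<Longrightarrow> Ck_on k T f"
  by (induction k arbitrary: f) (auto intro: continuous_on_subset)

lemma Ck_on_local:
  assumes "\<And>x. x \<in> S \<Longrightarrow> \<exists>T. open T \<and> x \<in> T \<and> Ck_on k T f"
  shows "Ck_on k S f"
  using assms
proof (induction k arbitrary: f)
  case 0
  have "continuous (at x within S) f" if x: "x \<in> S" for x
  proof -
    obtain T where T: "open T" "x \<in> T" "continuous_on T f" using 0 x by auto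
    then have "isCont f x" by (simp add: continuous_on_eq_continuous_at)
    then show ?thesis by (rule continuous_at_imp_continuous_at_within)
  qed
  then show ?case by (simp add: continuous_on_eq_continuous_within)
next
  case (Suc k)
  have "f differentiable (at x)" if "x \<in> S" for x
    using Suc.prems[OF that] by auto
  moreover have "Ck_on k S (\<lambda>x. frechet_derivative f (at x) v)" for v
    using Suc.prems by (intro Suc.IH) fastforce
  ultimately show ?case by simp
qed

lemma Ck_on_SucD: "Ck_on (Suc k) S f \<Longrightarrow> Ck_on k S f"
proof (induction k arbitrary: f)
  case 0
  then show ?case
    by (auto intro: continuous_at_imp_continuous_on differentiable_imp_continuous_within)
next
  case (Suc k)
  then show ?case by auto
qed

text \<open>Lets a known derivative formula stand in for the chosen
  \<open>frechet_derivative\<close>; the closure rules below supply such formulas and then induct on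
  k.\<close>

lemma Ck_on_SucI:
  assumes "open S" "\<And>x. x \<in> S \<Longrightarrow> (f has_derivative f' x) (at x)"
    "\<And>v. Ck_on k S (\<lambda>x. f' x v)"
  shows "Ck_on (Suc k) S f"
proof -
  have "frechet_derivative f (at x) v = f' x v" if "x \<in> S" for x v
    using frechet_derivative_at[OF assms(2)[OF that]] by metis
  then have "Ck_on k S (\<lambda>x. frechet_derivative f (at x) v)" for v
    using assms(3)[of v] by (subst Ck_on_cong[OF assms(1)]) auto
  then show ?thesis using assms(2) by (auto simp: differentiable_def)
qed

lemma Ck_on_Suc_has_derivative:
  "Ck_on (Suc k) S f \<Longrightarrow> x \<in> S \<Longrightarrow> (f has_derivative frechet_derivative f (at x)) (at x)"
  by (simp add: frechet_derivative_works)

lemma Ck_on_const: "Ck_on k S (\<lambda>x. c)"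
  by (induction k arbitrary: c) auto

lemma Ck_on_linear:
  assumes "bounded_linear L" "open S"
  shows "Ck_on k S L"
proof (cases k)
  case 0
  with assms show ?thesis by (simp add: linear_continuous_on)
next
  case (Suc j)
  then show ?thesis
    using assms bounded_linear_imp_has_derivative
    by (auto simp del: Ck_on.simps intro!: Ck_on_SucI[where f' = "\<lambda>_. L"] Ck_on_const)
qed

lemma Ck_on_compose_linear:
  assumes "bounded_linear L" "open S"
  shows "Ck_on k S f \<Longrightarrow> Ck_on k S (\<lambda>x. L (f x))"
proof (induction k arbitrary: f)
  case 0
  then show ?case using bounded_linear.continuous_on[OF assms(1)] by simp
next
  case (Suc k)
  show ?case
  proof (rule Ck_on_SucI[OF assms(2)])
    show "((\<lambda>x. L (f x)) has_derivative (\<lambda>v. L (frechet_derivative f (at x) v))) (at x)"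
      if "x \<in> S" for x
      using Ck_on_Suc_has_derivative[OF Suc.prems that] bounded_linear.has_derivative[OF assms(1)]
      by blast
    show "Ck_on k S (\<lambda>x. L (frechet_derivative f (at x) v))" for v
      using Suc by auto
  qed
qed

lemma Ck_on_add:
  assumes "open S"
  shows "Ck_on k S f \<Longrightarrow> Ck_on k S g \<Longrightarrow> Ck_on k S (\<lambda>x. f x + g x)"
proof (induction k arbitrary: f g)
  case 0
  then show ?case by (simp add: continuous_on_add)
next
  case (Suc k)
  show ?case
  proof (rule Ck_on_SucI[OF assms])
    show "((\<lambda>x. f x + g x) has_derivative
        (\<lambda>v. frechet_derivative f (at x) v + frechet_derivative g (at x) v)) (at x)"
      if "x \<in> S" for x
      using Suc.prems[THEN Ck_on_Suc_has_derivative, OF that] by (rule has_derivative_add)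
    show "Ck_on k S (\<lambda>x. frechet_derivative f (at x) v + frechet_derivative g (at x) v)" for v
      using Suc by auto
  qed
qed

lemma Ck_on_sum:
  assumes "open S" "\<And>i. i \<in> I \<Longrightarrow> Ck_on k S (f i)"
  shows "Ck_on k S (\<lambda>x. \<Sum>i\<in>I. f i x)"
  using assms(2) by (induction I rule: infinite_finite_induct)
    (auto intro: Ck_on_const Ck_on_add[OF assms(1)])

text \<open>One product rule serves multiplication, scaling and inner products. The derivative
  contains \<open>f\<close> and \<open>g\<close> themselves, which \<open>Ck_on_SucD\<close> lowers
  to class k for the induction hypothesis.\<close>

lemma Ck_on_bilinear:
  assumes "bounded_bilinear B" "open S"
  shows "Ck_on k S f \<Longrightarrow> Ck_on k S g \<Longrightarrow> Ck_on k S (\<lambda>x. B (f x) (g x))"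
proof (induction k arbitrary: f g)
  case 0
  then show ?case using bounded_bilinear.continuous_on[OF assms(1)] by simp
next
  case (Suc k)
  show ?case
  proof (rule Ck_on_SucI[OF assms(2)])
    show "((\<lambda>x. B (f x) (g x)) has_derivative
        (\<lambda>v. B (f x) (frechet_derivative g (at x) v) + B (frechet_derivative f (at x) v) (g x))) (at x)"
      if "x \<in> S" for x
      using Suc.prems[THEN Ck_on_Suc_has_derivative, OF that]
      by (rule bounded_bilinear.FDERIV[OF assms(1)])
    show "Ck_on k S (\<lambda>x. B (f x) (frechet_derivative g (at x) v) +
        B (frechet_derivative f (at x) v) (g x))" for v
      using Suc.prems[THEN Ck_on_SucD] Suc.prems
      by (intro Ck_on_add assms Suc.IH) auto
  qed
qed

lemma Ck_on_inverse:
  fixes f :: "_ \<Rightarrow> 'b::real_normed_field"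
  assumes "open S" "\<And>x. x \<in> S \<Longrightarrow> f x \<noteq> 0"
  shows "Ck_on k S f \<Longrightarrow> Ck_on k S (\<lambda>x. inverse (f x))"
proof (induction k)
  case 0
  then show ?case using assms by (simp add: continuous_on_inverse)
next
  case (Suc k)
  \<comment> \<open>The derivative of 1/f contains 1/f again; the induction hypothesis covers
    it.\<close>
  have i: "Ck_on k S (\<lambda>x. inverse (f x))"
    using Suc Ck_on_SucD by blast
  show ?case
  proof (rule Ck_on_SucI[OF assms(1)])
    show "((\<lambda>x. inverse (f x)) has_derivative
        (\<lambda>v. - (inverse (f x) * frechet_derivative f (at x) v * inverse (f x)))) (at x)"
      if "x \<in> S" for x
      using Ck_on_Suc_has_derivative[OF Suc.prems that] assms(2)[OF that]
      by (auto intro!: has_derivative_inverse)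
    have "Ck_on k S (\<lambda>x. inverse (f x) * frechet_derivative f (at x) v * inverse (f x))" for v
      using Suc.prems i by (intro Ck_on_bilinear[OF bounded_bilinear_mult] assms(1)) auto
    then show "Ck_on k S (\<lambda>x. - (inverse (f x) * frechet_derivative f (at x) v * inverse (f x)))" for v
      by (rule Ck_on_compose_linear[OF bounded_linear_minus[OF bounded_linear_ident] assms(1)])
  qed
qed

lemma Ck_on_compose:
  fixes f :: "'a::real_normed_vector \<Rightarrow> 'b::euclidean_space"
  assumes "open S" "open T" "f ` S \<subseteq> T"
  shows "Ck_on k S f \<Longrightarrow> Ck_on k T g \<Longrightarrow> Ck_on k S (\<lambda>x. g (f x))"
proof (induction k arbitrary: g)
  case 0
  then show ?case using continuous_on_compose2 assms(3) by (metis Ck_on.simps(1))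
next
  case (Suc k)
  let ?f' = "\<lambda>x. frechet_derivative f (at x)" and ?g' = "\<lambda>x. frechet_derivative g (at (f x))"
  show ?case
  proof (rule Ck_on_SucI[OF assms(1)])
    fix x assume x: "x \<in> S"
    have f: "(f has_derivative ?f' x) (at x)" and g: "(g has_derivative ?g' x) (at (f x))"
      using Suc.prems[THEN Ck_on_Suc_has_derivative] x assms(3) by blast+
    have "((\<lambda>x. g (f x)) has_derivative (\<lambda>v. ?g' x (?f' x v))) (at x)"
      using diff_chain_at[OF f g] by (simp add: o_def)
    \<comment> \<open>\<open>Ck_on\<close> controls derivatives in fixed directions only, while the
      direction \<open>?f' x v\<close> moves with x. Expanding it in the basis of the Euclidean
      middle space leaves fixed directions with varying scalar coefficients.\<close>
    moreover have "?g' x (?f' x v) = (\<Sum>b\<in>Basis. (?f' x v \<bullet> b) *\<^sub>R ?g' x b)" for v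
    proof -
      have l: "linear (?g' x)" using g has_derivative_linear by blast
      have "?g' x (?f' x v) = ?g' x (\<Sum>b\<in>Basis. (?f' x v \<bullet> b) *\<^sub>R b)"
        by (simp add: euclidean_representation)
      then show ?thesis using l by (simp add: linear_sum linear_scale)
    qed
    ultimately show "((\<lambda>x. g (f x)) has_derivative
      (\<lambda>v. \<Sum>b\<in>Basis. (?f' x v \<bullet> b) *\<^sub>R ?g' x b)) (at x)" by simp
  next
    fix v
    have "Ck_on k S (\<lambda>x. ?g' x b)" for b
      using Suc.prems Ck_on_SucD[OF Suc.prems(1)] by (intro Suc.IH[of "\<lambda>y. frechet_derivative g (at y) b"]) auto
    moreover have "Ck_on k S (\<lambda>x. ?f' x v \<bullet> b)" for b
      using Suc.prems(1) by (intro Ck_on_compose_linear[OF bounded_linear_inner_left assms(1)]) auto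
    ultimately show "Ck_on k S (\<lambda>x. \<Sum>b\<in>Basis. (?f' x v \<bullet> b) *\<^sub>R ?g' x b)"
      by (intro Ck_on_sum Ck_on_bilinear[OF bounded_bilinear_scaleR] assms(1))
  qed
qed

text \<open>The family is closed under differentiation, with \<open>X^2 (p - p')\<close> in place of \<open>p\<close>.\<close>
definition flat :: "real poly \<Rightarrow> real \<Rightarrow> real" where
  "flat p t = (if t > 0 then poly p (1 / t) * exp (- (1 / t)) else 0)"

lemma poly_exp_tendsto_0: "((\<lambda>s. poly p s * exp (- s)) \<longlongrightarrow> 0) at_top" for p :: "real poly"
proof -
  have "((\<lambda>s. \<Sum>i\<le>degree p. coeff p i * (s ^ i / exp s)) \<longlongrightarrow> (\<Sum>i\<le>degree p. coeff p i * 0)) at_top"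
    by (intro tendsto_sum tendsto_mult tendsto_const tendsto_power_div_exp_0)
  moreover have "poly p s * exp (- s) = (\<Sum>i\<le>degree p. coeff p i * (s ^ i / exp s))" for s
    by (simp add: poly_altdef sum_distrib_right exp_minus divide_inverse mult.assoc)
  ultimately show ?thesis by simp
qed

text \<open>For t > 0 the chain rule gives (p - p')(1/t) exp(-1/t) / t^2, whence the factor
  \<open>[:0, 0, 1:]\<close>. For t < 0 both sides vanish, and at 0 the exponential beats every
  polynomial in 1/t.\<close>

lemma flat_has_derivative:
  "(flat p has_real_derivative flat ([:0, 0, 1:] * (p - pderiv p)) t) (at t)"
proof -
  consider "t > 0" | "t < 0" | "t = 0" by linarith
  then show ?thesis
  proof cases
    case 1
    have "((\<lambda>t. poly p (1 / t) * exp (- (1 / t))) has_real_derivative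
        flat ([:0, 0, 1:] * (p - pderiv p)) t) (at t)"
    proof -
      have i: "((\<lambda>t. 1 / t) has_real_derivative - (1 / t * (1 / t))) (at t)"
        using 1 by (auto intro!: derivative_eq_intros)
      show ?thesis
        using DERIV_mult[OF DERIV_chain2[OF poly_DERIV i] DERIV_chain2[OF DERIV_exp DERIV_minus[OF i]]] 1
        by (simp add: flat_def algebra_simps)
    qed
    then show ?thesis
      by (rule has_field_derivative_transform_within_open[of _ _ _ "{0<..}"])
        (use 1 in \<open>auto simp: flat_def\<close>)
  next
    case 2
    have "(flat p has_real_derivative 0) (at t)"
      by (rule has_field_derivative_transform_within_open[OF DERIV_const[of 0], of "{..<0}"])
        (use 2 in \<open>auto simp: flat_def\<close>)
    with 2 show ?thesis by (simp add: flat_def)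
  next
    case 3
    \<comment> \<open>\<open>pCons 0 p\<close> is X p: with s = 1/h the difference quotient p(1/h)
      exp(-1/h) / h becomes s p(s) exp(-s).\<close>
    have "((\<lambda>h. poly (pCons 0 p) (inverse h) * exp (- inverse h)) \<longlongrightarrow> 0) (at_right 0)"
      using filterlim_compose[OF poly_exp_tendsto_0 filterlim_inverse_at_top_right] .
    then have "((\<lambda>h. flat p h / h) \<longlongrightarrow> 0) (at_right 0)"
      by (rule Lim_transform_eventually)
        (auto simp: eventually_at_filter flat_def divide_inverse)
    moreover have "((\<lambda>h. flat p h / h) \<longlongrightarrow> 0) (at_left 0)"
      by (rule Lim_transform_eventually[OF tendsto_const[of 0]])
        (auto simp: eventually_at_filter flat_def)
    ultimately show ?thesis
      using 3 by (simp add: DERIV_def flat_def filterlim_at_split)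
  qed
qed

lemma Ck_on_flat: "Ck_on k UNIV (flat p)"
proof (induction k arbitrary: p)
  case 0
  have "continuous_on UNIV (flat p)"
    by (intro continuous_at_imp_continuous_on ballI DERIV_isCont[OF flat_has_derivative])
  then show ?case by simp
next
  case (Suc k)
  show ?case
  proof (rule Ck_on_SucI)
    show "(flat p has_derivative (\<lambda>v. v * flat ([:0, 0, 1:] * (p - pderiv p)) x)) (at x)" for x
      using flat_has_derivative[of p x] by (simp add: has_field_derivative_def mult_commute_abs)
    show "Ck_on k UNIV (\<lambda>x. v * flat ([:0, 0, 1:] * (p - pderiv p)) x)" for v
      by (intro Ck_on_compose_linear[OF bounded_linear_mult_right] Suc) auto
  qed simp
qed

section \<open>Symmetry of second derivatives\<close>

text \<open>The mean value theorem is applied twice: to r \<mapsto> f(x + r v + s w) - f(x + r v),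
  and then along w to the derivative that results. The intermediate points fill the parallelogram,
  hence the domain condition on all of it.\<close>

lemma second_difference_mean_value:
  fixes f :: "'a::real_normed_vector \<Rightarrow> real"
  assumes S: "Ck_on 2 S f" and s: "0 < s"
    and box: "\<And>r t. 0 \<le> r \<Longrightarrow> r \<le> s \<Longrightarrow> 0 \<le> t \<Longrightarrow> t \<le> s \<Longrightarrow> x + r *\<^sub>R v + t *\<^sub>R w \<in> S"
  shows "\<exists>r t. 0 < r \<and> r < s \<and> 0 < t \<and> t < s \<and>
    f (x + s *\<^sub>R v + s *\<^sub>R w) - f (x + s *\<^sub>R v) - f (x + s *\<^sub>R w) + f x =
    s * s * frechet_derivative (\<lambda>y. frechet_derivative f (at y) v) (at (x + r *\<^sub>R v + t *\<^sub>R w)) w"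
proof -
  let ?D = "\<lambda>v y. frechet_derivative f (at y) v"
  have f: "(f has_derivative frechet_derivative f (at y)) (at y)" if "y \<in> S" for y
    using S that by (simp add: numeral_2_eq_2 frechet_derivative_works)
  have D: "(?D v has_derivative frechet_derivative (?D v) (at y)) (at y)" if "y \<in> S" for y
    using S that by (simp add: numeral_2_eq_2 frechet_derivative_works)
  have lin: "F (h *\<^sub>R z) = h * F z" if "(g has_derivative F) (at y)" for g :: "'a \<Rightarrow> real" and F h z y
    using linear_scale[OF has_derivative_linear[OF that]] by simp
  have df: "((\<lambda>r. f (x + r *\<^sub>R v + t *\<^sub>R w)) has_real_derivative ?D v (x + r *\<^sub>R v + t *\<^sub>R w)) (at r)"
    if "0 \<le> r" "r \<le> s" "0 \<le> t" "t \<le> s" for r t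
  proof -
    have "((\<lambda>r. x + r *\<^sub>R v + t *\<^sub>R w) has_derivative (\<lambda>h. h *\<^sub>R v)) (at r)"
      by (auto intro!: derivative_eq_intros)
    from diff_chain_at[OF this f[OF box[OF that]]]
    show ?thesis
      using lin[OF f[OF box[OF that]]] by (simp add: o_def has_field_derivative_def mult.commute[of _ "?D v _"])
  qed
  have dD: "((\<lambda>t. ?D v (x + r *\<^sub>R v + t *\<^sub>R w)) has_real_derivative
      frechet_derivative (?D v) (at (x + r *\<^sub>R v + t *\<^sub>R w)) w) (at t)"
    if "0 \<le> r" "r \<le> s" "0 \<le> t" "t \<le> s" for r t
  proof -
    have "((\<lambda>t. x + r *\<^sub>R v + t *\<^sub>R w) has_derivative (\<lambda>h. h *\<^sub>R w)) (at t)"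
      by (auto intro!: derivative_eq_intros)
    from diff_chain_at[OF this D[OF box[OF that]]]
    show ?thesis
      using lin[OF D[OF box[OF that]]]
      by (simp add: o_def has_field_derivative_def mult.commute[of _ "frechet_derivative (?D v) _ _"])
  qed
  have "\<exists>r. 0 < r \<and> r < s \<and>
     (f (x + s *\<^sub>R v + s *\<^sub>R w) - f (x + s *\<^sub>R v + 0 *\<^sub>R w)) - (f (x + 0 *\<^sub>R v + s *\<^sub>R w) - f (x + 0 *\<^sub>R v + 0 *\<^sub>R w)) =
     (s - 0) * (?D v (x + r *\<^sub>R v + s *\<^sub>R w) - ?D v (x + r *\<^sub>R v + 0 *\<^sub>R w))"
    using s by (intro MVT2 DERIV_diff df) auto
  then obtain r where r: "0 < r" "r < s" and
    1: "f (x + s *\<^sub>R v + s *\<^sub>R w) - f (x + s *\<^sub>R v) - f (x + s *\<^sub>R w) + f x =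
      s * (?D v (x + r *\<^sub>R v + s *\<^sub>R w) - ?D v (x + r *\<^sub>R v + 0 *\<^sub>R w))"
    by auto
  have "\<exists>t. 0 < t \<and> t < s \<and> ?D v (x + r *\<^sub>R v + s *\<^sub>R w) - ?D v (x + r *\<^sub>R v + 0 *\<^sub>R w) =
     (s - 0) * frechet_derivative (?D v) (at (x + r *\<^sub>R v + t *\<^sub>R w)) w"
    using s r by (intro MVT2 dD) auto
  with r 1 show ?thesis by (auto simp: mult.assoc)
qed

text \<open>The second difference over a parallelogram is symmetric in v and w. So the two mixed
  derivatives, each taken at some point near x, agree; shrinking the parallelogram moves both points
  to x, and continuity concludes.\<close>

lemma symmetric_second_derivative:
  fixes f :: "'a::real_normed_vector \<Rightarrow> real"
  assumes S: "open S" "x \<in> S" and f: "Ck_on 2 S f"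
  shows "frechet_derivative (\<lambda>y. frechet_derivative f (at y) v) (at x) w =
    frechet_derivative (\<lambda>y. frechet_derivative f (at y) w) (at x) v"
proof -
  let ?G = "\<lambda>v w y. frechet_derivative (\<lambda>y. frechet_derivative f (at y) v) (at y) w"
  have "continuous_on S (?G v w)" for v w
    using f by (simp add: numeral_2_eq_2)
  then have cont: "isCont (?G v w) x" for v w
    using S by (simp add: continuous_on_eq_continuous_at)
  obtain e where e: "e > 0" "ball x e \<subseteq> S" using S openE by blast
  \<comment> \<open>The summand 1 makes M positive and the bound \<open>bd\<close> strict; the sides
    \<open>s n\<close> then keep the parallelogram inside the ball of radius e.\<close>
  define M where "M = norm v + norm w + 1"
  have M: "M > 0" by (simp add: M_def add_nonneg_pos)
  define s where "s n = e / M * inverse (real (Suc n))" for n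
  have s: "0 < s n" "s n * M \<le> e" for n
  proof -
    show "0 < s n" using e M by (simp add: s_def)
    have "s n * M = e * inverse (real (Suc n))" using M by (simp add: s_def)
    also have "\<dots> \<le> e * 1" using e by (intro mult_left_mono) (auto simp: inverse_le_1_iff)
    finally show "s n * M \<le> e" by simp
  qed
  have bd: "norm (r *\<^sub>R v + t *\<^sub>R w) < s n * M"
    if "0 \<le> r" "r \<le> s n" "0 \<le> t" "t \<le> s n" for r t n
  proof -
    have "norm (r *\<^sub>R v + t *\<^sub>R w) \<le> r * norm v + t * norm w"
      using that norm_triangle_ineq[of "r *\<^sub>R v" "t *\<^sub>R w"] by simp
    also have "\<dots> \<le> s n * norm v + s n * norm w"
      using that by (intro add_mono mult_right_mono) auto
    also have "\<dots> < s n * M" using s(1)[of n] by (simp add: M_def algebra_simps)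
    finally show ?thesis .
  qed
  have box: "x + (r *\<^sub>R v + t *\<^sub>R w) \<in> S"
    if "0 \<le> r" "r \<le> s n" "0 \<le> t" "t \<le> s n" for r t n
    using bd[OF that] s(2)[of n] e(2) by (auto simp: dist_norm norm_minus_commute subset_iff)
  have "\<exists>a. norm a < s n * M \<and> (\<exists>b. norm b < s n * M \<and> ?G v w (x + a) = ?G w v (x + b))" for n
  proof -
    obtain r t where 1: "0 < r" "r < s n" "0 < t" "t < s n"
      "f (x + s n *\<^sub>R v + s n *\<^sub>R w) - f (x + s n *\<^sub>R v) - f (x + s n *\<^sub>R w) + f x =
        s n * s n * ?G v w (x + r *\<^sub>R v + t *\<^sub>R w)"
      using second_difference_mean_value[OF f s(1), of n x v w] box by (auto simp: add.assoc)
    obtain r' t' where 2: "0 < r'" "r' < s n" "0 < t'" "t' < s n"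
      "f (x + s n *\<^sub>R w + s n *\<^sub>R v) - f (x + s n *\<^sub>R w) - f (x + s n *\<^sub>R v) + f x =
        s n * s n * ?G w v (x + r' *\<^sub>R w + t' *\<^sub>R v)"
      using second_difference_mean_value[OF f s(1), of n x w v] box
      by (auto simp: add.assoc) (metis add.commute)
    have "?G v w (x + (r *\<^sub>R v + t *\<^sub>R w)) = ?G w v (x + (t' *\<^sub>R v + r' *\<^sub>R w))"
      using 1 2 s(1)[of n] by (simp add: algebra_simps)
    then show ?thesis using bd 1(1-4) 2(1-4) by (meson less_imp_le)
  qed
  then obtain a b where ab: "\<And>n. norm (a n) < s n * M" "\<And>n. norm (b n) < s n * M"
    "\<And>n. ?G v w (x + a n) = ?G w v (x + b n)" by metis
  have "(\<lambda>n. s n * M) \<longlonglongrightarrow> e / M * 0 * M"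
    unfolding s_def by (intro tendsto_mult tendsto_const LIMSEQ_inverse_real_of_nat)
  then have "(\<lambda>n. s n * M) \<longlonglongrightarrow> 0" by simp
  then have "a \<longlonglongrightarrow> 0" "b \<longlonglongrightarrow> 0"
    by - (rule Lim_null_comparison[OF eventuallyI], rule less_imp_le, rule ab, assumption)+
  then have "(\<lambda>n. x + a n) \<longlonglongrightarrow> x" "(\<lambda>n. x + b n) \<longlonglongrightarrow> x"
    using tendsto_add[OF tendsto_const[of x]] by force+
  then have "(\<lambda>n. ?G v w (x + a n)) \<longlonglongrightarrow> ?G v w x" "(\<lambda>n. ?G w v (x + b n)) \<longlonglongrightarrow> ?G w v x"
    using isCont_tendsto_compose[OF cont] by blast+
  then show ?thesis using LIMSEQ_unique ab(3) by simp
qed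

section \<open>Rules for smooth maps, and smooth step functions\<close>

lemma smooth_on_frechet: "smooth_on S f \<Longrightarrow> smooth_on S (\<lambda>x. frechet_derivative f (at x) v)"
  unfolding smooth_on_def by (metis Ck_on.simps(2))

lemma smooth_on_differentiable: "smooth_on S f \<Longrightarrow> x \<in> S \<Longrightarrow> f differentiable (at x)"
  unfolding smooth_on_def by (metis Ck_on.simps(2))

lemma smooth_on_cong:
  "open S \<Longrightarrow> (\<And>y. y \<in> S \<Longrightarrow> f y = g y) \<Longrightarrow> smooth_on S f \<longleftrightarrow> smooth_on S g"
  unfolding smooth_on_def using Ck_on_cong by blast

lemma smooth_on_subset: "smooth_on S f \<Longrightarrow> T \<subseteq> S \<Longrightarrow> smooth_on T f"
  unfolding smooth_on_def using Ck_on_subset by blast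

lemma smooth_on_local:
  "(\<And>x. x \<in> S \<Longrightarrow> \<exists>T. open T \<and> x \<in> T \<and> smooth_on T f) \<Longrightarrow> smooth_on S f"
  unfolding smooth_on_def by (intro allI Ck_on_local) blast

lemma smooth_on_const: "smooth_on S (\<lambda>x. c)"
  by (simp add: smooth_on_def Ck_on_const)

lemma smooth_on_linear: "bounded_linear L \<Longrightarrow> open S \<Longrightarrow> smooth_on S L"
  by (simp add: smooth_on_def Ck_on_linear)

lemma smooth_on_compose_linear:
  "bounded_linear L \<Longrightarrow> open S \<Longrightarrow> smooth_on S f \<Longrightarrow> smooth_on S (\<lambda>x. L (f x))"
  by (simp add: smooth_on_def Ck_on_compose_linear)

lemma smooth_on_add:
  "open S \<Longrightarrow> smooth_on S f \<Longrightarrow> smooth_on S g \<Longrightarrow> smooth_on S (\<lambda>x. f x + g x)"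
  by (simp add: smooth_on_def Ck_on_add)

lemma smooth_on_bilinear:
  "bounded_bilinear B \<Longrightarrow> open S \<Longrightarrow> smooth_on S f \<Longrightarrow> smooth_on S g \<Longrightarrow>
    smooth_on S (\<lambda>x. B (f x) (g x))"
  by (simp add: smooth_on_def Ck_on_bilinear)

lemma smooth_on_inverse:
  fixes f :: "_ \<Rightarrow> 'b::real_normed_field"
  shows "open S \<Longrightarrow> (\<And>x. x \<in> S \<Longrightarrow> f x \<noteq> 0) \<Longrightarrow> smooth_on S f \<Longrightarrow>
    smooth_on S (\<lambda>x. inverse (f x))"
  by (simp add: smooth_on_def Ck_on_inverse)

lemma smooth_on_compose:
  fixes f :: "'a::real_normed_vector \<Rightarrow> 'b::euclidean_space"
  shows "open S \<Longrightarrow> open T \<Longrightarrow> f ` S \<subseteq> T \<Longrightarrow> smooth_on S f \<Longrightarrow> smooth_on T g \<Longrightarrow>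
    smooth_on S (\<lambda>x. g (f x))"
  unfolding smooth_on_def using Ck_on_compose by blast

text \<open>The quotient l / (l + r) of flat functions, where l vanishes from b on and r up to a.
  Since a < b, they have no common zero and the denominator does not vanish.\<close>

lemma smooth_step:
  assumes "a < b"
  obtains f :: "real \<Rightarrow> real" where "smooth_on UNIV f"
    "\<And>t. t \<le> a \<Longrightarrow> f t = 1" "\<And>t. t \<ge> b \<Longrightarrow> f t = 0"
proof
  let ?l = "\<lambda>t. flat 1 (b - t)" and ?r = "\<lambda>t. flat 1 (t - a)"
  let ?f = "\<lambda>t. ?l t * inverse (?l t + ?r t)"
  have fl: "flat 1 t \<ge> 0" "flat 1 t = 0 \<longleftrightarrow> t \<le> 0" for t
    by (auto simp: flat_def)
  have p: "?l t + ?r t \<noteq> 0" for t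
    using fl(1)[of "b - t"] fl(1)[of "t - a"] fl(2)[of "b - t"] fl(2)[of "t - a"] assms
    by (smt (verit))
  have u: "smooth_on UNIV (flat 1)" by (simp add: smooth_on_def Ck_on_flat)
  have id: "smooth_on UNIV (\<lambda>t::real. t)" by (intro smooth_on_linear) (auto intro: bounded_linear_ident)
  have "smooth_on UNIV (\<lambda>t. b + - t)" "smooth_on UNIV (\<lambda>t. t + - a)"
    by (intro smooth_on_add smooth_on_const id open_UNIV
        smooth_on_compose_linear[OF bounded_linear_minus[OF bounded_linear_ident]])+
  then have lr: "smooth_on UNIV ?l" "smooth_on UNIV ?r"
    using smooth_on_compose[OF open_UNIV open_UNIV subset_UNIV _ u] by simp_all
  show "smooth_on UNIV ?f"
    by (intro smooth_on_bilinear[OF bounded_bilinear_mult] smooth_on_inverse smooth_on_add lr p open_UNIV)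
  show "?f t = 1" if "t \<le> a" for t
    using p[of t] fl(2)[of "t - a"] that by simp
  show "?f t = 0" if "t \<ge> b" for t
    using fl(2)[of "b - t"] that by simp
qed

section \<open>Smooth functions on manifolds\<close>

locale smooth_manifold =
  fixes A :: "('a::{t2_space, second_countable_topology}, 'n::finite) chart set"
  assumes atlas: "smooth_atlas A"
begin

abbreviation smooth :: "('a \<Rightarrow> 'f::real_normed_vector) \<Rightarrow> bool" where
  "smooth \<equiv> smooth_fun_on A UNIV"

lemma chart_open: "(U, \<phi>) \<in> A \<Longrightarrow> open U"
  and chart_homeo: "(U, \<phi>) \<in> A \<Longrightarrow> homeomorphism U (\<phi> ` U) \<phi> (inv_into U \<phi>)"
  and chart_open_image: "(U, \<phi>) \<in> A \<Longrightarrow> open (\<phi> ` U)"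
  using atlas unfolding smooth_atlas_def is_chart_def by auto

lemma chart_inv: "(U, \<phi>) \<in> A \<Longrightarrow> p \<in> U \<Longrightarrow> inv_into U \<phi> (\<phi> p) = p"
  by (rule homeomorphism_apply1[OF chart_homeo])

lemma chart_exists: "\<exists>U \<phi>. (U, \<phi>) \<in> A \<and> p \<in> U"
proof -
  have "p \<in> \<Union> (fst ` A)" using atlas by (simp add: smooth_atlas_def)
  then show ?thesis by auto
qed

lemma chart_image_open:
  assumes "(U, \<phi>) \<in> A" "open W"
  shows "open (\<phi> ` (W \<inter> U))"
proof -
  have "openin (top_of_set (\<phi> ` U)) (\<phi> ` (W \<inter> U))"
    using homeomorphism_imp_open_map[OF chart_homeo[OF assms(1)]] assms
    by (simp add: openin_open_Int Int_commute)
  then show ?thesis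
    using chart_open_image[OF assms(1)] openin_open_trans by blast
qed

lemma smooth_fun_on_chartD:
  "smooth_fun_on A W f \<Longrightarrow> (U, \<phi>) \<in> A \<Longrightarrow> smooth_on (\<phi> ` (W \<inter> U)) (f \<circ> inv_into U \<phi>)"
  unfolding smooth_fun_on_def by auto

lemma smooth_fun_onI:
  "(\<And>U \<phi>. (U, \<phi>) \<in> A \<Longrightarrow> smooth_on (\<phi> ` (W \<inter> U)) (\<lambda>x. f (inv_into U \<phi> x))) \<Longrightarrow>
    smooth_fun_on A W f"
  unfolding smooth_fun_on_def by (auto simp: o_def)

lemma smooth_fun_on_cong:
  assumes "open W" "\<And>p. p \<in> W \<Longrightarrow> f p = g p"
  shows "smooth_fun_on A W f \<longleftrightarrow> smooth_fun_on A W g"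
proof -
  have "smooth_on (\<phi> ` (W \<inter> U)) (f \<circ> inv_into U \<phi>) \<longleftrightarrow> smooth_on (\<phi> ` (W \<inter> U)) (g \<circ> inv_into U \<phi>)"
    if "(U, \<phi>) \<in> A" for U \<phi>
    using chart_image_open[OF that assms(1)] assms(2) chart_inv[OF that]
    by (intro smooth_on_cong) auto
  then show ?thesis unfolding smooth_fun_on_def by (metis (no_types, lifting) case_prodI2 case_prodD)
qed

lemma smooth_fun_on_subset:
  "smooth_fun_on A W f \<Longrightarrow> V \<subseteq> W \<Longrightarrow> smooth_fun_on A V f"
  unfolding smooth_fun_on_def by (auto intro: smooth_on_subset)

lemma smooth_fun_on_local:
  assumes "\<And>p. p \<in> W \<Longrightarrow> \<exists>V. open V \<and> p \<in> V \<and> smooth_fun_on A V f"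
  shows "smooth_fun_on A W f"
proof (rule smooth_fun_onI, rule smooth_on_local)
  fix U \<phi> x assume c: "(U, \<phi>) \<in> A" and "x \<in> \<phi> ` (W \<inter> U)"
  then obtain p where p: "p \<in> W" "p \<in> U" "x = \<phi> p" by auto
  then obtain V where V: "open V" "p \<in> V" "smooth_fun_on A V f" using assms by blast
  then show "\<exists>T. open T \<and> x \<in> T \<and> smooth_on T (\<lambda>x. f (inv_into U \<phi> x))"
    using chart_image_open[OF c V(1)] smooth_fun_on_chartD[OF V(3) c] p
    by (intro exI[of _ "\<phi> ` (V \<inter> U)"]) (auto simp: o_def)
qed

text \<open>The smooth transition maps carry smoothness from the one chart to all others.\<close>

lemma smooth_fun_on_chartI:
  fixes f :: "'a \<Rightarrow> 'f::real_normed_vector"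
  assumes c: "(U, \<phi>) \<in> A" and W: "open W" "W \<subseteq> U" and f: "smooth_on (\<phi> ` W) (f \<circ> inv_into U \<phi>)"
  shows "smooth_fun_on A W f"
proof (rule smooth_fun_onI)
  fix V \<psi> assume d: "(V, \<psi>) \<in> A"
  have "smooth_on (\<psi> ` (V \<inter> U)) (\<phi> \<circ> inv_into V \<psi>)"
    using atlas c d unfolding smooth_atlas_def by fast
  then have t: "smooth_on (\<psi> ` (W \<inter> V)) (\<phi> \<circ> inv_into V \<psi>)"
    using W by (auto intro: smooth_on_subset)
  have o: "open (\<psi> ` (W \<inter> V))" "open (\<phi> ` W)"
    using chart_image_open[OF d W(1)] chart_image_open[OF c W(1)] W(2)
    by (simp_all add: Int_absorb2)
  have "(\<phi> \<circ> inv_into V \<psi>) ` \<psi> ` (W \<inter> V) \<subseteq> \<phi> ` W"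
    using chart_inv[OF d] by auto
  from smooth_on_compose[OF o this t f]
  show "smooth_on (\<psi> ` (W \<inter> V)) (\<lambda>x. f (inv_into V \<psi> x))"
    by (rule iffD1[OF smooth_on_cong[OF o(1)], rotated])
      (use W chart_inv[OF d] chart_inv[OF c] in auto)
qed

lemma smooth_fun_on_chart_map:
  assumes "(U, \<phi>) \<in> A"
  shows "smooth_fun_on A U \<phi>"
proof -
  have o: "open (\<phi> ` U)" using assms by (rule chart_open_image)
  have "smooth_on (\<phi> ` U) (\<phi> \<circ> inv_into U \<phi>)"
    by (rule iffD1[OF smooth_on_cong[OF o] smooth_on_linear[OF bounded_linear_ident o]])
      (use chart_inv[OF assms] in auto)
  then show ?thesis
    using assms chart_open by (intro smooth_fun_on_chartI) auto
qed

lemma smooth_fun_on_compose: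
  fixes f :: "'a \<Rightarrow> 'e::euclidean_space"
  assumes "open W" "open T" "f ` W \<subseteq> T" "smooth_fun_on A W f" "smooth_on T g"
  shows "smooth_fun_on A W (\<lambda>p. g (f p))"
proof (rule smooth_fun_onI)
  fix U \<phi> assume c: "(U, \<phi>) \<in> A"
  have "(f \<circ> inv_into U \<phi>) ` \<phi> ` (W \<inter> U) \<subseteq> T"
    using assms(3) chart_inv[OF c] by auto
  from smooth_on_compose[OF chart_image_open[OF c assms(1)] assms(2) this
      smooth_fun_on_chartD[OF assms(4) c] assms(5)]
  show "smooth_on (\<phi> ` (W \<inter> U)) (\<lambda>x. g (f (inv_into U \<phi> x)))" by simp
qed

lemma smooth_fun_on_const [intro]: "smooth_fun_on A W (\<lambda>p. c)"
  by (intro smooth_fun_onI smooth_on_const)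

lemma smooth_fun_on_linear:
  assumes "bounded_linear L" "open W" "smooth_fun_on A W f"
  shows "smooth_fun_on A W (\<lambda>p. L (f p))"
proof (rule smooth_fun_onI)
  fix U \<phi> assume c: "(U, \<phi>) \<in> A"
  from smooth_on_compose_linear[OF assms(1) chart_image_open[OF c assms(2)]
      smooth_fun_on_chartD[OF assms(3) c]]
  show "smooth_on (\<phi> ` (W \<inter> U)) (\<lambda>x. L (f (inv_into U \<phi> x)))" by simp
qed

lemma smooth_fun_on_bilinear:
  assumes "bounded_bilinear B" "open W" "smooth_fun_on A W f" "smooth_fun_on A W g"
  shows "smooth_fun_on A W (\<lambda>p. B (f p) (g p))"
proof (rule smooth_fun_onI)
  fix U \<phi> assume c: "(U, \<phi>) \<in> A"
  from smooth_on_bilinear[OF assms(1) chart_image_open[OF c assms(2)]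
      smooth_fun_on_chartD[OF assms(3) c] smooth_fun_on_chartD[OF assms(4) c]]
  show "smooth_on (\<phi> ` (W \<inter> U)) (\<lambda>x. B (f (inv_into U \<phi> x)) (g (inv_into U \<phi> x)))" by simp
qed

lemma smooth_fun_on_add:
  assumes "open W" "smooth_fun_on A W f" "smooth_fun_on A W g"
  shows "smooth_fun_on A W (\<lambda>p. f p + g p)"
proof (rule smooth_fun_onI)
  fix U \<phi> assume c: "(U, \<phi>) \<in> A"
  from smooth_on_add[OF chart_image_open[OF c assms(1)]
      smooth_fun_on_chartD[OF assms(2) c] smooth_fun_on_chartD[OF assms(3) c]]
  show "smooth_on (\<phi> ` (W \<inter> U)) (\<lambda>x. f (inv_into U \<phi> x) + g (inv_into U \<phi> x))" by simp
qed

lemma smooth_fun_on_inverse: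
  fixes f :: "'a \<Rightarrow> 'f::real_normed_field"
  assumes "open W" "\<And>p. p \<in> W \<Longrightarrow> f p \<noteq> 0" "smooth_fun_on A W f"
  shows "smooth_fun_on A W (\<lambda>p. inverse (f p))"
proof (rule smooth_fun_onI)
  fix U \<phi> assume c: "(U, \<phi>) \<in> A"
  have "(f \<circ> inv_into U \<phi>) x \<noteq> 0" if "x \<in> \<phi> ` (W \<inter> U)" for x
    using that assms(2) chart_inv[OF c] by auto
  from smooth_on_inverse[OF chart_image_open[OF c assms(1)] this smooth_fun_on_chartD[OF assms(3) c]]
  show "smooth_on (\<phi> ` (W \<inter> U)) (\<lambda>x. inverse (f (inv_into U \<phi> x)))" by simp
qed

context
  fixes W :: "'a set"
  assumes W: "open W"
begin

lemma smooth_fun_on_minus: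
  "smooth_fun_on A W f \<Longrightarrow> smooth_fun_on A W (\<lambda>p. - f p)"
  by (rule smooth_fun_on_linear[OF bounded_linear_minus[OF bounded_linear_ident] W])

lemma smooth_fun_on_diff:
  "smooth_fun_on A W f \<Longrightarrow> smooth_fun_on A W g \<Longrightarrow> smooth_fun_on A W (\<lambda>p. f p - g p)"
  using smooth_fun_on_add[OF W _ smooth_fun_on_minus] by force

lemma smooth_fun_on_mult:
  fixes f g :: "'a \<Rightarrow> 'f::real_normed_algebra"
  shows "smooth_fun_on A W f \<Longrightarrow> smooth_fun_on A W g \<Longrightarrow> smooth_fun_on A W (\<lambda>p. f p * g p)"
  by (rule smooth_fun_on_bilinear[OF bounded_bilinear_mult W])

lemma smooth_fun_on_scaleR:
  "smooth_fun_on A W f \<Longrightarrow> smooth_fun_on A W g \<Longrightarrow> smooth_fun_on A W (\<lambda>p. f p *\<^sub>R g p)"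
  by (rule smooth_fun_on_bilinear[OF bounded_bilinear_scaleR W])

lemma smooth_fun_on_cnj: "smooth_fun_on A W f \<Longrightarrow> smooth_fun_on A W (\<lambda>p. cnj (f p))"
  by (rule smooth_fun_on_linear[OF bounded_linear_cnj W])

lemma smooth_fun_on_Re: "smooth_fun_on A W f \<Longrightarrow> smooth_fun_on A W (\<lambda>p. Re (f p))"
  by (rule smooth_fun_on_linear[OF bounded_linear_Re W])

lemma smooth_fun_on_Im: "smooth_fun_on A W f \<Longrightarrow> smooth_fun_on A W (\<lambda>p. Im (f p))"
  by (rule smooth_fun_on_linear[OF bounded_linear_Im W])

lemma smooth_fun_on_of_real:
  "smooth_fun_on A W f \<Longrightarrow>
    smooth_fun_on A W (\<lambda>p. of_real (f p) :: 'f::{real_normed_algebra_1})"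
  by (rule smooth_fun_on_linear[OF bounded_linear_of_real W])

lemma smooth_fun_on_sum:
  "(\<And>i. i \<in> I \<Longrightarrow> smooth_fun_on A W (f i)) \<Longrightarrow> smooth_fun_on A W (\<lambda>p. \<Sum>i\<in>I. f i p)"
  by (induction I rule: infinite_finite_induct)
    (auto intro: smooth_fun_on_add[OF W])

lemma smooth_fun_on_prod:
  fixes f :: "_ \<Rightarrow> 'a \<Rightarrow> 'f::{real_normed_algebra, comm_ring_1}"
  shows "(\<And>i. i \<in> I \<Longrightarrow> smooth_fun_on A W (f i)) \<Longrightarrow> smooth_fun_on A W (\<lambda>p. \<Prod>i\<in>I. f i p)"
  by (induction I rule: infinite_finite_induct)
    (auto intro: smooth_fun_on_mult)

end

lemmas smooth_fun_on_intros =
  smooth_fun_on_const smooth_fun_on_add smooth_fun_on_minus smooth_fun_on_diff smooth_fun_on_mult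
  smooth_fun_on_scaleR smooth_fun_on_cnj smooth_fun_on_Re smooth_fun_on_Im smooth_fun_on_of_real
  smooth_fun_on_sum smooth_fun_on_prod

lemmas smooth_intros = smooth_fun_on_const smooth_fun_on_intros(2-)[OF open_UNIV]

section \<open>Bump functions and cut-offs\<close>

text \<open>A step function of the squared coordinate distance to p, extended by zero outside a
  chart. The closed set K outside of which \<open>b\<close> vanishes is part of the conclusion
  because cutting off a local object relies on the open cover by W and the complement of K.\<close>

lemma bump:
  assumes "open W" "p \<in> W"
  obtains b :: "'a \<Rightarrow> real" and V K where "smooth b" "open V" "p \<in> V" "V \<subseteq> W"
    "\<And>q. q \<in> V \<Longrightarrow> b q = 1" "closed K" "K \<subseteq> W" "\<And>q. q \<notin> K \<Longrightarrow> b q = 0"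
proof -
  obtain U \<phi> where c: "(U, \<phi>) \<in> A" and p: "p \<in> U" using chart_exists by blast
  let ?S = "\<phi> ` (W \<inter> U)" and ?g = "inv_into U \<phi>"
  have S: "open ?S" "\<phi> p \<in> ?S" using chart_image_open[OF c assms(1)] p assms(2) by auto
  then obtain r where r: "r > 0" "cball (\<phi> p) r \<subseteq> ?S" using open_contains_cball by blast
  \<comment> \<open>With these thresholds \<open>b\<close> is 1 where the coordinate distance is at
    most r/2 and vanishes where it is at least r. The distance enters squared since the square is
    smooth also at p.\<close>
  obtain s :: "real \<Rightarrow> real" where s: "smooth_on UNIV s"
    "\<And>t. t \<le> r^2 / 4 \<Longrightarrow> s t = 1" "\<And>t. t \<ge> r^2 / 2 \<Longrightarrow> s t = 0"
    using smooth_step[of "r^2 / 4" "r^2 / 2"] r by (auto simp: field_simps)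
  define d where "d q = (\<phi> q - \<phi> p) \<bullet> (\<phi> q - \<phi> p)" for q
  define b where "b q = (if q \<in> U then s (d q) else 0)" for q
  define K where "K = ?g ` cball (\<phi> p) r"
  define V where "V = {q \<in> U. \<phi> q \<in> ball (\<phi> p) (r / 2)}"
  have cg: "continuous_on (\<phi> ` U) ?g" and cf: "continuous_on U \<phi>"
    using chart_homeo[OF c] by (auto simp: homeomorphism_def)
  have "cball (\<phi> p) r \<subseteq> \<phi> ` U" using r(2) by blast
  \<comment> \<open>Compactness makes K closed in the whole Hausdorff space and not merely in the
    chart domain; the extension by zero is smooth for this reason.\<close>
  then have "compact K" unfolding K_def
    by (intro compact_continuous_image continuous_on_subset[OF cg] compact_cball)
  then have K: "closed K" by (rule compact_imp_closed)
  have KW: "K \<subseteq> W \<inter> U"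
  proof
    fix q assume "q \<in> K"
    then obtain x where x: "x \<in> cball (\<phi> p) r" "q = ?g x" by (auto simp: K_def)
    then obtain q' where "q' \<in> W \<inter> U" "x = \<phi> q'" using r(2) by blast
    with x chart_inv[OF c] show "q \<in> W \<inter> U" by auto
  qed
  have dd: "d q = (dist (\<phi> p) (\<phi> q))^2" for q
    by (simp add: d_def dist_norm power2_norm_eq_inner norm_minus_commute[of "\<phi> p"])
  have z: "b q = 0" if "q \<notin> K" for q
  proof (cases "q \<in> U")
    case True
    have "\<phi> q \<notin> cball (\<phi> p) r"
      using that chart_inv[OF c True] unfolding K_def by (metis imageI)
    then have "dist (\<phi> p) (\<phi> q) > r" by simp
    then have "r^2 \<le> d q" using r(1) unfolding dd by (intro power_mono) auto
    then have "d q \<ge> r^2 / 2" using r(1) zero_le_power2[of r] by linarith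
    then show ?thesis using s(3) \<open>q \<in> U\<close> by (simp add: b_def)
  qed (simp add: b_def)
  have o: "b q = 1" if "q \<in> V" for q
  proof -
    have "(dist (\<phi> p) (\<phi> q))^2 \<le> (r / 2)^2"
      using that r(1) by (intro power_mono) (auto simp: V_def)
    then show ?thesis using that s(2)[of "d q"] by (simp add: b_def V_def dd power_divide)
  qed
  have dU: "smooth_fun_on A U (\<lambda>q. \<phi> q - \<phi> p)"
    using smooth_fun_on_diff[OF chart_open[OF c] smooth_fun_on_chart_map[OF c] smooth_fun_on_const] .
  have "smooth_fun_on A U d"
    unfolding d_def by (rule smooth_fun_on_bilinear[OF bounded_bilinear_inner chart_open[OF c] dU dU])
  then have "smooth_fun_on A U (\<lambda>q. s (d q))"
    by (rule smooth_fun_on_compose[OF chart_open[OF c] open_UNIV subset_UNIV _ s(1)])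
  then have bU: "smooth_fun_on A U b"
    by (rule iffD1[OF smooth_fun_on_cong[OF chart_open[OF c]], rotated]) (simp add: b_def)
  have bK: "smooth_fun_on A (- K) b"
    by (rule iffD1[OF smooth_fun_on_cong[OF open_Compl[OF K]] smooth_fun_on_const[of _ 0]])
      (simp add: z)
  have sb: "smooth b"
  proof (rule smooth_fun_on_local)
    fix q
    show "\<exists>V. open V \<and> q \<in> V \<and> smooth_fun_on A V b"
      using bU bK chart_open[OF c] open_Compl[OF K] KW by (cases "q \<in> U") auto
  qed
  have "open (U \<inter> \<phi> -` ball (\<phi> p) (r / 2))"
    using continuous_open_preimage[OF cf chart_open[OF c]] by blast
  then have oV: "open V" by (simp add: V_def vimage_def Int_def)
  have "V \<subseteq> W"
  proof
    fix q assume q: "q \<in> V"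
    then have "q \<in> K" using o z by fastforce
    then show "q \<in> W" using KW by blast
  qed
  with sb oV o K KW z p r(1) show ?thesis
    by (intro that[of b V K]) (auto simp: V_def)
qed

text \<open>The values of \<open>f\<close> outside W are arbitrary, but there the product is zero
  near every point, as W and the complement of K cover the manifold.\<close>

lemma smooth_bump_mult:
  fixes b :: "'a \<Rightarrow> real" and f :: "'a \<Rightarrow> 'f::real_normed_vector"
  assumes "smooth b" "closed K" "K \<subseteq> W" "open W" "\<And>q. q \<notin> K \<Longrightarrow> b q = 0" "smooth_fun_on A W f"
  shows "smooth (\<lambda>q. b q *\<^sub>R f q)"
proof (rule smooth_fun_on_local)
  fix q
  have 1: "smooth_fun_on A W (\<lambda>q. b q *\<^sub>R f q)"
    by (rule smooth_fun_on_scaleR[OF assms(4) smooth_fun_on_subset[OF assms(1)] assms(6)]) simp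
  have 2: "smooth_fun_on A (- K) (\<lambda>q. b q *\<^sub>R f q)"
    by (rule iffD1[OF smooth_fun_on_cong[OF open_Compl[OF assms(2)]] smooth_fun_on_const[of _ 0]])
      (simp add: assms(5))
  show "\<exists>V. open V \<and> q \<in> V \<and> smooth_fun_on A V (\<lambda>q. b q *\<^sub>R f q)"
  proof (cases "q \<in> W")
    case True
    then show ?thesis using 1 assms(4) by blast
  next
    case False
    then show ?thesis using 2 assms(2,3) by (intro exI[of _ "- K"]) auto
  qed
qed

end

section \<open>Tangent vectors\<close>

lemma cscale_apply [simp]: "cscale c v f = c * v f"
  by (simp add: cscale_def)

lemma cconj_apply [simp]: "cconj v f = cnj (v f)"
  by (simp add: cconj_def)

lemma sum_fun_apply2: "(\<Sum>i\<in>I. F i) x = (\<Sum>i\<in>I. F i x)"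
  by (induction I rule: infinite_finite_induct) auto

context smooth_manifold
begin

definition dvec :: "('a, 'n) chart \<Rightarrow> 'a \<Rightarrow> real ^ 'n \<Rightarrow> 'a cvec" where
  "dvec c p a = (\<lambda>f. if smooth f
     then complex_of_real (frechet_derivative (f \<circ> inv_into (fst c) (snd c)) (at (snd c p)) a) else 0)"

lemma tangent_dvec: "v \<in> tangent A p \<longleftrightarrow> (\<exists>c\<in>A. p \<in> fst c \<and> (\<exists>a. v = dvec c p a))"
proof
  assume "v \<in> tangent A p"
  then obtain U \<phi> a where "(U, \<phi>) \<in> A" "p \<in> U" "v = dvec (U, \<phi>) p a"
    unfolding tangent_def dvec_def by fastforce
  then show "\<exists>c\<in>A. p \<in> fst c \<and> (\<exists>a. v = dvec c p a)" by force
next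
  assume "\<exists>c\<in>A. p \<in> fst c \<and> (\<exists>a. v = dvec c p a)"
  then obtain U \<phi> a where "(U, \<phi>) \<in> A" "p \<in> U" "v = dvec (U, \<phi>) p a" by force
  then show "v \<in> tangent A p"
    unfolding tangent_def dvec_def by fastforce
qed

lemma smooth_chart_differentiable:
  fixes f :: "'a \<Rightarrow> 'f::real_normed_vector"
  assumes "(U, \<phi>) \<in> A" "p \<in> U" "smooth_fun_on A W f" "p \<in> W"
  shows "(f \<circ> inv_into U \<phi>) differentiable (at (\<phi> p))"
  using smooth_on_differentiable[OF smooth_fun_on_chartD[OF assms(3,1)]] assms by blast

lemma chart_derivative:
  fixes f :: "'a \<Rightarrow> 'f::real_normed_vector"
  assumes "(U, \<phi>) \<in> A" "p \<in> U" "smooth_fun_on A W f" "p \<in> W"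
  shows "((f \<circ> inv_into U \<phi>) has_derivative
    frechet_derivative (f \<circ> inv_into U \<phi>) (at (\<phi> p))) (at (\<phi> p))"
  using smooth_chart_differentiable[OF assms] frechet_derivative_works by blast

text \<open>The chain rule for the transition map. It shows that one chart already yields all
  tangent vectors at p, so that they form a real vector space although the definition ranges over
  all charts.\<close>

lemma dvec_change:
  assumes c: "(U, \<phi>) \<in> A" "p \<in> U" and d: "(V, \<psi>) \<in> A" "p \<in> V"
  shows "dvec (U, \<phi>) p a = dvec (V, \<psi>) p (frechet_derivative (\<psi> \<circ> inv_into U \<phi>) (at (\<phi> p)) a)"
proof
  fix f :: "'a \<Rightarrow> real"
  show "dvec (U, \<phi>) p a f = dvec (V, \<psi>) p (frechet_derivative (\<psi> \<circ> inv_into U \<phi>) (at (\<phi> p)) a) f"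
  proof (cases "smooth f")
    case True
    let ?t = "\<psi> \<circ> inv_into U \<phi>" and ?g = "f \<circ> inv_into V \<psi>"
    have tp: "?t (\<phi> p) = \<psi> p" using chart_inv[OF c] by simp
    have t: "(?t has_derivative frechet_derivative ?t (at (\<phi> p))) (at (\<phi> p))"
      using chart_derivative[OF c smooth_fun_on_chart_map[OF d(1)]] d by blast
    have g: "(?g has_derivative frechet_derivative ?g (at (\<psi> p))) (at (?t (\<phi> p)))"
      using chart_derivative[OF d True] tp by simp
    have "((?g \<circ> ?t) has_derivative (\<lambda>v. frechet_derivative ?g (at (\<psi> p)) (frechet_derivative ?t (at (\<phi> p)) v))) (at (\<phi> p))"
      using diff_chain_at[OF t g] by (simp add: o_def)
    then have "frechet_derivative (?g \<circ> ?t) (at (\<phi> p)) =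
        (\<lambda>v. frechet_derivative ?g (at (\<psi> p)) (frechet_derivative ?t (at (\<phi> p)) v))"
      using frechet_derivative_at by metis
    moreover have "frechet_derivative (?g \<circ> ?t) (at (\<phi> p)) = frechet_derivative (f \<circ> inv_into U \<phi>) (at (\<phi> p))"
    proof (rule frechet_derivative_cong_open)
      show "open (\<phi> ` (V \<inter> U))" using chart_image_open[OF c(1) chart_open[OF d(1)]] .
      show "\<phi> p \<in> \<phi> ` (V \<inter> U)" using c d by blast
    qed (use chart_inv[OF d(1)] chart_inv[OF c(1)] in auto)
    ultimately show ?thesis using True by (simp add: dvec_def)
  qed (simp add: dvec_def)
qed

lemma tangent_chart:
  assumes "(U, \<phi>) \<in> A" "p \<in> U"
  shows "tangent A p = range (dvec (U, \<phi>) p)"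
proof
  show "tangent A p \<subseteq> range (dvec (U, \<phi>) p)"
    using dvec_change[OF _ _ assms] by (fastforce simp: tangent_dvec)
  show "range (dvec (U, \<phi>) p) \<subseteq> tangent A p"
    using assms by (auto simp: tangent_dvec intro!: bexI[of _ "(U, \<phi>)"])
qed

lemma dvec_add:
  assumes "(U, \<phi>) \<in> A" "p \<in> U"
  shows "dvec (U, \<phi>) p (a + b) = dvec (U, \<phi>) p a + dvec (U, \<phi>) p b"
proof -
  have "frechet_derivative (f \<circ> inv_into U \<phi>) (at (\<phi> p)) (a + b) =
      frechet_derivative (f \<circ> inv_into U \<phi>) (at (\<phi> p)) a +
      frechet_derivative (f \<circ> inv_into U \<phi>) (at (\<phi> p)) b" if "smooth f" for f :: "'a \<Rightarrow> real"
    using linear_add[OF has_derivative_linear[OF chart_derivative[OF assms that UNIV_I]]] .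
  then show ?thesis by (auto simp: dvec_def fun_eq_iff)
qed

lemma dvec_scale:
  assumes "(U, \<phi>) \<in> A" "p \<in> U"
  shows "dvec (U, \<phi>) p (r *\<^sub>R a) = cscale (complex_of_real r) (dvec (U, \<phi>) p a)"
proof -
  have "frechet_derivative (f \<circ> inv_into U \<phi>) (at (\<phi> p)) (r *\<^sub>R a) =
      r * frechet_derivative (f \<circ> inv_into U \<phi>) (at (\<phi> p)) a" if "smooth f" for f :: "'a \<Rightarrow> real"
    using linear_scale[OF has_derivative_linear[OF chart_derivative[OF assms that UNIV_I]]] by simp
  then show ?thesis by (auto simp: dvec_def fun_eq_iff)
qed

lemma tangent_add:
  assumes "u \<in> tangent A p" "v \<in> tangent A p"
  shows "u + v \<in> tangent A p"
proof -
  obtain U \<phi> where c: "(U, \<phi>) \<in> A" "p \<in> U" using chart_exists by blast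
  show ?thesis using assms dvec_add[OF c] unfolding tangent_chart[OF c]
    by (auto simp: image_iff) metis
qed

lemma tangent_scale:
  assumes "v \<in> tangent A p"
  shows "cscale (complex_of_real r) v \<in> tangent A p"
proof -
  obtain U \<phi> where c: "(U, \<phi>) \<in> A" "p \<in> U" using chart_exists by blast
  show ?thesis using assms dvec_scale[OF c] unfolding tangent_chart[OF c]
    by (auto simp: image_iff) metis
qed

lemma tangent_zero: "0 \<in> tangent A p"
proof -
  obtain U \<phi> where c: "(U, \<phi>) \<in> A" "p \<in> U" using chart_exists by blast
  then have "cscale (complex_of_real 0) (dvec (U, \<phi>) p 0) \<in> tangent A p"
    by (intro tangent_scale) (simp add: tangent_chart[OF c])
  moreover have "cscale (complex_of_real 0) (dvec (U, \<phi>) p 0) = 0" by (simp add: fun_eq_iff)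
  ultimately show ?thesis by simp
qed

lemma tangent_uminus: "v \<in> tangent A p \<Longrightarrow> - v \<in> tangent A p"
  using tangent_scale[of v p "-1"] by (simp add: cscale_def fun_Compl_def)

lemma tangent_diff: "u \<in> tangent A p \<Longrightarrow> v \<in> tangent A p \<Longrightarrow> u - v \<in> tangent A p"
  using tangent_add[OF _ tangent_uminus] by fastforce

lemma tangent_sum: "(\<And>i. i \<in> I \<Longrightarrow> v i \<in> tangent A p) \<Longrightarrow> (\<Sum>i\<in>I. v i) \<in> tangent A p"
  by (induction I rule: infinite_finite_induct) (auto intro: tangent_zero tangent_add)

lemma tangent_real: "v \<in> tangent A p \<Longrightarrow> Im (v f) = 0"
  by (auto simp: tangent_dvec dvec_def)

lemma tangent_of_Re: "v \<in> tangent A p \<Longrightarrow> complex_of_real (Re (v f)) = v f"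
  using tangent_real by (simp add: complex_eq_iff)

lemma tangent_nonsmooth: "v \<in> tangent A p \<Longrightarrow> \<not> smooth f \<Longrightarrow> v f = 0"
  by (auto simp: tangent_dvec dvec_def)

lemma tangent_local:
  assumes "v \<in> tangent A p" "smooth f" "smooth g" "open W" "p \<in> W" "\<And>q. q \<in> W \<Longrightarrow> f q = g q"
  shows "v f = v g"
proof -
  obtain U \<phi> where c: "(U, \<phi>) \<in> A" "p \<in> U" using chart_exists by blast
  then obtain a where v: "v = dvec (U, \<phi>) p a" using assms(1) tangent_chart by blast
  have "frechet_derivative (f \<circ> inv_into U \<phi>) (at (\<phi> p)) =
      frechet_derivative (g \<circ> inv_into U \<phi>) (at (\<phi> p))"
    by (rule frechet_derivative_cong_open[OF chart_image_open[OF c(1) assms(4)]])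
      (use c assms(5,6) chart_inv[OF c(1)] in auto)
  then show ?thesis using assms(2,3) v by (simp add: dvec_def)
qed

lemma tangent_fun_add:
  assumes "v \<in> tangent A p" "smooth f" "smooth g"
  shows "v (\<lambda>q. f q + g q) = v f + v g"
proof -
  obtain U \<phi> where c: "(U, \<phi>) \<in> A" "p \<in> U" using chart_exists by blast
  then obtain a where v: "v = dvec (U, \<phi>) p a" using assms(1) tangent_chart by blast
  have "((\<lambda>x. (f \<circ> inv_into U \<phi>) x + (g \<circ> inv_into U \<phi>) x) has_derivative
     (\<lambda>a. frechet_derivative (f \<circ> inv_into U \<phi>) (at (\<phi> p)) a +
       frechet_derivative (g \<circ> inv_into U \<phi>) (at (\<phi> p)) a)) (at (\<phi> p))"
    by (intro has_derivative_add chart_derivative[OF c _ UNIV_I] assms)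
  from fun_cong[OF frechet_derivative_at[OF this], of a]
  have "frechet_derivative ((\<lambda>q. f q + g q) \<circ> inv_into U \<phi>) (at (\<phi> p)) a =
     frechet_derivative (f \<circ> inv_into U \<phi>) (at (\<phi> p)) a +
       frechet_derivative (g \<circ> inv_into U \<phi>) (at (\<phi> p)) a"
    by (simp add: o_def)
  then show ?thesis
    using assms(2,3) smooth_fun_on_add[OF open_UNIV assms(2,3)] by (simp add: v dvec_def)
qed

lemma tangent_fun_mult:
  assumes "v \<in> tangent A p" "smooth f" "smooth g"
  shows "v (\<lambda>q. f q * g q) = of_real (f p) * v g + of_real (g p) * v f"
proof -
  obtain U \<phi> where c: "(U, \<phi>) \<in> A" "p \<in> U" using chart_exists by blast
  then obtain a where v: "v = dvec (U, \<phi>) p a" using assms(1) tangent_chart by blast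
  have "((\<lambda>x. (f \<circ> inv_into U \<phi>) x * (g \<circ> inv_into U \<phi>) x) has_derivative
     (\<lambda>a. (f \<circ> inv_into U \<phi>) (\<phi> p) * frechet_derivative (g \<circ> inv_into U \<phi>) (at (\<phi> p)) a +
       frechet_derivative (f \<circ> inv_into U \<phi>) (at (\<phi> p)) a * (g \<circ> inv_into U \<phi>) (\<phi> p))) (at (\<phi> p))"
    by (intro has_derivative_mult chart_derivative[OF c _ UNIV_I] assms)
  from fun_cong[OF frechet_derivative_at[OF this], of a]
  have "frechet_derivative ((\<lambda>q. f q * g q) \<circ> inv_into U \<phi>) (at (\<phi> p)) a =
     f p * frechet_derivative (g \<circ> inv_into U \<phi>) (at (\<phi> p)) a +
       frechet_derivative (f \<circ> inv_into U \<phi>) (at (\<phi> p)) a * g p"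
    using chart_inv[OF c] by (simp add: o_def)
  then show ?thesis
    using assms(2,3) smooth_fun_on_mult[OF open_UNIV assms(2,3)] by (simp add: v dvec_def)
qed

lemma tangent_fun_const:
  assumes "v \<in> tangent A p"
  shows "v (\<lambda>q. k) = 0"
  using assms by (auto simp: tangent_dvec dvec_def o_def)

subsection \<open>The complexified tangent space\<close>

lemma ctangentE:
  assumes "v \<in> ctangent A p"
  obtains x y where "x \<in> tangent A p" "y \<in> tangent A p" "v = x + cscale \<i> y"
  using assms by (auto simp: ctangent_def)

lemma tangent_ctangent: "v \<in> tangent A p \<Longrightarrow> v \<in> ctangent A p"
proof -
  assume "v \<in> tangent A p"
  moreover have "v = v + cscale \<i> 0" by (simp add: fun_eq_iff)
  ultimately show ?thesis using tangent_zero unfolding ctangent_def by blast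
qed

lemma ctangentI: "x \<in> tangent A p \<Longrightarrow> y \<in> tangent A p \<Longrightarrow> x + cscale \<i> y \<in> ctangent A p"
  by (auto simp: ctangent_def)

lemma ctangent_add: "u \<in> ctangent A p \<Longrightarrow> v \<in> ctangent A p \<Longrightarrow> u + v \<in> ctangent A p"
proof (elim ctangentE)
  fix x y x' y' assume *: "x \<in> tangent A p" "y \<in> tangent A p" "x' \<in> tangent A p" "y' \<in> tangent A p"
    "u = x + cscale \<i> y" "v = x' + cscale \<i> y'"
  have "u + v = (x + x') + cscale \<i> (y + y')" using * by (simp add: fun_eq_iff algebra_simps)
  then show ?thesis using * ctangentI tangent_add by metis
qed

lemma ctangent_scale: "v \<in> ctangent A p \<Longrightarrow> cscale c v \<in> ctangent A p"
proof (elim ctangentE)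
  fix x y assume *: "x \<in> tangent A p" "y \<in> tangent A p" "v = x + cscale \<i> y"
  have "cscale c v = (cscale (of_real (Re c)) x + cscale (of_real (- Im c)) y) +
      cscale \<i> (cscale (of_real (Im c)) x + cscale (of_real (Re c)) y)"
    using * by (simp add: fun_eq_iff) (simp add: complex_eq_iff algebra_simps)
  then show ?thesis using * by (simp only:) (intro ctangentI tangent_add tangent_scale)
qed

lemma ctangent_zero: "0 \<in> ctangent A p"
  by (rule tangent_ctangent[OF tangent_zero])

lemma ctangent_uminus: "v \<in> ctangent A p \<Longrightarrow> - v \<in> ctangent A p"
  using ctangent_scale[of v p "-1"] by (simp add: cscale_def fun_Compl_def)

lemma ctangent_diff: "u \<in> ctangent A p \<Longrightarrow> v \<in> ctangent A p \<Longrightarrow> u - v \<in> ctangent A p"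
  using ctangent_add[OF _ ctangent_uminus] by fastforce

lemma ctangent_conj: "v \<in> ctangent A p \<Longrightarrow> cconj v \<in> ctangent A p"
proof (elim ctangentE)
  fix x y assume *: "x \<in> tangent A p" "y \<in> tangent A p" "v = x + cscale \<i> y"
  have "cconj v = x + cscale \<i> (- y)"
    using * tangent_real[of x] tangent_real[of y] by (simp add: fun_eq_iff complex_eq_iff)
  then show ?thesis using * ctangentI tangent_uminus by metis
qed

definition re_vec :: "'a cvec \<Rightarrow> 'a cvec" where "re_vec v = (\<lambda>f. of_real (Re (v f)))"
definition im_vec :: "'a cvec \<Rightarrow> 'a cvec" where "im_vec v = (\<lambda>f. of_real (Im (v f)))"

lemma re_im_vec: "re_vec v + cscale \<i> (im_vec v) = v"
  by (simp add: re_vec_def im_vec_def fun_eq_iff complex_eq_iff)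

lemma re_vec_tangent: "v \<in> ctangent A p \<Longrightarrow> re_vec v \<in> tangent A p"
proof (elim ctangentE)
  fix x y assume *: "x \<in> tangent A p" "y \<in> tangent A p" "v = x + cscale \<i> y"
  have "re_vec v = x"
    using * tangent_real[of x] tangent_real[of y] by (simp add: re_vec_def fun_eq_iff complex_eq_iff)
  then show ?thesis using * by simp
qed

lemma im_vec_tangent: "v \<in> ctangent A p \<Longrightarrow> im_vec v \<in> tangent A p"
proof (elim ctangentE)
  fix x y assume *: "x \<in> tangent A p" "y \<in> tangent A p" "v = x + cscale \<i> y"
  have "im_vec v = y"
    using * tangent_real[of x] tangent_real[of y] by (simp add: im_vec_def fun_eq_iff complex_eq_iff)
  then show ?thesis using * by simp
qed

lemma tangent_iff: "v \<in> tangent A p \<longleftrightarrow> v \<in> ctangent A p \<and> (\<forall>f. Im (v f) = 0)"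
proof -
  have "re_vec v = v" if "\<forall>f. Im (v f) = 0"
    using that by (simp add: re_vec_def fun_eq_iff complex_eq_iff)
  then show ?thesis using tangent_real tangent_ctangent re_vec_tangent by metis
qed

lemma ctangent_nonsmooth: "v \<in> ctangent A p \<Longrightarrow> \<not> smooth f \<Longrightarrow> v f = 0"
  by (elim ctangentE) (simp add: tangent_nonsmooth)

lemma ctangent_local:
  assumes "v \<in> ctangent A p" "smooth f" "smooth g" "open W" "p \<in> W" "\<And>q. q \<in> W \<Longrightarrow> f q = g q"
  shows "v f = v g"
  using assms(1) by (elim ctangentE) (simp add: tangent_local[OF _ assms(2-)])

lemma ctangent_fun_add:
  "v \<in> ctangent A p \<Longrightarrow> smooth f \<Longrightarrow> smooth g \<Longrightarrow> v (\<lambda>q. f q + g q) = v f + v g"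
  by (elim ctangentE) (simp add: tangent_fun_add algebra_simps)

lemma ctangent_fun_mult:
  "v \<in> ctangent A p \<Longrightarrow> smooth f \<Longrightarrow> smooth g \<Longrightarrow>
    v (\<lambda>q. f q * g q) = of_real (f p) * v g + of_real (g p) * v f"
  by (elim ctangentE) (simp add: tangent_fun_mult algebra_simps)

lemma ctangent_fun_const: "v \<in> ctangent A p \<Longrightarrow> v (\<lambda>q. k) = 0"
  by (elim ctangentE) (simp add: tangent_fun_const)

lemma ctangent_fun_minus:
  assumes "v \<in> ctangent A p" "smooth f"
  shows "v (\<lambda>q. - f q) = - v f"
  using ctangent_fun_mult[OF assms(1) smooth_fun_on_const assms(2), of "-1"] ctangent_fun_const[OF assms(1)]
  by simp

lemma ctangent_fun_diff:
  assumes "v \<in> ctangent A p" "smooth f" "smooth g"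
  shows "v (\<lambda>q. f q - g q) = v f - v g"
  using ctangent_fun_add[OF assms(1,2) smooth_fun_on_minus[OF open_UNIV assms(3)]]
    ctangent_fun_minus[OF assms(1,3)] by simp

lemma ctangent_fun_sum:
  assumes "v \<in> ctangent A p" "\<And>i. i \<in> I \<Longrightarrow> smooth (f i)"
  shows "v (\<lambda>q. \<Sum>i\<in>I. f i q) = (\<Sum>i\<in>I. v (f i))"
  using assms(2)
  by (induction I rule: infinite_finite_induct)
    (auto simp: ctangent_fun_const[OF assms(1)] ctangent_fun_add[OF assms(1)] smooth_intros)

subsection \<open>Coordinate frames\<close>

text \<open>The coordinate fields and coordinate functions of a chart, cut off so that they become
  global; on \<open>V\<close>, where the cut-off is 1, they keep their usual relations. The last
  relation says that coordinate fields commute, which is the symmetry of second derivatives.\<close>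

lemma frame:
  obtains V :: "'a set" and e :: "'n \<Rightarrow> 'a cfield" and x :: "'n \<Rightarrow> 'a \<Rightarrow> real" where
    "open V" "p \<in> V" "\<And>i. e i \<in> vfields A" "\<And>i. smooth (x i)"
    "\<And>q v. q \<in> V \<Longrightarrow> v \<in> ctangent A q \<Longrightarrow> v = (\<Sum>i\<in>UNIV. cscale (v (x i)) (e i q))"
    "\<And>q i j. q \<in> V \<Longrightarrow> e i q (x j) = of_bool (i = j)"
    "\<And>q i j f. q \<in> V \<Longrightarrow> smooth f \<Longrightarrow> e i q (\<lambda>r. Re (e j r f)) = e j q (\<lambda>r. Re (e i r f))"
proof -
  obtain U \<phi> where c: "(U, \<phi>) \<in> A" and p: "p \<in> U" using chart_exists by blast
  let ?g = "inv_into U \<phi>"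
  obtain b :: "'a \<Rightarrow> real" and V K where b: "smooth b" "open V" "p \<in> V" "V \<subseteq> U"
    "\<And>q. q \<in> V \<Longrightarrow> b q = 1" "closed K" "K \<subseteq> U" "\<And>q. q \<notin> K \<Longrightarrow> b q = 0"
    using bump[OF chart_open[OF c] p] by metis
  define e where "e i q = cscale (of_real (b q)) (dvec (U, \<phi>) q (axis i 1))" for i :: 'n and q
  define x where "x j q = b q *\<^sub>R (\<phi> q $ j)" for j q
  have oV: "open (\<phi> ` V)"
    using chart_image_open[OF c b(2)] b(4) by (simp add: Int_absorb2)
  have D: "smooth_fun_on A U (\<lambda>q. frechet_derivative (f \<circ> ?g) (at (\<phi> q)) a)"
    if "smooth f" for f :: "'a \<Rightarrow> real" and a
  proof (rule smooth_fun_on_chartI[OF c chart_open[OF c] subset_refl])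
    have "smooth_on (\<phi> ` U) (\<lambda>y. frechet_derivative (f \<circ> ?g) (at y) a)"
      using smooth_on_frechet smooth_fun_on_chartD[OF that c] by force
    then show "smooth_on (\<phi> ` U) ((\<lambda>q. frechet_derivative (f \<circ> ?g) (at (\<phi> q)) a) \<circ> ?g)"
      by (rule iffD1[OF smooth_on_cong[OF chart_open_image[OF c]], rotated])
        (use chart_inv[OF c] in auto)
  qed
  have e_app: "e i q f = of_real (b q *\<^sub>R frechet_derivative (f \<circ> ?g) (at (\<phi> q)) (axis i 1))"
    if "smooth f" for i q f
    using that by (simp add: e_def dvec_def)
  have sm: "smooth (\<lambda>q. b q *\<^sub>R frechet_derivative (f \<circ> ?g) (at (\<phi> q)) (axis i 1))"
    if "smooth f" for f :: "'a \<Rightarrow> real" and i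
    using smooth_bump_mult[OF b(1,6,7) chart_open[OF c] b(8) D[OF that]] by blast
  have et: "e i q \<in> tangent A q" for i q
  proof (cases "q \<in> U")
    case True
    then show ?thesis unfolding e_def
      by (intro tangent_scale) (simp add: tangent_chart[OF c True])
  next
    case False
    then have "e i q = 0" using b(7,8) by (auto simp: e_def fun_eq_iff)
    then show ?thesis by (simp add: tangent_zero)
  qed
  have ev: "e i \<in> vfields A" for i
  proof -
    have "smooth (\<lambda>q. e i q f)" if "smooth f" for f
      using smooth_fun_on_of_real[OF open_UNIV sm[OF that]] that by (simp add: e_app)
    then show ?thesis
      using et tangent_ctangent by (simp add: sections_def smooth_field_on_def)
  qed
  have xs: "smooth (x i)" for i
    unfolding x_def
    by (rule smooth_bump_mult[OF b(1,6,7) chart_open[OF c] b(8)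
      smooth_fun_on_linear[OF bounded_linear_vec_nth chart_open[OF c] smooth_fun_on_chart_map[OF c]]])
  have dx: "frechet_derivative (x j \<circ> ?g) (at (\<phi> q)) a = a $ j" if "q \<in> V" for j q a
  proof -
    have "frechet_derivative (x j \<circ> ?g) (at (\<phi> q)) = frechet_derivative (\<lambda>y. y $ j) (at (\<phi> q))"
    proof (rule frechet_derivative_cong_open[OF oV])
      fix y assume "y \<in> \<phi> ` V"
      then obtain r where "r \<in> V" "y = \<phi> r" by blast
      then show "(x j \<circ> ?g) y = y $ j"
        using chart_inv[OF c, of r] b(4) b(5)[of r] by (auto simp: x_def)
    qed (use that in blast)
    then show ?thesis
      using frechet_derivative_at[OF bounded_linear_imp_has_derivative[OF bounded_linear_vec_nth]]
      by metis
  qed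
  have e1: "e i q = dvec (U, \<phi>) q (axis i 1)" if "q \<in> V" for i q
    using b(5)[OF that] by (simp add: e_def fun_eq_iff)
  have dvx: "dvec (U, \<phi>) q a (x j) = of_real (a $ j)" if "q \<in> V" for q a j
    using dx[OF that] xs by (simp add: dvec_def)
  have expt: "v = (\<Sum>i\<in>UNIV. cscale (v (x i)) (e i q))" if q: "q \<in> V" and v: "v \<in> tangent A q" for q v
  proof -
    have qU: "q \<in> U" using q b(4) by blast
    obtain a where a: "v = dvec (U, \<phi>) q a" using v tangent_chart[OF c qU] by blast
    have "dvec (U, \<phi>) q (\<Sum>i\<in>I. a $ i *\<^sub>R axis i 1) =
        (\<Sum>i\<in>I. cscale (of_real (a $ i)) (dvec (U, \<phi>) q (axis i 1)))" if "finite I" for I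
      using that
    proof induction
      case empty
      show ?case using dvec_scale[OF c qU, of 0 0] by (simp add: fun_eq_iff)
    qed (simp add: dvec_add[OF c qU] dvec_scale[OF c qU])
    from this[of UNIV] basis_expansion[of a]
    have "v = (\<Sum>i\<in>UNIV. cscale (of_real (a $ i)) (dvec (U, \<phi>) q (axis i 1)))"
      by (simp add: a scalar_mult_eq_scaleR)
    moreover have "v (x i) = of_real (a $ i)" for i using dvx[OF q] a by simp
    ultimately show ?thesis using e1[OF q] by simp
  qed
  show ?thesis
  proof (rule that[OF b(2,3) ev xs])
    fix q v assume q: "q \<in> V" and "v \<in> ctangent A q"
    then obtain y z where yz: "y \<in> tangent A q" "z \<in> tangent A q" "v = y + cscale \<i> z"
      by (elim ctangentE)
    have "v f = (\<Sum>i\<in>UNIV. cscale (v (x i)) (e i q)) f" for f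
    proof -
      have "v f = (\<Sum>i\<in>UNIV. y (x i) * e i q f) + \<i> * (\<Sum>i\<in>UNIV. z (x i) * e i q f)"
        using fun_cong[OF expt[OF q yz(1)], of f] fun_cong[OF expt[OF q yz(2)], of f] yz(3)
        by (simp add: sum_fun_apply2)
      also have "\<dots> = (\<Sum>i\<in>UNIV. (y (x i) + \<i> * z (x i)) * e i q f)"
        by (simp add: sum_distrib_left sum.distrib algebra_simps)
      finally show ?thesis by (simp add: sum_fun_apply2 yz(3))
    qed
    then show "v = (\<Sum>i\<in>UNIV. cscale (v (x i)) (e i q))" by blast
  next
    fix q i j assume "q \<in> V"
    then show "e i q (x j) = of_bool (i = j)"
      by (simp add: e1 dvx axis_def)
  next
    fix q i j and f :: "'a \<Rightarrow> real" assume q: "q \<in> V" and f: "smooth f"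
    have "e i q (\<lambda>r. Re (e j r f)) = of_real (frechet_derivative
        (\<lambda>y. frechet_derivative (f \<circ> ?g) (at y) (axis j 1)) (at (\<phi> q)) (axis i 1))" for i j
    proof -
      have "frechet_derivative ((\<lambda>r. Re (e j r f)) \<circ> ?g) (at (\<phi> q)) =
         frechet_derivative (\<lambda>y. frechet_derivative (f \<circ> ?g) (at y) (axis j 1)) (at (\<phi> q))"
      proof (rule frechet_derivative_cong_open[OF oV])
        fix y assume "y \<in> \<phi> ` V"
        then obtain r where "r \<in> V" "y = \<phi> r" by blast
        then show "((\<lambda>r. Re (e j r f)) \<circ> ?g) y = frechet_derivative (f \<circ> ?g) (at y) (axis j 1)"
          using chart_inv[OF c, of r] b(4) b(5)[of r] by (auto simp: e_app[OF f])
      qed (use q in blast)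
      moreover have "smooth (\<lambda>r. Re (e j r f))"
        using sm[OF f, of j] by (simp add: e_app[OF f])
      ultimately show ?thesis by (simp add: e_app b(5)[OF q])
    qed
    moreover have "Ck_on 2 (\<phi> ` V) (f \<circ> ?g)"
      using smooth_fun_on_chartD[OF f c] b(4) unfolding smooth_on_def by (blast intro: Ck_on_subset)
    ultimately show "e i q (\<lambda>r. Re (e j r f)) = e j q (\<lambda>r. Re (e i r f))"
      using symmetric_second_derivative[OF oV _ , of "\<phi> q" "f \<circ> ?g"] q by simp
  qed
qed

end

section \<open>Vector fields\<close>

definition cfscale :: "('a \<Rightarrow> complex) \<Rightarrow> 'a cfield \<Rightarrow> 'a cfield" where
  "cfscale u X = (\<lambda>p. cscale (u p) (X p))"

definition fconj :: "'a cfield \<Rightarrow> 'a cfield" where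
  "fconj X = (\<lambda>p. cconj (X p))"

lemma cfscale_apply [simp]: "cfscale u X p = cscale (u p) (X p)"
  by (simp add: cfscale_def)

lemma fconj_apply [simp]: "fconj X p = cconj (X p)"
  by (simp add: fconj_def)

lemma fscale_cfscale: "fscale u X = cfscale (\<lambda>p. of_real (u p)) X"
  by (simp add: fscale_def cfscale_def)

lemma ciscale_cfscale: "ciscale X = cfscale (\<lambda>_. \<i>) X"
  by (simp add: ciscale_def cfscale_def)

lemma cscale_add: "cscale c (v + w) = cscale c v + cscale c w"
  and cscale_add_left: "cscale (c + d) v = cscale c v + cscale d v"
  and cscale_minus: "cscale c (- v) = - cscale c v"
  and cscale_minus_left: "cscale (- c) v = - cscale c v"
  and cscale_diff: "cscale c (v - w) = cscale c v - cscale c w"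
  and cscale_cscale [simp]: "cscale c (cscale d v) = cscale (c * d) v"
  and cscale_one [simp]: "cscale 1 v = v"
  and cscale_zero_left [simp]: "cscale 0 v = 0"
  and cscale_zero [simp]: "cscale c 0 = 0"
  by (auto simp: fun_eq_iff algebra_simps)

lemma cconj_add: "cconj (v + w) = cconj v + cconj w"
  and cconj_cscale: "cconj (cscale c v) = cscale (cnj c) (cconj v)"
  and cconj_cconj [simp]: "cconj (cconj v) = v"
  and cconj_zero [simp]: "cconj 0 = 0"
  by (auto simp: fun_eq_iff)

lemma fconj_fconj [simp]: "fconj (fconj X) = X"
  by (simp add: fun_eq_iff)

lemma capply_add: "capply (v + w) u = capply v u + capply w u"
  and capply_cscale: "capply (cscale c v) u = c * capply v u"
  and capply_zero [simp]: "capply 0 u = 0"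
  by (auto simp: capply_def algebra_simps)

context smooth_manifold
begin

lemma sections_iff:
  "X \<in> sections A F \<longleftrightarrow> (\<forall>p. X p \<in> ctangent A p) \<and> (\<forall>p. X p \<in> F p) \<and>
    (\<forall>f. smooth f \<longrightarrow> smooth (\<lambda>p. X p f))"
  by (auto simp: sections_def smooth_field_on_def)

lemma cvfields_iff:
  "X \<in> cvfields A \<longleftrightarrow> (\<forall>p. X p \<in> ctangent A p) \<and> (\<forall>f. smooth f \<longrightarrow> smooth (\<lambda>p. X p f))"
  by (auto simp: sections_iff)

lemma sections_cvfields: "X \<in> sections A F \<longleftrightarrow> X \<in> cvfields A \<and> (\<forall>p. X p \<in> F p)"
  by (auto simp: sections_iff)

lemma vfields_iff: "X \<in> vfields A \<longleftrightarrow> X \<in> cvfields A \<and> (\<forall>p. X p \<in> tangent A p)"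
  by (rule sections_cvfields)

lemma cvfields_ctangent: "X \<in> cvfields A \<Longrightarrow> X p \<in> ctangent A p"
  by (simp add: cvfields_iff)

lemma vfields_cvfields: "X \<in> vfields A \<Longrightarrow> X \<in> cvfields A"
  by (simp add: vfields_iff)

lemma vfields_tangent: "X \<in> vfields A \<Longrightarrow> X p \<in> tangent A p"
  by (simp add: vfields_iff)

text \<open>Vectors return 0 on functions that are not smooth, so in that case the function of p is
  constant.\<close>

lemma smooth_app: "X \<in> cvfields A \<Longrightarrow> smooth (\<lambda>p. X p f)"
proof (cases "smooth f")
  case False
  assume "X \<in> cvfields A"
  then have "X p f = 0" for p by (rule ctangent_nonsmooth[OF cvfields_ctangent False])
  then show ?thesis by (simp add: smooth_fun_on_const)
qed (simp add: cvfields_iff)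

lemma cvfieldsI: "(\<And>p. X p \<in> ctangent A p) \<Longrightarrow> (\<And>f. smooth f \<Longrightarrow> smooth (\<lambda>p. X p f)) \<Longrightarrow> X \<in> cvfields A"
  by (simp add: cvfields_iff)

lemma cvfields_add: "X \<in> cvfields A \<Longrightarrow> Y \<in> cvfields A \<Longrightarrow> X + Y \<in> cvfields A"
  by (rule cvfieldsI) (simp_all add: ctangent_add cvfields_ctangent smooth_app smooth_intros)

lemma cvfields_diff: "X \<in> cvfields A \<Longrightarrow> Y \<in> cvfields A \<Longrightarrow> X - Y \<in> cvfields A"
  by (rule cvfieldsI) (simp_all add: ctangent_diff cvfields_ctangent smooth_app smooth_intros)

lemma cvfields_uminus: "X \<in> cvfields A \<Longrightarrow> - X \<in> cvfields A"
  by (rule cvfieldsI) (simp_all add: ctangent_uminus cvfields_ctangent smooth_app smooth_intros)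

lemma cvfields_zero: "0 \<in> cvfields A"
  by (rule cvfieldsI) (simp_all add: ctangent_zero smooth_fun_on_const)

lemma cvfields_cfscale: "smooth u \<Longrightarrow> X \<in> cvfields A \<Longrightarrow> cfscale u X \<in> cvfields A"
  by (rule cvfieldsI) (simp_all add: ctangent_scale cvfields_ctangent smooth_app smooth_intros)

lemma cvfields_fconj: "X \<in> cvfields A \<Longrightarrow> fconj X \<in> cvfields A"
  by (rule cvfieldsI) (simp_all add: ctangent_conj cvfields_ctangent smooth_app smooth_intros)

lemma cvfields_sum: "(\<And>i. i \<in> I \<Longrightarrow> X i \<in> cvfields A) \<Longrightarrow> (\<Sum>i\<in>I. X i) \<in> cvfields A"
  by (induction I rule: infinite_finite_induct) (auto intro: cvfields_zero cvfields_add)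

lemma vfields_add: "X \<in> vfields A \<Longrightarrow> Y \<in> vfields A \<Longrightarrow> X + Y \<in> vfields A"
  by (simp add: vfields_iff cvfields_add tangent_add)

lemma vfields_diff: "X \<in> vfields A \<Longrightarrow> Y \<in> vfields A \<Longrightarrow> X - Y \<in> vfields A"
  by (simp add: vfields_iff cvfields_diff tangent_diff)

lemma vfields_zero: "0 \<in> vfields A"
  by (simp add: vfields_iff cvfields_zero tangent_zero)

lemma vfields_fscale: "smooth u \<Longrightarrow> X \<in> vfields A \<Longrightarrow> fscale u X \<in> vfields A"
  by (simp add: vfields_iff fscale_cfscale cvfields_cfscale tangent_scale smooth_intros)

lemma vfields_sum: "(\<And>i. i \<in> I \<Longrightarrow> X i \<in> vfields A) \<Longrightarrow> (\<Sum>i\<in>I. X i) \<in> vfields A"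
  by (induction I rule: infinite_finite_induct) (auto intro: vfields_zero vfields_add)

lemma re_field_vec: "re_field X p = re_vec (X p)"
  by (simp add: re_field_def re_vec_def)

lemma im_field_vec: "im_field X p = im_vec (X p)"
  by (simp add: im_field_def im_vec_def)

lemma re_field_vfields: "X \<in> cvfields A \<Longrightarrow> re_field X \<in> vfields A"
  unfolding vfields_iff cvfields_iff[of "re_field X"]
  by (simp add: re_field_vec re_vec_tangent cvfields_ctangent tangent_ctangent)
    (simp add: re_vec_def smooth_intros smooth_app)

lemma im_field_vfields: "X \<in> cvfields A \<Longrightarrow> im_field X \<in> vfields A"
  unfolding vfields_iff cvfields_iff[of "im_field X"]
  by (simp add: im_field_vec im_vec_tangent cvfields_ctangent tangent_ctangent)
    (simp add: im_vec_def smooth_intros smooth_app)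

lemma re_im_field: "X = re_field X + ciscale (im_field X)"
  by (simp add: fun_eq_iff re_field_def im_field_def ciscale_def complex_eq_iff)

lemma vfields_Im: "X \<in> vfields A \<Longrightarrow> Im (X p f) = 0"
  by (rule tangent_real[OF vfields_tangent])

lemma vfields_fconj: "X \<in> vfields A \<Longrightarrow> fconj X = X"
  by (simp add: fun_eq_iff complex_eq_iff vfields_Im)

lemma re_field_vfield: "X \<in> vfields A \<Longrightarrow> re_field X = X"
  and im_field_vfield: "X \<in> vfields A \<Longrightarrow> im_field X = 0"
  by (simp_all add: fun_eq_iff re_field_def im_field_def complex_eq_iff vfields_Im)

subsection \<open>Derivatives of complex functions\<close>

context
  fixes v :: "'a cvec" and p
  assumes v: "v \<in> ctangent A p"
begin

lemma capply_fun_add: "smooth f \<Longrightarrow> smooth g \<Longrightarrow> capply v (\<lambda>q. f q + g q) = capply v f + capply v g"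
  by (simp add: capply_def ctangent_fun_add[OF v] smooth_intros algebra_simps)

lemma capply_fun_mult:
  "smooth f \<Longrightarrow> smooth g \<Longrightarrow> capply v (\<lambda>q. f q * g q) = f p * capply v g + g p * capply v f"
  by (simp add: capply_def ctangent_fun_add[OF v] ctangent_fun_diff[OF v] ctangent_fun_mult[OF v] smooth_intros)
    (simp add: complex_eq_iff algebra_simps)

lemma capply_fun_const: "capply v (\<lambda>q. k) = 0"
  by (simp add: capply_def ctangent_fun_const[OF v])

lemma capply_fun_cmult: "smooth f \<Longrightarrow> capply v (\<lambda>q. k * f q) = k * capply v f"
  by (simp add: capply_fun_mult smooth_intros capply_fun_const)

lemma capply_of_real: "capply v (\<lambda>q. of_real (f q)) = v f"
  by (simp add: capply_def ctangent_fun_const[OF v])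

lemma capply_cnj: "smooth f \<Longrightarrow> capply (cconj v) (\<lambda>q. cnj (f q)) = cnj (capply v f)"
  by (simp add: capply_def ctangent_fun_minus[OF v] smooth_intros)

end

lemma smooth_capply: "X \<in> cvfields A \<Longrightarrow> smooth u \<Longrightarrow> smooth (\<lambda>p. capply (X p) u)"
  unfolding capply_def by (intro smooth_intros smooth_app)

lemma capply_real: "v \<in> tangent A p \<Longrightarrow> Re (capply v u) = Re (v (\<lambda>q. Re (u q)))"
  by (simp add: capply_def tangent_real)

subsection \<open>Lie brackets\<close>

lemma lie_bracket_antisym: "lie_bracket X Y p = - lie_bracket Y X p"
  by (simp add: fun_eq_iff lie_bracket_def)

lemma lie_bracket_add_right:
  assumes "X \<in> cvfields A" "Y \<in> cvfields A" "Y' \<in> cvfields A"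
  shows "lie_bracket X (Y + Y') p = lie_bracket X Y p + lie_bracket X Y' p"
  by (simp add: fun_eq_iff lie_bracket_def capply_fun_add[OF cvfields_ctangent[OF assms(1)]]
      smooth_app assms capply_add)

lemma lie_bracket_add_left:
  assumes "X \<in> cvfields A" "X' \<in> cvfields A" "Y \<in> cvfields A"
  shows "lie_bracket (X + X') Y p = lie_bracket X Y p + lie_bracket X' Y p"
  using lie_bracket_add_right[OF assms(3,1,2), of p]
    lie_bracket_antisym[of "X + X'" Y p] lie_bracket_antisym[of X Y p] lie_bracket_antisym[of X' Y p]
  by simp

lemma lie_bracket_cfscale_right:
  assumes "X \<in> cvfields A" "Y \<in> cvfields A" "smooth u"
  shows "lie_bracket X (cfscale u Y) p = cscale (capply (X p) u) (Y p) + cscale (u p) (lie_bracket X Y p)"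
  by (simp add: fun_eq_iff lie_bracket_def capply_fun_mult[OF cvfields_ctangent[OF assms(1)]]
      smooth_app assms capply_cscale algebra_simps)

lemma lie_bracket_cfscale_left:
  assumes "X \<in> cvfields A" "Y \<in> cvfields A" "smooth u"
  shows "lie_bracket (cfscale u X) Y p = cscale (u p) (lie_bracket X Y p) - cscale (capply (Y p) u) (X p)"
  using lie_bracket_cfscale_right[OF assms(2,1,3), of p]
    lie_bracket_antisym[of "cfscale u X" Y p] lie_bracket_antisym[of X Y p]
  by (simp add: cscale_minus)

text \<open>The bracket is given as an operator on functions, whereas a tangent vector has to be a
  directional derivative in a chart. So its coordinate expression, with components X(Y x_j) - Y(X
  x_j), must be produced.\<close>

lemma lie_bracket_vfields:
  assumes X: "X \<in> vfields A" and Y: "Y \<in> vfields A"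
  shows "lie_bracket X Y \<in> vfields A"
proof -
  have cX: "X \<in> cvfields A" and cY: "Y \<in> cvfields A" using X Y by (simp_all add: vfields_iff)
  have "lie_bracket X Y p \<in> tangent A p" for p
  proof -
    obtain V :: "'a set" and e x where fr: "open V" "p \<in> V" "\<And>i. e i \<in> vfields A" "\<And>i::'n. smooth (x i :: 'a \<Rightarrow> real)"
      "\<And>q v. q \<in> V \<Longrightarrow> v \<in> ctangent A q \<Longrightarrow> v = (\<Sum>i\<in>UNIV. cscale (v (x i)) (e i q))"
      "\<And>q i j. q \<in> V \<Longrightarrow> e i q (x j) = of_bool (i = j)"
      "\<And>q i j f. q \<in> V \<Longrightarrow> smooth f \<Longrightarrow> e i q (\<lambda>r. Re (e j r f)) = e j q (\<lambda>r. Re (e i r f))"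
      by (rule frame[of p]) blast
    have ce: "e i \<in> cvfields A" for i using fr(3) by (simp add: vfields_iff)
    have sR: "smooth (\<lambda>q. Re (X q f))" if "X \<in> vfields A" for X f
      using that by (auto intro!: smooth_intros smooth_app simp: vfields_iff)
    \<comment> \<open>X(Y f) is a first-order part plus a second-order part. Since coordinate fields
      commute, the second-order part is symmetric in X and Y and drops out of the bracket.\<close>
    have second: "X p (\<lambda>q. Re (Y q f)) = (\<Sum>j\<in>UNIV. X p (\<lambda>q. Re (Y q (x j))) * e j p f) +
        (\<Sum>j\<in>UNIV. \<Sum>i\<in>UNIV. Y p (x j) * X p (x i) * e i p (\<lambda>q. Re (e j q f)))"
      if X: "X \<in> vfields A" and Y: "Y \<in> vfields A" and f: "smooth f" for X Y f
    proof -
      have Xp: "X p \<in> ctangent A p" using X by (simp add: vfields_iff cvfields_iff)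
      have "Y q f = (\<Sum>j\<in>UNIV. Y q (x j) * e j q f)" if "q \<in> V" for q
        using fun_cong[OF fr(5)[OF that, of "Y q"], of f] Y
        by (simp add: vfields_iff cvfields_iff sum_fun_apply2)
      then have "X p (\<lambda>q. Re (Y q f)) = X p (\<lambda>q. \<Sum>j\<in>UNIV. Re (Y q (x j)) * Re (e j q f))"
        by (intro ctangent_local[OF Xp _ _ fr(1,2)])
          (auto intro!: smooth_intros sR X Y fr(3) simp: vfields_Im[OF Y])
      also have "\<dots> = (\<Sum>j\<in>UNIV. Y p (x j) * X p (\<lambda>q. Re (e j q f)) + e j p f * X p (\<lambda>q. Re (Y q (x j))))"
        by (simp add: ctangent_fun_sum[OF Xp] ctangent_fun_mult[OF Xp] smooth_intros sR X Y fr(3)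
            tangent_of_Re[OF vfields_tangent[OF Y]] tangent_of_Re[OF vfields_tangent[OF fr(3)]])
      also have "\<dots> = (\<Sum>j\<in>UNIV. Y p (x j) * (\<Sum>i\<in>UNIV. X p (x i) * e i p (\<lambda>q. Re (e j q f))) +
          e j p f * X p (\<lambda>q. Re (Y q (x j))))"
      proof -
        have "X p g = (\<Sum>i\<in>UNIV. X p (x i) * e i p g)" for g
          using fun_cong[OF fr(5)[OF fr(2) Xp], of g] by (simp only: sum_fun_apply2 cscale_apply)
        then show ?thesis by (intro sum.cong refl arg_cong2[where f = "(+)"] arg_cong2[where f = "(*)"])
      qed
      finally show ?thesis
        by (simp add: sum.distrib sum_distrib_left mult_ac)
    qed
    have cap: "capply (X p) (\<lambda>q. Y q f) = X p (\<lambda>q. Re (Y q f))" if "X \<in> vfields A" "Y \<in> vfields A" for X Y f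
      using that by (simp add: capply_def vfields_Im ctangent_fun_const[OF cvfields_ctangent[OF vfields_cvfields]])
    have "lie_bracket X Y p = (\<Sum>j\<in>UNIV. cscale (of_real (Re (X p (\<lambda>q. Re (Y q (x j)))) - Re (Y p (\<lambda>q. Re (X q (x j))))))
       (e j p))" (is "_ = ?rhs")
    proof
      fix f :: "'a \<Rightarrow> real"
      show "lie_bracket X Y p f = ?rhs f"
      proof (cases "smooth f")
        case True
        have sym: "(\<Sum>j\<in>UNIV. \<Sum>i\<in>UNIV. Y p (x j) * X p (x i) * e i p (\<lambda>q. Re (e j q f))) =
          (\<Sum>j\<in>UNIV. \<Sum>i\<in>UNIV. X p (x j) * Y p (x i) * e i p (\<lambda>q. Re (e j q f)))"
          by (subst sum.swap) (intro sum.cong refl, simp add: fr(7)[OF fr(2) True] mult_ac)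
        have "lie_bracket X Y p f = (\<Sum>j\<in>UNIV. X p (\<lambda>q. Re (Y q (x j))) * e j p f) -
           (\<Sum>j\<in>UNIV. Y p (\<lambda>q. Re (X q (x j))) * e j p f)"
          using second[OF X Y True] second[OF Y X True] sym
          by (simp add: lie_bracket_def cap X Y)
        then show ?thesis
          by (simp add: sum_fun_apply2 tangent_of_Re[OF vfields_tangent[OF Y]]
              tangent_of_Re[OF vfields_tangent[OF X]] sum_subtractf left_diff_distrib)
      next
        case False
        then show ?thesis using X Y ce
          by (simp add: lie_bracket_def sum_fun_apply2 ctangent_nonsmooth[OF cvfields_ctangent]
              capply_fun_const[OF cvfields_ctangent] vfields_iff)
      qed
    qed
    then show ?thesis by (simp only:) (intro tangent_sum tangent_scale vfields_tangent fr(3))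
  qed
  moreover have "smooth (\<lambda>p. lie_bracket X Y p f)" for f
    unfolding lie_bracket_def by (intro smooth_intros smooth_capply smooth_app cX cY)
  ultimately show ?thesis by (auto simp: vfields_iff cvfields_iff tangent_ctangent)
qed

lemma lie_bracket_cvfields:
  assumes X: "X \<in> cvfields A" and Y: "Y \<in> cvfields A"
  shows "lie_bracket X Y \<in> cvfields A"
proof -
  have v: "re_field X \<in> vfields A" "im_field X \<in> vfields A" "re_field Y \<in> vfields A" "im_field Y \<in> vfields A"
    using X Y re_field_vfields im_field_vfields by auto
  note c = v[THEN vfields_cvfields]
  have i: "ciscale Z \<in> cvfields A" if "Z \<in> cvfields A" for Z
    using that unfolding ciscale_cfscale by (intro cvfields_cfscale smooth_intros)
  have r: "lie_bracket Z (Y' + ciscale Y'') p = lie_bracket Z Y' p + cscale \<i> (lie_bracket Z Y'' p)"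
    if "Z \<in> cvfields A" "Y' \<in> cvfields A" "Y'' \<in> cvfields A" for Z Y' Y'' p
    using that i[of Y'']
    by (simp add: lie_bracket_add_right)
      (simp add: ciscale_cfscale lie_bracket_cfscale_right smooth_fun_on_const capply_fun_const[OF cvfields_ctangent[OF that(1)]])
  have l: "lie_bracket (X' + ciscale X'') Z p = lie_bracket X' Z p + cscale \<i> (lie_bracket X'' Z p)"
    if "Z \<in> cvfields A" "X' \<in> cvfields A" "X'' \<in> cvfields A" for Z X' X'' p
    using that i[of X'']
    by (simp add: lie_bracket_add_left)
      (simp add: ciscale_cfscale lie_bracket_cfscale_left smooth_fun_on_const capply_fun_const[OF cvfields_ctangent[OF that(1)]])
  have "lie_bracket (re_field X + ciscale (im_field X)) (re_field Y + ciscale (im_field Y)) p \<in> ctangent A p" for p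
    using cvfields_ctangent[OF vfields_cvfields[OF lie_bracket_vfields]] v
    by (simp add: r l c cvfields_add i ctangent_add ctangent_scale del: cscale_cscale)
  then have "lie_bracket X Y p \<in> ctangent A p" for p
    using re_im_field[of X] re_im_field[of Y] by simp
  moreover have "smooth (\<lambda>p. lie_bracket X Y p f)" for f
    unfolding lie_bracket_def by (intro smooth_intros smooth_capply smooth_app X Y)
  ultimately show ?thesis by (simp add: cvfields_iff)
qed

subsection \<open>Tensoriality\<close>

definition coord_frame :: "'a set \<Rightarrow> ('n \<Rightarrow> 'a cfield) \<Rightarrow> ('n \<Rightarrow> 'a \<Rightarrow> real) \<Rightarrow> bool" where
  "coord_frame V e x \<longleftrightarrow> open V \<and> (\<forall>i. e i \<in> vfields A) \<and> (\<forall>i. smooth (x i)) \<and>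
    (\<forall>q\<in>V. \<forall>v\<in>ctangent A q. v = (\<Sum>i\<in>UNIV. cscale (v (x i)) (e i q))) \<and>
    (\<forall>q\<in>V. \<forall>i j. e i q (x j) = of_bool (i = j))"

lemma coord_frame_exists: "\<exists>V e x. p \<in> V \<and> coord_frame V e x"
proof -
  obtain V :: "'a set" and e :: "'n \<Rightarrow> 'a cfield" and x :: "'n \<Rightarrow> 'a \<Rightarrow> real" where fr:
    "open V" "p \<in> V" "\<And>i. e i \<in> vfields A" "\<And>i. smooth (x i)"
    "\<And>q v. q \<in> V \<Longrightarrow> v \<in> ctangent A q \<Longrightarrow> v = (\<Sum>i\<in>UNIV. cscale (v (x i)) (e i q))"
    "\<And>q i j. q \<in> V \<Longrightarrow> e i q (x j) = of_bool (i = j)"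
    by (rule frame[of p]) blast
  then have "coord_frame V e x" unfolding coord_frame_def by (intro conjI ballI allI) assumption+
  with fr(2) show ?thesis by blast
qed

lemma coord_frame_expand:
  "coord_frame V e x \<Longrightarrow> q \<in> V \<Longrightarrow> v \<in> tangent A q \<Longrightarrow>
    v = (\<Sum>i\<in>UNIV. cscale (of_real (Re (v (x i)))) (e i q))"
  by (simp add: coord_frame_def tangent_ctangent tangent_of_Re)

text \<open>Linearity over the smooth functions makes \<open>G\<close> depend on Y only through Y p.
  For a bump function b with b p = 1 supported in V, the field b Y is a global combination of the
  frame with smooth coefficients, and G (b Y) = G Y.\<close>

lemma tensorial_expand:
  fixes G :: "'a cfield \<Rightarrow> real"
  assumes add: "\<And>Y Y'. Y \<in> vfields A \<Longrightarrow> Y' \<in> vfields A \<Longrightarrow> G (Y + Y') = G Y + G Y'"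
    and scale: "\<And>u Y. smooth u \<Longrightarrow> Y \<in> vfields A \<Longrightarrow> G (fscale u Y) = u p * G Y"
    and fr: "coord_frame V e x" "p \<in> V" and Y: "Y \<in> vfields A"
  shows "G Y = (\<Sum>i\<in>UNIV. Re (Y p (x i)) * G (e i))"
proof -
  have V: "open V" and e: "\<And>i. e i \<in> vfields A" using fr by (auto simp: coord_frame_def)
  obtain b :: "'a \<Rightarrow> real" and V' K where b: "smooth b" "p \<in> V'"
    "\<And>q. q \<in> V' \<Longrightarrow> b q = 1" "K \<subseteq> V" "\<And>q. q \<notin> K \<Longrightarrow> b q = 0"
    using bump[OF V fr(2)] by metis
  have s: "smooth (\<lambda>q. b q * Re (Y q (x i)))" for i
    using Y by (intro smooth_intros b smooth_app) (simp add: vfields_iff)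
  have "fscale b Y q = (\<Sum>i\<in>UNIV. fscale (\<lambda>q. b q * Re (Y q (x i))) (e i)) q" for q
  proof (cases "q \<in> V")
    case True
    have "fscale b Y q = cscale (of_real (b q)) (\<Sum>i\<in>UNIV. cscale (of_real (Re (Y q (x i)))) (e i q))"
      using coord_frame_expand[OF fr(1) True vfields_tangent[OF Y]] by (simp add: fscale_def)
    then show ?thesis
      by (simp add: fun_eq_iff sum_fun_apply2 fscale_def sum_distrib_left mult_ac)
  next
    case False
    then have "b q = 0" using b by blast
    then show ?thesis by (simp add: fun_eq_iff sum_fun_apply2 fscale_def)
  qed
  then have "fscale b Y = (\<Sum>i\<in>UNIV. fscale (\<lambda>q. b q * Re (Y q (x i))) (e i))" ..
  moreover have "G (\<Sum>i\<in>I. F i) = (\<Sum>i\<in>I. G (F i))" if "finite I" "\<And>i. F i \<in> vfields A" for I :: "'n set" and F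
    using that
  proof induction
    case empty
    have "G 0 = 0" using add[OF vfields_zero vfields_zero] unfolding add_0_left by linarith
    then show ?case by (simp only: sum.empty)
  qed (simp add: add vfields_sum)
  ultimately have "G (fscale b Y) = (\<Sum>i\<in>UNIV. G (fscale (\<lambda>q. b q * Re (Y q (x i))) (e i)))"
    using e s vfields_fscale by simp
  then show ?thesis
    using b(2,3) by (simp add: scale b(1) Y s e)
qed

lemma vfield_extend:
  assumes "v \<in> tangent A p"
  shows "\<exists>X\<in>vfields A. X p = v"
proof -
  obtain V e x where fr: "p \<in> V" "coord_frame V e x" using coord_frame_exists by blast
  let ?X = "\<Sum>i\<in>UNIV. fscale (\<lambda>_. Re (v (x i))) (e i)"
  have "?X \<in> vfields A"
    using fr(2) by (intro vfields_sum vfields_fscale smooth_fun_on_const) (auto simp: coord_frame_def)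
  moreover have "?X p = v"
    using coord_frame_expand[OF fr(2,1) assms] by (simp add: sum_fun_apply2 fscale_def)
  ultimately show ?thesis by blast
qed

end

section \<open>The bundle of type (1,0)\<close>

interpretation cvec: vector_space "cscale :: complex \<Rightarrow> 'a cvec \<Rightarrow> 'a cvec"
  by unfold_locales (auto simp: fun_eq_iff algebra_simps)

lemma cvec_span_image:
  "cvec.span (Z ` {..<j}) = {(\<Sum>i<j. cscale (c i) (Z i)) | c. True}" for Z :: "nat \<Rightarrow> 'a cvec"
proof
  have "Z i \<in> {(\<Sum>i<j. cscale (c i) (Z i)) | c. True}" if "i < j" for i
  proof -
    have "(\<Sum>l<j. cscale (if l = i then 1 else 0) (Z l)) = (\<Sum>l<j. if l = i then Z l else 0)"
      by (intro sum.cong) auto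
    also have "\<dots> = Z i" using that by simp
    finally show ?thesis
      unfolding mem_Collect_eq by (intro exI[of _ "\<lambda>l. if l = i then 1 else 0"]) simp
  qed
  moreover have "cvec.subspace {(\<Sum>i<j. cscale (c i) (Z i)) | c. True}"
  proof (rule cvec.subspaceI)
    show "0 \<in> {(\<Sum>i<j. cscale (c i) (Z i)) | c. True}"
      by (auto intro: exI[of _ "\<lambda>_. 0"])
  next
    fix x y assume "x \<in> {(\<Sum>i<j. cscale (c i) (Z i)) | c. True}" "y \<in> {(\<Sum>i<j. cscale (c i) (Z i)) | c. True}"
    then obtain c d where "x = (\<Sum>i<j. cscale (c i) (Z i))" "y = (\<Sum>i<j. cscale (d i) (Z i))" by auto
    then have "x + y = (\<Sum>i<j. cscale (c i + d i) (Z i))" by (simp add: cscale_add_left sum.distrib)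
    then show "x + y \<in> {(\<Sum>i<j. cscale (c i) (Z i)) | c. True}" by auto
  next
    fix k x assume "x \<in> {(\<Sum>i<j. cscale (c i) (Z i)) | c. True}"
    then obtain c where "x = (\<Sum>i<j. cscale (c i) (Z i))" by auto
    then have "cscale k x = (\<Sum>i<j. cscale (k * c i) (Z i))"
      by (simp add: cvec.scale_sum_right)
    then show "cscale k x \<in> {(\<Sum>i<j. cscale (c i) (Z i)) | c. True}" by auto
  qed
  ultimately show "cvec.span (Z ` {..<j}) \<subseteq> {(\<Sum>i<j. cscale (c i) (Z i)) | c. True}"
    by (intro cvec.span_minimal) auto
  show "{(\<Sum>i<j. cscale (c i) (Z i)) | c. True} \<subseteq> cvec.span (Z ` {..<j})"
    by clarify (rule cvec.span_sum, rule cvec.span_scale, rule cvec.span_base, blast)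
qed

text \<open>On the (1,0) vectors this is a real isomorphism onto \<open>H(M)\<close> which turns multiplication by
  the imaginary unit into \<open>J_b\<close>.\<close>
definition dbl :: "'a cvec \<Rightarrow> 'a cvec" where
  "dbl v = v + cconj v"

lemma dbl_add: "dbl (v + w) = dbl v + dbl w"
  and dbl_of_real: "dbl (cscale (of_real r) v) = cscale (of_real r) (dbl v)"
  and dbl_zero [simp]: "dbl 0 = 0"
  by (auto simp: dbl_def fun_eq_iff algebra_simps)

locale ph_manifold =
  fixes A :: "('a::{t2_space, second_countable_topology}, 'n::finite) chart set"
    and m :: nat
    and E :: "'a \<Rightarrow> 'a cvec set"
    and \<theta> :: "'a \<Rightarrow> 'a cvec \<Rightarrow> real"
    and h :: "'a \<Rightarrow> 'a cvec \<Rightarrow> 'a cvec \<Rightarrow> real"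
  assumes ph: "pseudo_hermitian_manifold A m E \<theta> h"

sublocale ph_manifold \<subseteq> smooth_manifold A
  using ph by unfold_locales (simp add: pseudo_hermitian_manifold_def cr_structure_def)

context smooth_manifold
begin

lemma cvfields_local:
  assumes "\<And>p. \<exists>V X'. open V \<and> p \<in> V \<and> X' \<in> cvfields A \<and> (\<forall>q\<in>V. X q = X' q)"
  shows "X \<in> cvfields A"
proof (rule cvfieldsI)
  show "X p \<in> ctangent A p" for p
    using assms[of p] cvfields_ctangent by metis
  fix f :: "'a \<Rightarrow> real"
  show "smooth (\<lambda>p. X p f)"
  proof (rule smooth_fun_on_local)
    fix p
    obtain V X' where V: "open V" "p \<in> V" "X' \<in> cvfields A" "\<forall>q\<in>V. X q = X' q"
      using assms[of p] by blast
    have "smooth_fun_on A V (\<lambda>p. X' p f)"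
      using smooth_fun_on_subset[OF smooth_app[OF V(3)]] by blast
    then have "smooth_fun_on A V (\<lambda>p. X p f)"
      by (rule iffD1[OF smooth_fun_on_cong[OF V(1)], rotated]) (use V(4) in simp)
    then show "\<exists>V. open V \<and> p \<in> V \<and> smooth_fun_on A V (\<lambda>p. X p f)" using V by blast
  qed
qed

lemma dbl_tangent: "v \<in> ctangent A p \<Longrightarrow> dbl v \<in> tangent A p"
  unfolding tangent_iff by (simp add: dbl_def ctangent_add ctangent_conj)

end

context ph_manifold
begin

abbreviation \<Gamma> :: "'a cfield set" where "\<Gamma> \<equiv> sections A E"
abbreviation H :: "'a \<Rightarrow> 'a cvec set" where "H \<equiv> Hreal A E"

lemma subbundle: "complex_subbundle A m E"
  and E_bar: "E p \<inter> bar E p = {0}"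
  and th: "one_form A \<theta>"
  and th_nz: "\<exists>v\<in>tangent A p. \<theta> p v \<noteq> 0"
  and H_iff': "{v \<in> tangent A p. \<theta> p v = 0} = H p"
  and nondegenerate: "levi_nondegenerate A E \<theta>"
  and metric: "fiber_metric A E h"
  and h_Jb: "u \<in> H p \<Longrightarrow> v \<in> H p \<Longrightarrow> h p (Jb E p u) (Jb E p v) = h p u v"
  using ph by (simp_all add: pseudo_hermitian_manifold_def cr_structure_def pseudo_hermitian_form_def)

lemma H_iff: "v \<in> H p \<longleftrightarrow> v \<in> tangent A p \<and> \<theta> p v = 0"
  using H_iff'[of p] by blast

lemma E_ctangent: "v \<in> E p \<Longrightarrow> v \<in> ctangent A p"
  using subbundle unfolding complex_subbundle_def by blast

text \<open>Cutting off turns the local frame from the definition of a subbundle into global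
  sections; spanning and independence survive where the bump function is 1.\<close>

lemma E_frame:
  obtains V Z where "open V" "p \<in> V" "\<And>i. i < m \<Longrightarrow> Z i \<in> \<Gamma>"
    "\<And>q. q \<in> V \<Longrightarrow> E q = cvec.span ((\<lambda>i. Z i q) ` {..<m})"
    "\<And>q c i. q \<in> V \<Longrightarrow> (\<Sum>i<m. cscale (c i) (Z i q)) = 0 \<Longrightarrow> i < m \<Longrightarrow> c i = 0"
proof -
  obtain U Z where UZ: "open U \<and> p \<in> U \<and> (\<forall>i<m. smooth_field_on A U (Z i)) \<and>
      (\<forall>q\<in>U. E q = {(\<Sum>i<m. cscale (c i) (Z i q)) | c. True} \<and>
        (\<forall>c. (\<Sum>i<m. cscale (c i) (Z i q)) = 0 \<longrightarrow> (\<forall>i<m. c i = 0)))"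
    using subbundle[unfolded complex_subbundle_def, THEN conjunct2, THEN spec[of _ p]]
    by (elim exE) (rule that)
  have Z: "open U" "p \<in> U" using UZ by simp_all
  have Z3: "smooth_field_on A U (Z i)" if "i < m" for i
    using UZ that by simp
  have Z4: "E q = {(\<Sum>i<m. cscale (c i) (Z i q)) | c. True}" if "q \<in> U" for q
    using UZ that by simp
  have Z5: "\<forall>i<m. c i = 0" if "q \<in> U" "(\<Sum>i<m. cscale (c i) (Z i q)) = 0" for q c
    using UZ that by simp
  have sp: "E q = cvec.span ((\<lambda>i. Z i q) ` {..<m})" if "q \<in> U" for q
    using Z4[OF that] cvec_span_image[of "\<lambda>i. Z i q" m] by simp
  have E0: "0 \<in> E q" for q
    using E_bar by blast
  obtain b :: "'a \<Rightarrow> real" and V K where b: "smooth b" "open V" "p \<in> V" "V \<subseteq> U"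
    "\<And>q. q \<in> V \<Longrightarrow> b q = 1" "closed K" "K \<subseteq> U" "\<And>q. q \<notin> K \<Longrightarrow> b q = 0"
    using bump[OF Z(1,2)] by metis
  define W where "W i q = cscale (of_real (b q)) (Z i q)" for i q
  have WE: "W i q \<in> E q" if "i < m" for i q
  proof (cases "q \<in> U")
    case True
    then show ?thesis using that unfolding W_def sp[OF True]
      by (intro cvec.span_scale cvec.span_base) auto
  next
    case False
    then have "W i q = 0" using b by (auto simp: W_def)
    then show ?thesis using E0 by simp
  qed
  have WG: "W i \<in> \<Gamma>" if "i < m" for i
  proof -
    have "smooth (\<lambda>q. b q *\<^sub>R Z i q f)" if "smooth f" for f
      using Z3[OF \<open>i < m\<close>] that
      by (intro smooth_bump_mult[OF b(1,6,7) Z(1) b(8)]) (simp_all add: smooth_field_on_def)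
    then show ?thesis
      using WE[OF that] E_ctangent by (auto simp: sections_iff W_def scaleR_conv_of_real)
  qed
  have WZ: "W i q = Z i q" if "q \<in> V" for i q
    using b(5)[OF that] by (simp add: W_def)
  show ?thesis
  proof (rule that[OF b(2,3) WG])
    fix q assume q: "q \<in> V"
    with b(4) have qU: "q \<in> U" by blast
    show "E q = cvec.span ((\<lambda>i. W i q) ` {..<m})"
      using sp[OF qU] by (simp add: WZ[OF q])
    fix c i assume "(\<Sum>i<m. cscale (c i) (W i q)) = 0" "i < m"
    then show "c i = 0" using Z5[OF qU, of c] by (simp add: WZ[OF q])
  qed
qed

lemma E_subspace: "cvec.subspace (E p)"
  by (rule E_frame[of p]) (metis cvec.subspace_span)

lemma E_zero: "0 \<in> E p" and E_add: "u \<in> E p \<Longrightarrow> v \<in> E p \<Longrightarrow> u + v \<in> E p"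
  and E_scale: "v \<in> E p \<Longrightarrow> cscale c v \<in> E p"
  and E_diff: "u \<in> E p \<Longrightarrow> v \<in> E p \<Longrightarrow> u - v \<in> E p"
  and E_uminus: "v \<in> E p \<Longrightarrow> - v \<in> E p"
  and E_sum: "(\<And>i. i \<in> I \<Longrightarrow> w i \<in> E p) \<Longrightarrow> sum w I \<in> E p"
  using E_subspace
  by (auto intro: cvec.subspace_0 cvec.subspace_add cvec.subspace_scale cvec.subspace_diff
      cvec.subspace_neg cvec.subspace_sum)

lemma bar_iff: "v \<in> bar E p \<longleftrightarrow> cconj v \<in> E p"
  unfolding bar_def by (metis cconj_cconj image_eqI imageE)

lemma E_bar_zero: "v \<in> E p \<Longrightarrow> cconj v \<in> E p \<Longrightarrow> v = 0"
  using E_bar[of p] bar_iff[of v p] by auto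

lemma dbl_inj: "u \<in> E p \<Longrightarrow> v \<in> E p \<Longrightarrow> dbl u = dbl v \<Longrightarrow> u = v"
proof -
  assume u: "u \<in> E p" and v: "v \<in> E p" and "dbl u = dbl v"
  then have "cconj (u - v) = - (u - v)"
    by (simp add: dbl_def fun_eq_iff) (metis (no_types) add_diff_cancel_left' add.commute add_diff_eq)
  then have "u - v = 0" using u v by (intro E_bar_zero[of _ p]) (auto intro: E_diff E_uminus)
  then show ?thesis by simp
qed

lemma dbl_H: "v \<in> E p \<Longrightarrow> dbl v \<in> H p"
  using dbl_tangent[OF E_ctangent] unfolding Hreal_def bar_def dbl_def by blast

text \<open>A real vector a + b, with a in E and b in the conjugate bundle, equals its own
  conjugate. So a - conj b is a (1,0) vector fixed by conjugation; it lies in both bundles and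
  vanishes.\<close>

lemma H_dbl: "v \<in> H p \<Longrightarrow> \<exists>w\<in>E p. v = dbl w"
proof -
  assume "v \<in> H p"
  then obtain a b where ab: "a \<in> E p" "cconj b \<in> E p" "v = a + b" and v: "v \<in> tangent A p"
    unfolding Hreal_def bar_iff by blast
  have "cconj v = v" using tangent_real[OF v] by (simp add: fun_eq_iff complex_eq_iff)
  then have "cnj (a f) + cnj (b f) = a f + b f" for f
    using ab(3) by (metis cconj_apply plus_fun_apply complex_cnj_add)
  then have "cnj (a f) - b f = a f - cnj (b f)" for f
    by (simp add: algebra_simps)
  then have "cconj (a - cconj b) = a - cconj b"
    by (simp add: fun_eq_iff)
  moreover have "a - cconj b \<in> E p" using ab by (intro E_diff)
  ultimately have "a - cconj b = 0" by (intro E_bar_zero) simp_all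
  then have "b = cconj a" by (metis cconj_cconj eq_iff_diff_eq_0)
  then show ?thesis using ab by (auto simp: dbl_def)
qed

lemma Jb_dbl: "v \<in> E p \<Longrightarrow> Jb E p (dbl v) = dbl (cscale \<i> v)"
proof -
  assume v: "v \<in> E p"
  have e: "cscale \<i> (v - cconj v) = dbl (cscale \<i> v)" for v :: "'a cvec"
    by (simp add: dbl_def fun_eq_iff algebra_simps)
  show ?thesis unfolding Jb_def
  proof (rule the_equality)
    show "\<exists>z\<in>E p. dbl v = z + cconj z \<and> dbl (cscale \<i> v) = cscale \<i> (z - cconj z)"
      using v e by (intro bexI[of _ v]) (auto simp: dbl_def)
  next
    fix w assume "\<exists>z\<in>E p. dbl v = z + cconj z \<and> w = cscale \<i> (z - cconj z)"
    then obtain z where "z \<in> E p" "dbl v = dbl z" "w = cscale \<i> (z - cconj z)" by (auto simp: dbl_def)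
    then show "w = dbl (cscale \<i> v)" using dbl_inj[OF v] e by metis
  qed
qed

lemma h_add: "u \<in> H p \<Longrightarrow> v \<in> H p \<Longrightarrow> w \<in> H p \<Longrightarrow> h p (u + v) w = h p u w + h p v w"
  and h_scale: "u \<in> H p \<Longrightarrow> v \<in> H p \<Longrightarrow> h p (cscale (of_real c) u) v = c * h p u v"
  and h_sym: "u \<in> H p \<Longrightarrow> v \<in> H p \<Longrightarrow> h p u v = h p v u"
  and h_pos: "u \<in> H p \<Longrightarrow> u \<noteq> 0 \<Longrightarrow> h p u u > 0"
  and h_smooth: "X \<in> sections A H \<Longrightarrow> Y \<in> sections A H \<Longrightarrow> smooth (\<lambda>p. h p (X p) (Y p))"
  using metric unfolding fiber_metric_def by blast+

subsection \<open>The Hermitian form\<close>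

text \<open>The Hermitian form, linear in the first and conjugate linear in the second slot. Its
  real part is \<open>h\<close> transported by \<open>dbl\<close>; its imaginary part at (w, v) is
  then forced to be the real part at (w, iv).\<close>

definition K :: "'a \<Rightarrow> 'a cvec \<Rightarrow> 'a cvec \<Rightarrow> complex" where
  "K p w v = of_real (h p (dbl w) (dbl v)) + \<i> * of_real (h p (dbl w) (dbl (cscale \<i> v)))"

lemma h_dbl_i: "u \<in> E p \<Longrightarrow> v \<in> E p \<Longrightarrow> h p (dbl (cscale \<i> u)) (dbl (cscale \<i> v)) = h p (dbl u) (dbl v)"
  using h_Jb[OF dbl_H dbl_H] by (simp add: Jb_dbl)

text \<open>\<open>J_b\<close> is an isometry with square -1, hence skew.\<close>

lemma h_dbl_skew:
  assumes "u \<in> E p" "v \<in> E p"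
  shows "h p (dbl (cscale \<i> u)) (dbl v) = - h p (dbl u) (dbl (cscale \<i> v))"
proof -
  have cc: "cscale \<i> (cscale \<i> u) = cscale (of_real (-1)) u"
    by (simp add: fun_eq_iff)
  have "h p (dbl (cscale \<i> u)) (dbl v) = h p (dbl (cscale (of_real (-1)) u)) (dbl (cscale \<i> v))"
    unfolding cc[symmetric] by (rule h_dbl_i[OF E_scale, symmetric]) (use assms in auto)
  also have "h p (dbl (cscale (of_real (-1)) u)) (dbl (cscale \<i> v)) = -1 * h p (dbl u) (dbl (cscale \<i> v))"
    unfolding dbl_of_real by (rule h_scale[OF dbl_H dbl_H[OF E_scale]]) (use assms in auto)
  finally show ?thesis by simp
qed

lemma K_add_left:
  assumes "u \<in> E p" "v \<in> E p" "w \<in> E p"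
  shows "K p (u + v) w = K p u w + K p v w"
  using assms by (simp add: K_def dbl_add h_add dbl_H E_scale algebra_simps)

lemma K_scale_left:
  assumes u: "u \<in> E p" and w: "w \<in> E p"
  shows "K p (cscale c u) w = c * K p u w"
proof -
  have r: "K p (cscale (of_real r) u) w = of_real r * K p u w" if "u \<in> E p" for r u
    using that w by (simp add: K_def dbl_of_real h_scale dbl_H E_scale algebra_simps)
  have i: "K p (cscale \<i> u) w = \<i> * K p u w"
    using u w by (simp add: K_def h_dbl_skew h_dbl_i algebra_simps)
  have "c = of_real (Re c) + of_real (Im c) * \<i>" by (simp add: complex_eq_iff)
  then have "cscale c u = cscale (of_real (Re c)) u + cscale (of_real (Im c)) (cscale \<i> u)"
    by (metis cscale_add_left cscale_cscale)
  then have "K p (cscale c u) w = of_real (Re c) * K p u w + of_real (Im c) * (\<i> * K p u w)"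
    using u w by (simp only: K_add_left E_scale r i)
  also have "\<dots> = c * K p u w" by (simp add: complex_eq_iff)
  finally show ?thesis .
qed

lemma K_herm:
  assumes "u \<in> E p" "v \<in> E p"
  shows "cnj (K p u v) = K p v u"
proof -
  have "h p (dbl u) (dbl (cscale \<i> v)) = - h p (dbl v) (dbl (cscale \<i> u))"
    using h_dbl_skew[OF assms] h_sym[OF dbl_H dbl_H, of "cscale \<i> u" p v] assms E_scale by simp
  then show ?thesis
    using h_sym[OF dbl_H dbl_H, of u p v] assms by (simp add: K_def)
qed

lemma K_add_right:
  assumes "u \<in> E p" "v \<in> E p" "w \<in> E p"
  shows "K p u (v + w) = K p u v + K p u w"
  using K_add_left[of v p w u] assms by (metis K_herm E_add complex_cnj_add)

lemma K_scale_right: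
  assumes "u \<in> E p" "v \<in> E p"
  shows "K p u (cscale c v) = cnj c * K p u v"
  using K_scale_left[of v p u c] assms by (metis K_herm E_scale complex_cnj_mult)

lemma K_pos:
  assumes u: "u \<in> E p" "u \<noteq> 0"
  shows "K p u u = of_real (h p (dbl u) (dbl u))" "h p (dbl u) (dbl u) > 0"
proof -
  have "Im (cnj (K p u u)) = Im (K p u u)" using K_herm u by metis
  then show "K p u u = of_real (h p (dbl u) (dbl u))" by (simp add: K_def complex_eq_iff)
  have "dbl u \<noteq> 0" using dbl_inj[OF u(1) E_zero] u(2) by auto
  then show "h p (dbl u) (dbl u) > 0" using h_pos dbl_H u by blast
qed

lemma K_zero_imp: "u \<in> E p \<Longrightarrow> K p u u = 0 \<Longrightarrow> u = 0"
  using K_pos[of u p] by fastforce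

lemma K_zero_left [simp]: "v \<in> E p \<Longrightarrow> K p 0 v = 0"
  using K_scale_left[OF E_zero, of v p 0] by simp

lemma K_uminus_left: "u \<in> E p \<Longrightarrow> v \<in> E p \<Longrightarrow> K p (- u) v = - K p u v"
  using K_scale_left[of u p v "-1"] by (simp add: cscale_minus_left)

lemma K_diff_left: "u \<in> E p \<Longrightarrow> v \<in> E p \<Longrightarrow> w \<in> E p \<Longrightarrow> K p (u - v) w = K p u w - K p v w"
  using K_add_left[of u p "- v" w] by (simp add: K_uminus_left E_uminus)

lemma K_diff_right: "u \<in> E p \<Longrightarrow> v \<in> E p \<Longrightarrow> w \<in> E p \<Longrightarrow> K p u (v - w) = K p u v - K p u w"
  using K_diff_left[of v p w u] by (metis K_herm E_diff complex_cnj_diff)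

lemma K_sum_left:
  "(\<And>i. i \<in> I \<Longrightarrow> w i \<in> E p) \<Longrightarrow> v \<in> E p \<Longrightarrow> K p (\<Sum>i\<in>I. w i) v = (\<Sum>i\<in>I. K p (w i) v)"
  by (induction I rule: infinite_finite_induct) (auto simp: K_add_left E_sum)

lemma K_lincomb_left:
  assumes "\<And>i. i \<in> I \<Longrightarrow> w i \<in> E p" "v \<in> E p"
  shows "K p (\<Sum>i\<in>I. cscale (c i) (w i)) v = (\<Sum>i\<in>I. c i * K p (w i) v)"
proof -
  have "K p (\<Sum>i\<in>I. cscale (c i) (w i)) v = (\<Sum>i\<in>I. K p (cscale (c i) (w i)) v)"
    using assms by (intro K_sum_left E_scale)
  also have "\<dots> = (\<Sum>i\<in>I. c i * K p (w i) v)"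
    using assms by (intro sum.cong refl K_scale_left)
  finally show ?thesis .
qed

lemma K_eqI:
  assumes "u \<in> E p" "v \<in> E p" "\<And>w. w \<in> E p \<Longrightarrow> K p w u = K p w v"
  shows "u = v"
  using K_zero_imp[of "u - v" p] assms by (simp add: E_diff K_diff_right)

lemma \<Gamma>_cvfields: "X \<in> \<Gamma> \<Longrightarrow> X \<in> cvfields A"
  and \<Gamma>_E: "X \<in> \<Gamma> \<Longrightarrow> X p \<in> E p"
  by (simp_all add: sections_cvfields[of X E])

lemma \<Gamma>I: "X \<in> cvfields A \<Longrightarrow> (\<And>p. X p \<in> E p) \<Longrightarrow> X \<in> \<Gamma>"
  by (simp add: sections_cvfields[of X E])

lemma \<Gamma>_zero: "0 \<in> \<Gamma>"
  by (intro \<Gamma>I cvfields_zero) (simp add: E_zero)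

lemma \<Gamma>_add: "X \<in> \<Gamma> \<Longrightarrow> Y \<in> \<Gamma> \<Longrightarrow> X + Y \<in> \<Gamma>"
  by (intro \<Gamma>I cvfields_add) (simp_all add: E_add \<Gamma>_cvfields \<Gamma>_E)

lemma \<Gamma>_diff: "X \<in> \<Gamma> \<Longrightarrow> Y \<in> \<Gamma> \<Longrightarrow> X - Y \<in> \<Gamma>"
  by (intro \<Gamma>I cvfields_diff) (simp_all add: E_diff \<Gamma>_cvfields \<Gamma>_E)

lemma \<Gamma>_cfscale: "smooth u \<Longrightarrow> X \<in> \<Gamma> \<Longrightarrow> cfscale u X \<in> \<Gamma>"
  by (intro \<Gamma>I cvfields_cfscale) (simp_all add: E_scale \<Gamma>_cvfields \<Gamma>_E)

lemma \<Gamma>_sum: "(\<And>i. i \<in> I \<Longrightarrow> X i \<in> \<Gamma>) \<Longrightarrow> (\<Sum>i\<in>I. X i) \<in> \<Gamma>"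
  by (induction I rule: infinite_finite_induct) (auto intro: \<Gamma>_zero \<Gamma>_add)

definition fdbl :: "'a cfield \<Rightarrow> 'a cfield" where "fdbl X = X + fconj X"

lemma fdbl_apply [simp]: "fdbl X p = dbl (X p)"
  by (simp add: fdbl_def dbl_def)

lemma fdbl_vfields: "X \<in> cvfields A \<Longrightarrow> fdbl X \<in> vfields A"
  unfolding vfields_iff
  by (simp add: dbl_tangent cvfields_ctangent) (simp add: fdbl_def cvfields_add cvfields_fconj)

lemma fdbl_H: "X \<in> \<Gamma> \<Longrightarrow> fdbl X \<in> sections A H"
  unfolding sections_cvfields[of _ H]
  by (intro conjI vfields_cvfields fdbl_vfields \<Gamma>_cvfields) (simp_all add: dbl_H \<Gamma>_E)

text \<open>Here \<open>w\<close> is only a pointwise half of the smooth field Y. As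
  \<open>h\<close> sees it through Y alone, its products with sections are smooth before
  \<open>w\<close> itself is known to be; \<open>smooth_undouble\<close> rests on this.\<close>

lemma smooth_K_half:
  assumes "Y \<in> sections A H" "\<And>p. w p \<in> E p" "\<And>p. Y p = dbl (w p)" "V \<in> \<Gamma>"
  shows "smooth (\<lambda>p. K p (w p) (V p))"
proof -
  have "smooth (\<lambda>p. h p (Y p) (fdbl V p))" "smooth (\<lambda>p. h p (Y p) (fdbl (cfscale (\<lambda>_. \<i>) V) p))"
    by (intro h_smooth fdbl_H \<Gamma>_cfscale smooth_fun_on_const assms)+
  then show ?thesis unfolding K_def using assms(3) by (intro smooth_intros) simp_all
qed

lemma smooth_K: "W \<in> \<Gamma> \<Longrightarrow> V \<in> \<Gamma> \<Longrightarrow> smooth (\<lambda>p. K p (W p) (V p))"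
  by (rule smooth_K_half[OF fdbl_H, of W]) (simp_all add: \<Gamma>_E)

subsection \<open>Orthogonal frames\<close>

text \<open>One Gram-Schmidt step. The coefficients K(Z, W i) / K(W i, W i) make sense only where
  the W i do not vanish, so they are cut off, and orthogonality is obtained on a smaller
  set.\<close>

lemma orthogonal_step:
  fixes W :: "nat \<Rightarrow> 'a cfield"
  assumes V: "open V" "p \<in> V" and Z: "Z \<in> \<Gamma>" and W: "\<And>i. i < j \<Longrightarrow> W i \<in> \<Gamma>"
    and nz: "\<And>q i. q \<in> V \<Longrightarrow> i < j \<Longrightarrow> W i q \<noteq> 0"
    and orth: "\<And>q i l. q \<in> V \<Longrightarrow> i < j \<Longrightarrow> l < j \<Longrightarrow> i \<noteq> l \<Longrightarrow> K q (W i q) (W l q) = 0"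
  shows "\<exists>V' c. open V' \<and> p \<in> V' \<and> V' \<subseteq> V \<and> Z - (\<Sum>i<j. cfscale (c i) (W i)) \<in> \<Gamma> \<and>
    (\<forall>q\<in>V'. \<forall>i<j. K q ((Z - (\<Sum>i<j. cfscale (c i) (W i))) q) (W i q) = 0)"
proof -
  obtain b :: "'a \<Rightarrow> real" and V' C where b: "smooth b" "open V'" "p \<in> V'" "V' \<subseteq> V"
    "\<And>q. q \<in> V' \<Longrightarrow> b q = 1" "closed C" "C \<subseteq> V" "\<And>q. q \<notin> C \<Longrightarrow> b q = 0"
    using bump[OF V] by metis
  define c where "c i q = b q *\<^sub>R (K q (Z q) (W i q) * inverse (K q (W i q) (W i q)))" for i q
  have Knz: "K q (W i q) (W i q) \<noteq> 0" if "q \<in> V" "i < j" for q i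
    using K_zero_imp[OF \<Gamma>_E[OF W]] nz that by blast
  have sc: "smooth (c i)" if "i < j" for i
    unfolding c_def
    by (intro smooth_bump_mult[OF b(1,6,7) V(1) b(8)] smooth_fun_on_mult[OF V(1)]
        smooth_fun_on_inverse[OF V(1)] Knz that smooth_fun_on_subset[OF smooth_K, of _ _ V] Z W) auto
  have RG: "Z - (\<Sum>i<j. cfscale (c i) (W i)) \<in> \<Gamma>"
    by (intro \<Gamma>_diff \<Gamma>_sum \<Gamma>_cfscale Z) (auto intro: sc W)
  have "K q ((Z - (\<Sum>i<j. cfscale (c i) (W i))) q) (W l q) = 0" if q: "q \<in> V'" and l: "l < j" for q l
  proof -
    have qV: "q \<in> V" using q b(4) by blast
    have 1: "K q ((Z - (\<Sum>i<j. cfscale (c i) (W i))) q) (W l q) =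
        K q (Z q) (W l q) - (\<Sum>i<j. c i q * K q (W i q) (W l q))"
    proof -
      have WE: "W i q \<in> E q" if "i \<in> {..<j}" for i using that \<Gamma>_E[OF W] by simp
      have "K q (Z q - (\<Sum>i<j. cscale (c i q) (W i q))) (W l q) =
          K q (Z q) (W l q) - K q (\<Sum>i<j. cscale (c i q) (W i q)) (W l q)"
        by (intro K_diff_left E_sum E_scale WE \<Gamma>_E[OF Z]) (use l in simp_all)
      moreover have "K q (\<Sum>i<j. cscale (c i q) (W i q)) (W l q) = (\<Sum>i<j. c i q * K q (W i q) (W l q))"
        by (intro K_lincomb_left WE) (use l in simp_all)
      ultimately show ?thesis by (simp add: sum_fun_apply2)
    qed
    have "(\<Sum>i<j. c i q * K q (W i q) (W l q)) = (\<Sum>i<j. if i = l then c l q * K q (W l q) (W l q) else 0)"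
      using orth[OF qV _ l] by (intro sum.cong) auto
    also have "\<dots> = c l q * K q (W l q) (W l q)" using l by simp
    also have "\<dots> = K q (Z q) (W l q)" using Knz[OF qV l] by (simp add: c_def b(5)[OF q])
    finally show ?thesis unfolding 1 by simp
  qed
  with b RG show ?thesis
    by (intro exI[of _ V'] exI[of _ c] conjI ballI allI impI) simp_all
qed

text \<open>Gram-Schmidt in m steps, with the neighbourhood shrinking in each. The vectors stay
  unnormalised, which keeps square roots out of the smoothness argument.\<close>

lemma orthogonal_frame:
  obtains V W where "open V" "p \<in> V" "\<And>i. i < m \<Longrightarrow> W i \<in> \<Gamma>"
    "\<And>q. q \<in> V \<Longrightarrow> E q = cvec.span ((\<lambda>i. W i q) ` {..<m})"
    "\<And>q i. q \<in> V \<Longrightarrow> i < m \<Longrightarrow> W i q \<noteq> 0"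
    "\<And>q i l. q \<in> V \<Longrightarrow> i < m \<Longrightarrow> l < m \<Longrightarrow> i \<noteq> l \<Longrightarrow> K q (W i q) (W l q) = 0"
proof -
  obtain V0 Z where V0: "open V0" "p \<in> V0" and Z: "\<And>i. i < m \<Longrightarrow> Z i \<in> \<Gamma>"
    and sp: "\<And>q. q \<in> V0 \<Longrightarrow> E q = cvec.span ((\<lambda>i. Z i q) ` {..<m})"
    and ind: "\<And>q c i. q \<in> V0 \<Longrightarrow> (\<Sum>i<m. cscale (c i) (Z i q)) = 0 \<Longrightarrow> i < m \<Longrightarrow> c i = 0"
    by (rule E_frame[of p]) blast
  \<comment> \<open>Independence of the Z i, in the form that makes each new Gram-Schmidt vector
    nonzero.\<close>
  have notin: "Z j q \<notin> cvec.span ((\<lambda>i. Z i q) ` {..<j})" if j: "j < m" and q: "q \<in> V0" for j q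
  proof
    assume "Z j q \<in> cvec.span ((\<lambda>i. Z i q) ` {..<j})"
    then obtain c where c: "Z j q = (\<Sum>i<j. cscale (c i) (Z i q))"
      unfolding cvec_span_image by blast
    let ?d = "\<lambda>i. if i < j then c i else if i = j then - 1 else 0"
    have "(\<Sum>i<m. cscale (?d i) (Z i q)) = (\<Sum>i<Suc j. cscale (?d i) (Z i q))"
      using j by (intro sum.mono_neutral_right) auto
    also have "\<dots> = 0" using c by (simp add: cscale_minus_left)
    finally show False using ind[OF q, of ?d j] j by simp
  qed
  \<comment> \<open>Equality of the partial spans is part of the invariant: it lets
    \<open>notin\<close> speak about the orthogonalised vectors, and at j = m it says that they span
    E.\<close>
  define P where "P j V W \<longleftrightarrow> open V \<and> p \<in> V \<and> V \<subseteq> V0 \<and> (\<forall>i<j. W i \<in> \<Gamma>) \<and>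
     (\<forall>q\<in>V. cvec.span ((\<lambda>i. W i q) ` {..<j}) = cvec.span ((\<lambda>i. Z i q) ` {..<j}) \<and>
       (\<forall>i<j. W i q \<noteq> 0) \<and> (\<forall>i<j. \<forall>l<j. i \<noteq> l \<longrightarrow> K q (W i q) (W l q) = 0))"
    for j :: nat and V and W :: "nat \<Rightarrow> 'a cfield"
  have "\<exists>V W. P j V W" if "j \<le> m" for j
    using that
  proof (induction j)
    case 0
    have "P 0 V0 Z" using V0 by (simp add: P_def)
    then show ?case by blast
  next
    case (Suc j)
    then obtain V W where PVW: "P j V W" by auto
    then have V: "open V" "p \<in> V" "V \<subseteq> V0" and W: "\<And>i. i < j \<Longrightarrow> W i \<in> \<Gamma>"
      and s: "\<And>q. q \<in> V \<Longrightarrow> cvec.span ((\<lambda>i. W i q) ` {..<j}) = cvec.span ((\<lambda>i. Z i q) ` {..<j})"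
      and nz: "\<And>q i. q \<in> V \<Longrightarrow> i < j \<Longrightarrow> W i q \<noteq> 0"
      and orth: "\<And>q i l. q \<in> V \<Longrightarrow> i < j \<Longrightarrow> l < j \<Longrightarrow> i \<noteq> l \<Longrightarrow> K q (W i q) (W l q) = 0"
      by (auto simp: P_def)
    have jm: "j < m" using Suc.prems by simp
    have "\<exists>V' c. open V' \<and> p \<in> V' \<and> V' \<subseteq> V \<and> Z j - (\<Sum>i<j. cfscale (c i) (W i)) \<in> \<Gamma> \<and>
      (\<forall>q\<in>V'. \<forall>i<j. K q ((Z j - (\<Sum>i<j. cfscale (c i) (W i))) q) (W i q) = 0)"
      by (rule orthogonal_step[OF V(1,2) Z[OF jm]]) (simp_all add: W nz orth)
    then obtain V' c where V'c: "open V' \<and> p \<in> V' \<and> V' \<subseteq> V \<and> Z j - (\<Sum>i<j. cfscale (c i) (W i)) \<in> \<Gamma> \<and>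
      (\<forall>q\<in>V'. \<forall>i<j. K q ((Z j - (\<Sum>i<j. cfscale (c i) (W i))) q) (W i q) = 0)"
      by (elim exE) (rule that)
    then have V': "open V'" "p \<in> V'" "V' \<subseteq> V" and R: "Z j - (\<Sum>i<j. cfscale (c i) (W i)) \<in> \<Gamma>"
      by simp_all
    have Ro: "K q ((Z j - (\<Sum>i<j. cfscale (c i) (W i))) q) (W i q) = 0" if "q \<in> V'" "i < j" for q i
      using V'c that by (elim conjE) blast
    define R where "R = Z j - (\<Sum>i<j. cfscale (c i) (W i))"
    define W' where "W' = W(j := R)"
    have W'j: "W' j = R" and W'i: "\<And>i. i < j \<Longrightarrow> W' i = W i" by (auto simp: W'_def)
    have "P (Suc j) V' W'"
      unfolding P_def
    proof (intro conjI ballI allI impI)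
      show "open V'" "p \<in> V'" "V' \<subseteq> V0" using V' V by auto
      show "W' i \<in> \<Gamma>" if "i < Suc j" for i
        using that W R by (auto simp: W'_def R_def less_Suc_eq)
      fix q assume q: "q \<in> V'"
      then have qV: "q \<in> V" and qV0: "q \<in> V0" using V' V by auto
      define S where "S = cvec.span ((\<lambda>i. Z i q) ` {..<j})"
      have comb: "(\<Sum>i<j. cscale (c i q) (W i q)) \<in> S"
        unfolding S_def s[OF qV, symmetric]
        by (intro cvec.span_sum cvec.span_scale) (auto intro: cvec.span_base)
      have Rq: "R q = Z j q - (\<Sum>i<j. cscale (c i q) (W i q))"
        by (simp add: R_def sum_fun_apply2)
      have Rnz: "R q \<noteq> 0"
        using comb notin[OF jm qV0] Rq by (auto simp: S_def)
      have im: "(\<lambda>i. W' i q) ` {..<Suc j} = insert (R q) ((\<lambda>i. W i q) ` {..<j})"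
        using W'j W'i by (auto simp: lessThan_Suc image_iff)
      have imZ: "(\<lambda>i. Z i q) ` {..<Suc j} = insert (Z j q) ((\<lambda>i. Z i q) ` {..<j})"
        by (simp add: lessThan_Suc)
      have sub: "S \<subseteq> cvec.span (insert x ((\<lambda>i. Z i q) ` {..<j}))" for x
        unfolding S_def by (intro cvec.span_mono) auto
      have sub': "S \<subseteq> cvec.span (insert x ((\<lambda>i. W i q) ` {..<j}))" for x
        unfolding S_def s[OF qV, symmetric] by (intro cvec.span_mono) auto
      show "cvec.span ((\<lambda>i. W' i q) ` {..<Suc j}) = cvec.span ((\<lambda>i. Z i q) ` {..<Suc j})"
        unfolding im imZ cvec.span_eq
      proof (intro conjI insert_subsetI)
        show "R q \<in> cvec.span (insert (Z j q) ((\<lambda>i. Z i q) ` {..<j}))"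
          unfolding Rq using comb sub
          by (intro cvec.span_diff[OF cvec.span_base]) auto
        have "(\<lambda>i. W i q) ` {..<j} \<subseteq> S"
          unfolding S_def s[OF qV, symmetric] by (rule cvec.span_superset)
        then show "(\<lambda>i. W i q) ` {..<j} \<subseteq> cvec.span (insert (Z j q) ((\<lambda>i. Z i q) ` {..<j}))"
          using sub by blast
        have "R q + (\<Sum>i<j. cscale (c i q) (W i q)) \<in> cvec.span (insert (R q) ((\<lambda>i. W i q) ` {..<j}))"
          using comb sub' by (intro cvec.span_add[OF cvec.span_base]) auto
        then show "Z j q \<in> cvec.span (insert (R q) ((\<lambda>i. W i q) ` {..<j}))"
          by (simp add: Rq)
        have "(\<lambda>i. Z i q) ` {..<j} \<subseteq> S"
          unfolding S_def by (rule cvec.span_superset)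
        then show "(\<lambda>i. Z i q) ` {..<j} \<subseteq> cvec.span (insert (R q) ((\<lambda>i. W i q) ` {..<j}))"
          using sub' by blast
      qed
      show "W' i q \<noteq> 0" if "i < Suc j" for i
        using that nz[OF qV] Rnz W'j W'i by (cases "i = j") auto
      have RE: "R q \<in> E q" using R by (simp add: R_def[symmetric] \<Gamma>_E)
      have o1: "K q (R q) (W i q) = 0" if "i < j" for i
        using Ro[OF q that] by (simp add: R_def)
      then have o2: "K q (W i q) (R q) = 0" if "i < j" for i
        using that K_herm[OF RE \<Gamma>_E[OF W[OF that]]] by (metis complex_cnj_zero)
      show "K q (W' i q) (W' l q) = 0" if "i < Suc j" "l < Suc j" "i \<noteq> l" for i l
        using that o1 o2 orth[OF qV] W'j W'i by (cases "i = j"; cases "l = j") auto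
    qed
    then show ?case by blast
  qed
  then obtain V W where "P m V W" by blast
  then show ?thesis
    using sp by (intro that[of V W]) (auto simp: P_def)
qed

text \<open>The form in which frames are used later: the identity recovers a (1,0) vector from its
  products with smooth sections. For an orthogonal frame W one takes U = W / K(W, W) with a
  cut-off.\<close>

definition dual_frames :: "'a set \<Rightarrow> (nat \<Rightarrow> 'a cfield) \<Rightarrow> (nat \<Rightarrow> 'a cfield) \<Rightarrow> bool" where
  "dual_frames V W U \<longleftrightarrow> open V \<and> (\<forall>i<m. W i \<in> \<Gamma> \<and> U i \<in> \<Gamma>) \<and>
    (\<forall>q\<in>V. \<forall>e\<in>E q. e = (\<Sum>i<m. cscale (K q e (W i q)) (U i q)))"

lemma dual_frames_exist: "\<exists>V W U. p \<in> V \<and> dual_frames V W U"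
proof -
  obtain V W where V: "open V" "p \<in> V" and W: "\<And>i. i < m \<Longrightarrow> W i \<in> \<Gamma>"
    and sp: "\<And>q. q \<in> V \<Longrightarrow> E q = cvec.span ((\<lambda>i. W i q) ` {..<m})"
    and nz: "\<And>q i. q \<in> V \<Longrightarrow> i < m \<Longrightarrow> W i q \<noteq> 0"
    and orth: "\<And>q i l. q \<in> V \<Longrightarrow> i < m \<Longrightarrow> l < m \<Longrightarrow> i \<noteq> l \<Longrightarrow> K q (W i q) (W l q) = 0"
    by (rule orthogonal_frame[of p]) blast
  obtain b :: "'a \<Rightarrow> real" and V' C where b: "smooth b" "open V'" "p \<in> V'" "V' \<subseteq> V"
    "\<And>q. q \<in> V' \<Longrightarrow> b q = 1" "closed C" "C \<subseteq> V" "\<And>q. q \<notin> C \<Longrightarrow> b q = 0"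
    using bump[OF V] by metis
  define U where "U i = cfscale (\<lambda>q. b q *\<^sub>R inverse (K q (W i q) (W i q))) (W i)" for i
  have Knz: "K q (W i q) (W i q) \<noteq> 0" if "q \<in> V" "i < m" for q i
    using K_zero_imp[OF \<Gamma>_E[OF W]] nz that by blast
  have UG: "U i \<in> \<Gamma>" if "i < m" for i
    unfolding U_def
    by (intro \<Gamma>_cfscale smooth_bump_mult[OF b(1,6,7) V(1) b(8)] smooth_fun_on_inverse[OF V(1)]
        Knz that smooth_fun_on_subset[OF smooth_K, of _ _ V] W) auto
  have "e = (\<Sum>i<m. cscale (K q e (W i q)) (U i q))" if q: "q \<in> V'" and e: "e \<in> E q" for q e
  proof -
    have qV: "q \<in> V" using q b(4) by blast
    obtain c where c: "e = (\<Sum>i<m. cscale (c i) (W i q))"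
      using e unfolding sp[OF qV] cvec_span_image by blast
    have "K q e (W l q) = c l * K q (W l q) (W l q)" if l: "l < m" for l
    proof -
      have "K q e (W l q) = (\<Sum>i<m. c i * K q (W i q) (W l q))"
        unfolding c using l by (intro K_lincomb_left \<Gamma>_E W) simp_all
      also have "\<dots> = (\<Sum>i<m. if i = l then c l * K q (W l q) (W l q) else 0)"
        using orth[OF qV _ l] by (intro sum.cong) auto
      finally show ?thesis using l by simp
    qed
    then have "cscale (K q e (W i q)) (U i q) = cscale (c i) (W i q)" if "i < m" for i
      using that Knz[OF qV that] b(5)[OF q] by (simp add: U_def)
    then show ?thesis using c by simp
  qed
  then have "dual_frames V' W U" using b(2) W UG by (simp add: dual_frames_def)
  then show ?thesis using b(3) by blast
qed

text \<open>The identity in \<open>dual_frames\<close> says that a certain endomorphism is the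
  identity. This is the same statement for its \<open>K\<close>-adjoint, in which W and U trade
  places.\<close>

lemma dual_frames_adjoint:
  assumes "dual_frames V W U" "q \<in> V" "e \<in> E q"
  shows "e = (\<Sum>i<m. cscale (K q e (U i q)) (W i q))"
proof (rule K_eqI)
  have WU: "W i q \<in> E q" "U i q \<in> E q" if "i < m" for i
    using assms(1) that \<Gamma>_E unfolding dual_frames_def by blast+
  show "e \<in> E q" "(\<Sum>i<m. cscale (K q e (U i q)) (W i q)) \<in> E q"
    using assms WU by (auto intro!: E_sum E_scale)
  fix w assume w: "w \<in> E q"
  have "K q w e = K q (\<Sum>i<m. cscale (K q w (W i q)) (U i q)) e"
    using assms w unfolding dual_frames_def by metis
  also have "\<dots> = (\<Sum>i<m. K q w (W i q) * K q (U i q) e)"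
    using assms(3) w WU by (subst K_lincomb_left) simp_all
  also have "\<dots> = cnj (\<Sum>i<m. K q e (U i q) * K q (W i q) w)"
    using assms(3) w WU by (simp add: K_herm mult.commute cong: sum.cong_simp)
  also have "\<dots> = cnj (K q (\<Sum>i<m. cscale (K q e (U i q)) (W i q)) w)"
    using assms(3) w WU by (subst K_lincomb_left) simp_all
  also have "\<dots> = K q w (\<Sum>i<m. cscale (K q e (U i q)) (W i q))"
    using assms w WU by (intro K_herm E_sum) (auto intro: E_scale)
  finally show "K q w e = K q w (\<Sum>i<m. cscale (K q e (U i q)) (W i q))" .
qed

text \<open>Locally w is the combination of the U i with the coefficients K(w, W i), and these are
  smooth by \<open>smooth_K_half\<close>. So passing from H(M) back to the (1,0) bundle preserves
  smoothness.\<close>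

lemma smooth_undouble:
  assumes Y: "Y \<in> sections A H" and w: "\<And>p. w p \<in> E p" "\<And>p. Y p = dbl (w p)"
  shows "w \<in> \<Gamma>"
proof (rule \<Gamma>I[OF cvfields_local w(1)])
  fix p
  obtain V W U where d: "p \<in> V" "dual_frames V W U" using dual_frames_exist by blast
  let ?X = "\<Sum>i<m. cfscale (\<lambda>q. K q (w q) (W i q)) (U i)"
  have "?X \<in> cvfields A"
    using d(2) by (intro cvfields_sum cvfields_cfscale smooth_K_half[OF Y w] \<Gamma>_cvfields) (auto simp: dual_frames_def)
  moreover have "w q = ?X q" if "q \<in> V" for q
    using d(2) that w(1) by (simp add: sum_fun_apply2 dual_frames_def)
  ultimately show "\<exists>V X'. open V \<and> p \<in> V \<and> X' \<in> cvfields A \<and> (\<forall>q\<in>V. w q = X' q)"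
    using d unfolding dual_frames_def by blast
qed

end

section \<open>The Reeb field\<close>

context smooth_manifold
begin

lemma smooth_det:
  fixes M :: "'a \<Rightarrow> real ^ 'k ^ 'k"
  assumes "open W" "\<And>i j. smooth_fun_on A W (\<lambda>q. M q $ i $ j)"
  shows "smooth_fun_on A W (\<lambda>q. det (M q))"
  unfolding det_def
  by (intro smooth_fun_on_sum smooth_fun_on_mult smooth_fun_on_prod smooth_fun_on_const assms)

end

context ph_manifold
begin

section \<open>The form \<theta> and its exterior derivative as tensors\<close>

lemma th_add: "u \<in> tangent A p \<Longrightarrow> v \<in> tangent A p \<Longrightarrow> \<theta> p (u + v) = \<theta> p u + \<theta> p v"
  and th_scale: "u \<in> tangent A p \<Longrightarrow> \<theta> p (cscale (complex_of_real c) u) = c * \<theta> p u"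
  and th_smooth: "X \<in> vfields A \<Longrightarrow> smooth (\<lambda>p. \<theta> p (X p))"
  using th unfolding one_form_def by blast+

lemma th_zero [simp]: "\<theta> p 0 = 0"
  using th_scale[OF tangent_zero, of p 0] by simp

lemma th_uminus: "u \<in> tangent A p \<Longrightarrow> \<theta> p (- u) = - \<theta> p u"
  using th_scale[of u p "-1"] by (simp add: cscale_minus_left)

lemma th_diff: "u \<in> tangent A p \<Longrightarrow> v \<in> tangent A p \<Longrightarrow> \<theta> p (u - v) = \<theta> p u - \<theta> p v"
  using th_add[OF _ tangent_uminus, of u p v] by (simp add: th_uminus)

lemma th_fscale: "Y \<in> vfields A \<Longrightarrow> \<theta> p (fscale u Y p) = u p * \<theta> p (Y p)"
  by (simp add: fscale_def th_scale vfields_tangent)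

abbreviation d\<theta> :: "'a cfield \<Rightarrow> 'a cfield \<Rightarrow> 'a \<Rightarrow> real" where "d\<theta> \<equiv> ext_deriv \<theta>"

lemma d\<theta>_antisym:
  assumes "X \<in> vfields A" "Y \<in> vfields A"
  shows "d\<theta> X Y p = - d\<theta> Y X p"
  using th_uminus[OF vfields_tangent[OF lie_bracket_vfields[OF assms]], of p]
    lie_bracket_antisym[of Y X p]
  by (simp add: ext_deriv_def field_simps)

lemma d\<theta>_add_right:
  assumes X: "X \<in> vfields A" and Y: "Y \<in> vfields A" and Y': "Y' \<in> vfields A"
  shows "d\<theta> X (Y + Y') p = d\<theta> X Y p + d\<theta> X Y' p"
proof -
  have "X p (\<lambda>q. \<theta> q ((Y + Y') q)) = X p (\<lambda>q. \<theta> q (Y q)) + X p (\<lambda>q. \<theta> q (Y' q))"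
    using tangent_fun_add[OF vfields_tangent[OF X] th_smooth[OF Y] th_smooth[OF Y']]
    by (simp add: th_add vfields_tangent Y Y')
  moreover have "\<theta> p (lie_bracket X (Y + Y') p) = \<theta> p (lie_bracket X Y p) + \<theta> p (lie_bracket X Y' p)"
    using assms by (simp add: lie_bracket_add_right vfields_cvfields th_add vfields_tangent[OF lie_bracket_vfields])
  ultimately show ?thesis by (simp add: ext_deriv_def field_simps)
qed

lemma d\<theta>_scale_right:
  assumes X: "X \<in> vfields A" and Y: "Y \<in> vfields A" and u: "smooth u"
  shows "d\<theta> X (fscale u Y) p = u p * d\<theta> X Y p"
proof -
  have a: "X p u = of_real (Re (X p u))" using tangent_of_Re[OF vfields_tangent[OF X]] by metis
  have "X p (\<lambda>q. \<theta> q (fscale u Y q)) = X p (\<lambda>q. u q * \<theta> q (Y q))"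
    by (simp add: fscale_def th_scale vfields_tangent Y)
  also have "\<dots> = of_real (u p) * X p (\<lambda>q. \<theta> q (Y q)) + of_real (\<theta> p (Y p)) * X p u"
    using tangent_fun_mult[OF vfields_tangent[OF X] u th_smooth[OF Y]] by simp
  finally have 1: "Re (X p (\<lambda>q. \<theta> q (fscale u Y q))) = u p * Re (X p (\<lambda>q. \<theta> q (Y q))) + \<theta> p (Y p) * Re (X p u)"
    by simp
  have "lie_bracket X (fscale u Y) p = cscale (of_real (Re (X p u))) (Y p) + cscale (of_real (u p)) (lie_bracket X Y p)"
    using lie_bracket_cfscale_right[OF X[THEN vfields_cvfields] Y[THEN vfields_cvfields] smooth_fun_on_of_real[OF open_UNIV u], of p] a
      capply_of_real[OF cvfields_ctangent[OF X[THEN vfields_cvfields]], of p u]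
    by (simp add: fscale_cfscale)
  then have "\<theta> p (lie_bracket X (fscale u Y) p) = Re (X p u) * \<theta> p (Y p) + u p * \<theta> p (lie_bracket X Y p)"
    using X Y by (simp add: th_add th_scale tangent_scale vfields_tangent[OF Y] vfields_tangent[OF lie_bracket_vfields])
  with 1 show ?thesis by (simp add: ext_deriv_def fscale_def algebra_simps add_divide_distrib diff_divide_distrib)
qed

lemma d\<theta>_cong_left:
  assumes X: "X \<in> vfields A" and X': "X' \<in> vfields A" and Y: "Y \<in> vfields A" and eq: "X p = X' p"
  shows "d\<theta> X Y p = d\<theta> X' Y p"
proof -
  obtain V e x where fr: "p \<in> V" "coord_frame V e x" using coord_frame_exists by blast
  have "d\<theta> Y X p = (\<Sum>i\<in>UNIV. Re (X p (x i)) * d\<theta> Y (e i) p)" if "X \<in> vfields A" for X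
    by (rule tensorial_expand[OF _ _ fr(2,1) that, of "\<lambda>X. d\<theta> Y X p"])
      (simp_all add: d\<theta>_add_right d\<theta>_scale_right Y)
  then show ?thesis using d\<theta>_antisym[OF X Y] d\<theta>_antisym[OF X' Y] X X' eq by simp
qed

lemma d\<theta>_add_left:
  assumes "X \<in> vfields A" "X' \<in> vfields A" "Y \<in> vfields A"
  shows "d\<theta> (X + X') Y p = d\<theta> X Y p + d\<theta> X' Y p"
  using assms by (simp add: d\<theta>_antisym[of _ Y] vfields_add d\<theta>_add_right)

lemma d\<theta>_scale_left:
  assumes "X \<in> vfields A" "Y \<in> vfields A" "smooth u"
  shows "d\<theta> (fscale u X) Y p = u p * d\<theta> X Y p"
  using assms by (simp add: d\<theta>_antisym[of _ Y] vfields_fscale d\<theta>_scale_right)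

lemma d\<theta>_zero_left: "Y \<in> vfields A \<Longrightarrow> d\<theta> 0 Y p = 0"
  using d\<theta>_add_left[OF vfields_zero vfields_zero, of Y p] unfolding add_0_left by simp

lemma sections_H_vfields: "X \<in> sections A H \<Longrightarrow> X \<in> vfields A"
  using H_iff by (auto simp: sections_cvfields[of _ H] vfields_iff)

lemma Jb_section:
  assumes Y: "Y \<in> sections A H"
  shows "(\<lambda>p. Jb E p (Y p)) \<in> sections A H"
proof -
  have "\<forall>p. \<exists>w\<in>E p. Y p = dbl w"
    using H_dbl Y by (simp add: sections_cvfields[of _ H])
  then obtain w where w: "\<And>p. w p \<in> E p" "\<And>p. Y p = dbl (w p)" by metis
  have "(\<lambda>p. Jb E p (Y p)) = fdbl (cfscale (\<lambda>_. \<i>) w)"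
    using w by (auto simp: Jb_dbl)
  then show ?thesis
    using fdbl_H[OF \<Gamma>_cfscale[OF smooth_fun_on_const smooth_undouble[OF Y w]]] by simp
qed

lemma sections_H_iff: "X \<in> sections A H \<longleftrightarrow> X \<in> vfields A \<and> (\<forall>p. \<theta> p (X p) = 0)"
  using H_iff by (auto simp: sections_cvfields[of _ H] vfields_iff)

text \<open>Non-degeneracy is stated for global sections of H(M), whereas X lies in H(M) only at q.
  The field \<theta>(Y) X - \<theta>(X) Y lies in H(M) everywhere and is a nonzero multiple of X at
  q. Since \<open>J_b\<close> maps sections of H(M) to such sections, the assumption on d\<theta>
  makes the Levi form vanish.\<close>

lemma d\<theta>_nondegenerate:
  assumes X: "X \<in> vfields A" and X0: "\<theta> q (X q) = 0"
    and z: "\<And>Y. Y \<in> sections A H \<Longrightarrow> d\<theta> X Y q = 0"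
  shows "X q = 0"
proof -
  obtain v where v: "v \<in> tangent A q" "\<theta> q v \<noteq> 0" using th_nz by blast
  obtain Y where Y: "Y \<in> vfields A" "Y q = v" using vfield_extend[OF v(1)] by blast
  let ?X = "fscale (\<lambda>p. \<theta> p (Y p)) X + fscale (\<lambda>p. - \<theta> p (X p)) Y"
  have sm: "smooth (\<lambda>p. \<theta> p (Y p))" "smooth (\<lambda>p. - \<theta> p (X p))"
    by (intro smooth_fun_on_minus[OF open_UNIV] th_smooth X Y)+
  have X': "?X \<in> vfields A" by (intro vfields_add vfields_fscale sm X Y)
  have "\<theta> p (?X p) = 0" for p
    using th_add[OF tangent_scale tangent_scale, OF vfields_tangent[OF X] vfields_tangent[OF Y(1)]]
    by (simp add: fscale_def th_scale vfields_tangent X Y del: of_real_minus)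
  then have "?X \<in> sections A H" using X' by (simp add: sections_H_iff)
  moreover have "levi_form E \<theta> ?X Z q = 0" if Z: "Z \<in> sections A H" for Z
  proof -
    have JZ: "(\<lambda>p. Jb E p (Z p)) \<in> sections A H" by (rule Jb_section[OF Z])
    then have "(\<lambda>p. Jb E p (Z p)) \<in> vfields A" by (rule sections_H_vfields)
    then show ?thesis unfolding levi_form_def
      using z[OF JZ] X0 by (simp add: d\<theta>_add_left d\<theta>_scale_left vfields_fscale sm X Y)
  qed
  ultimately have "?X q = 0"
    using nondegenerate unfolding levi_nondegenerate_def by blast
  then have "cscale (of_real (\<theta> q v)) (X q) = 0"
    using X0 Y by (simp add: fscale_def)
  then have "cscale (inverse (of_real (\<theta> q v)) * of_real (\<theta> q v)) (X q) = 0"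
    unfolding cscale_cscale[symmetric] by (simp del: cscale_cscale)
  then show ?thesis using v(2) by simp
qed

text \<open>Both conditions on the Reeb field are merged into one linear system: with \<beta>(X, Y)
  = d\<theta>(X, Y) + \<theta>(X) \<theta>(Y) one solves \<beta>(R, .) = \<theta>. The form \<beta>
  is non-degenerate, so Cramer's rule gives a solution with smooth coefficients.\<close>

lemma reeb_local:
  "\<exists>V R. open V \<and> p \<in> V \<and> R \<in> vfields A \<and> (\<forall>q\<in>V. \<theta> q (R q) = 1 \<and> (\<forall>Y\<in>vfields A. d\<theta> R Y q = 0))"
proof -
  obtain V e x where pV: "p \<in> V" and fr: "coord_frame V e x" using coord_frame_exists by blast
  have V: "open V" and e: "\<And>i. e i \<in> vfields A" using fr by (auto simp: coord_frame_def)
  have ex: "e i q (x j) = of_bool (i = j)" if "q \<in> V" for i j q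
    using fr that by (simp add: coord_frame_def)
  \<comment> \<open>Row j, column i holds \<beta>(e_i, e_j), written with the antisymmetry of
    d\<theta>. So M applied to the components of X lists the values \<beta>(X, e_j).\<close>
  define M :: "'a \<Rightarrow> real ^ 'n ^ 'n" where
    "M q = (\<chi> j i. - d\<theta> (e j) (e i) q + \<theta> q (e i q) * \<theta> q (e j q))" for q
  define t :: "'a \<Rightarrow> real ^ 'n" where "t q = (\<chi> j. \<theta> q (e j q))" for q
  define C where "C a = (\<Sum>i\<in>UNIV. fscale (\<lambda>_. a $ i) (e i))" for a :: "real ^ 'n"
  have Cv: "C a \<in> vfields A" for a
    unfolding C_def by (intro vfields_sum vfields_fscale smooth_fun_on_const e)
  have C_x: "C a q (x j) = of_real (a $ j)" if "q \<in> V" for a q j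
    by (simp add: C_def sum_fun_apply2 fscale_def ex[OF that] of_bool_def if_distrib cong: if_cong)
  have G: "(M q *v a) $ j = d\<theta> X (e j) q + \<theta> q (X q) * \<theta> q (e j q)"
    if q: "q \<in> V" and X: "X \<in> vfields A" and Xa: "\<And>i. Re (X q (x i)) = a $ i" for q a X j
  proof -
    have "- d\<theta> (e j) X q + \<theta> q (X q) * \<theta> q (e j q) =
        (\<Sum>i\<in>UNIV. Re (X q (x i)) * (- d\<theta> (e j) (e i) q + \<theta> q (e i q) * \<theta> q (e j q)))"
      by (rule tensorial_expand[OF _ _ fr q X, of "\<lambda>X. - d\<theta> (e j) X q + \<theta> q (X q) * \<theta> q (e j q)"])
        (simp_all add: d\<theta>_add_right d\<theta>_scale_right e th_add th_fscale vfields_tangent algebra_simps)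
    moreover have "d\<theta> X (e j) q = - d\<theta> (e j) X q" by (rule d\<theta>_antisym[OF X e])
    ultimately show ?thesis
      by (simp add: matrix_vector_mult_def M_def Xa mult.commute)
  qed
  have exp: "d\<theta> X Y q + \<theta> q (X q) * \<theta> q (Y q) = (\<Sum>i\<in>UNIV. Re (Y q (x i)) * (d\<theta> X (e i) q + \<theta> q (X q) * \<theta> q (e i q)))"
    if q: "q \<in> V" and X: "X \<in> vfields A" and Y: "Y \<in> vfields A" for q X Y
    by (rule tensorial_expand[OF _ _ fr q Y, of "\<lambda>Y. d\<theta> X Y q + \<theta> q (X q) * \<theta> q (Y q)"])
      (simp_all add: d\<theta>_add_right d\<theta>_scale_right X th_add th_fscale vfields_tangent algebra_simps)
  \<comment> \<open>If \<beta>(C, .) = 0, then \<beta>(C, C) = \<theta>(C)^2 gives \<theta>(C) = 0;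
    hence d\<theta>(C, .) = 0, and C vanishes at q by non-degeneracy.\<close>
  have det: "det (M q) \<noteq> 0" if q: "q \<in> V" for q
  proof -
    have "a = 0" if a: "M q *v a = 0" for a
    proof -
      have z: "d\<theta> (C a) Y q + \<theta> q (C a q) * \<theta> q (Y q) = 0" if "Y \<in> vfields A" for Y
      proof -
        have "d\<theta> (C a) (e i) q + \<theta> q (C a q) * \<theta> q (e i q) = 0" for i
          using G[OF q Cv, of a a i] C_x[OF q] a by simp
        then show ?thesis using exp[OF q Cv that] by simp
      qed
      have "d\<theta> (C a) (C a) q = 0" using d\<theta>_antisym[OF Cv Cv, of a a q] by simp
      then have t0: "\<theta> q (C a q) = 0" using z[OF Cv[of a]] by simp
      have "C a q = 0"
        using z t0 by (intro d\<theta>_nondegenerate[OF Cv t0]) (simp add: sections_H_iff)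
      then show "a = 0" using C_x[OF q, of a] by (simp add: vec_eq_iff)
    qed
    then have "inj ((*v) (M q))" by (simp add: vec.inj_iff_eq_0)
    then show ?thesis
      using det_nz_iff_inj[OF matrix_vector_mul_linear, of "M q"] by (simp add: matrix_of_matrix_vector_mul)
  qed
  define a where "a q = (\<chi> k. det (\<chi> i j. if j = k then t q $ i else M q $ i $ j) / det (M q))" for q
  have Ma: "M q *v a q = t q" if "q \<in> V" for q
    using cramer[OF det[OF that], of "a q" "t q"] by (simp add: a_def)
  have sdt: "smooth (\<lambda>q. d\<theta> (e i) (e j) q)" for i j
    unfolding ext_deriv_def
    by (intro smooth_intros smooth_fun_on_linear[OF bounded_linear_divide open_UNIV] smooth_app
        vfields_cvfields e th_smooth lie_bracket_vfields)
  have sM: "smooth (\<lambda>q. M q $ i $ j)" and st: "smooth (\<lambda>q. t q $ i)" for i j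
    by (simp_all add: M_def t_def sdt smooth_intros th_smooth e)
  have sa: "smooth_fun_on A V (\<lambda>q. a q $ k)" for k
  proof -
    have "smooth_fun_on A V (\<lambda>q. det (\<chi> i j. if j = k then t q $ i else M q $ i $ j) * inverse (det (M q)))"
    proof (intro smooth_fun_on_mult[OF V] smooth_fun_on_inverse[OF V] det smooth_det[OF V])
      show "smooth_fun_on A V (\<lambda>q. (\<chi> i j. if j = k then t q $ i else M q $ i $ j) $ i $ j)" for i j
        using smooth_fun_on_subset[OF sM, of V i j] smooth_fun_on_subset[OF st, of V i] by (cases "j = k") simp_all
    qed (assumption, rule smooth_fun_on_subset[OF sM subset_UNIV])
    then show ?thesis by (simp add: a_def divide_inverse)
  qed
  obtain b :: "'a \<Rightarrow> real" and V' L where b: "smooth b" "open V'" "p \<in> V'" "V' \<subseteq> V"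
    "\<And>q. q \<in> V' \<Longrightarrow> b q = 1" "closed L" "L \<subseteq> V" "\<And>q. q \<notin> L \<Longrightarrow> b q = 0"
    using bump[OF V pV] by metis
  define R where "R = (\<Sum>i\<in>UNIV. fscale (\<lambda>q. b q *\<^sub>R (a q $ i)) (e i))"
  have R: "R \<in> vfields A"
    unfolding R_def by (intro vfields_sum vfields_fscale e smooth_bump_mult[OF b(1,6,7) V b(8)] sa)
  have "\<theta> q (R q) = 1 \<and> (\<forall>Y\<in>vfields A. d\<theta> R Y q = 0)" if q: "q \<in> V'" for q
  proof -
    have qV: "q \<in> V" using q b(4) by blast
    have Rx: "Re (R q (x j)) = a q $ j" for j
      by (simp add: R_def sum_fun_apply2 fscale_def ex[OF qV] b(5)[OF q] of_bool_def if_distrib cong: if_cong)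
    have main: "d\<theta> R Y q + \<theta> q (R q) * \<theta> q (Y q) = \<theta> q (Y q)" if Y: "Y \<in> vfields A" for Y
    proof -
      have "d\<theta> R (e i) q + \<theta> q (R q) * \<theta> q (e i q) = \<theta> q (e i q)" for i
        using G[OF qV R Rx, of i] Ma[OF qV] by (simp add: t_def)
      then have "d\<theta> R Y q + \<theta> q (R q) * \<theta> q (Y q) = (\<Sum>i\<in>UNIV. Re (Y q (x i)) * \<theta> q (e i q))"
        using exp[OF qV R Y] by simp
      also have "\<dots> = \<theta> q (Y q)"
        by (rule tensorial_expand[OF _ _ fr qV Y, of "\<lambda>Y. \<theta> q (Y q)", symmetric])
          (simp_all add: th_add th_fscale vfields_tangent)
      finally show ?thesis .
    qed
    \<comment> \<open>Evaluating \<beta>(R, .) = \<theta> on R shows that \<theta>(R) is 0 or 1. The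
      value 0 would make d\<theta>(R, .) vanish on H(M), hence R = 0 and then \<theta> = 0 at
      q.\<close>
    have "d\<theta> R R q = 0" using d\<theta>_antisym[OF R R, of q] by simp
    then have "\<theta> q (R q) * \<theta> q (R q) = \<theta> q (R q)" using main[OF R] by simp
    moreover have "\<theta> q (R q) \<noteq> 0"
    proof
      assume t0: "\<theta> q (R q) = 0"
      have "R q = 0"
        using main t0 by (intro d\<theta>_nondegenerate[OF R t0]) (simp add: sections_H_iff)
      then have "d\<theta> R Y q = 0" if "Y \<in> vfields A" for Y
        using d\<theta>_cong_left[OF R vfields_zero that, of q] d\<theta>_zero_left[OF that] by simp
      then have "\<theta> q (Y q) = 0" if "Y \<in> vfields A" for Y
        using main[OF that] t0 that by simp
      then show False using th_nz[of q] vfield_extend by metis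
    qed
    ultimately have "\<theta> q (R q) = 1" by simp
    then show ?thesis using main by simp
  qed
  then show ?thesis using b R by blast
qed

lemma reeb_unique:
  assumes R: "R \<in> vfields A" "R' \<in> vfields A" "\<theta> q (R q) = 1" "\<theta> q (R' q) = 1"
    and z: "\<And>Y. Y \<in> vfields A \<Longrightarrow> d\<theta> R Y q = 0" "\<And>Y. Y \<in> vfields A \<Longrightarrow> d\<theta> R' Y q = 0"
  shows "R q = R' q"
proof -
  let ?D = "R + fscale (\<lambda>_. - 1) R'"
  have D: "?D \<in> vfields A" by (intro vfields_add vfields_fscale smooth_fun_on_const R)
  have eq: "?D q = R q - R' q" by (simp add: fscale_def fun_eq_iff)
  have "?D q = 0"
  proof (rule d\<theta>_nondegenerate[OF D])
    show "\<theta> q (?D q) = 0" unfolding eq using R by (simp add: th_diff vfields_tangent)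
    show "d\<theta> ?D Y q = 0" if "Y \<in> sections A H" for Y
      using z sections_H_vfields[OF that] R
      by (simp add: d\<theta>_add_left d\<theta>_scale_left vfields_fscale smooth_fun_on_const)
  qed
  then show ?thesis using eq by simp
qed

abbreviation \<xi> :: "'a cfield" where "\<xi> \<equiv> reeb A \<theta>"

text \<open>Local Reeb fields agree at common points by \<open>reeb_unique\<close>, so p \<mapsto> R
  p p coincides near each point with a single smooth field. The definite description in
  \<open>reeb\<close> then denotes this field.\<close>

lemma reeb_props: "\<xi> \<in> vfields A \<and> (\<forall>p. \<theta> p (\<xi> p) = 1) \<and> (\<forall>X\<in>vfields A. \<forall>p. d\<theta> \<xi> X p = 0)"
proof -
  let ?P = "\<lambda>\<xi>. \<xi> \<in> vfields A \<and> (\<forall>p. \<theta> p (\<xi> p) = 1) \<and> (\<forall>X\<in>vfields A. \<forall>p. d\<theta> \<xi> X p = 0)"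
  have "\<forall>p. \<exists>V R. open V \<and> p \<in> V \<and> R \<in> vfields A \<and>
      (\<forall>q\<in>V. \<theta> q (R q) = 1 \<and> (\<forall>Y\<in>vfields A. d\<theta> R Y q = 0))"
    using reeb_local by blast
  then obtain V R where VR: "\<forall>p. open (V p) \<and> p \<in> V p \<and> R p \<in> vfields A \<and>
      (\<forall>q\<in>V p. \<theta> q (R p q) = 1 \<and> (\<forall>Y\<in>vfields A. d\<theta> (R p) Y q = 0))"
    unfolding choice_iff by (elim exE) (rule that)
  have V: "open (V p)" "p \<in> V p" and R: "R p \<in> vfields A"
    and t: "q \<in> V p \<Longrightarrow> \<theta> q (R p q) = 1" and d: "q \<in> V p \<Longrightarrow> Y \<in> vfields A \<Longrightarrow> d\<theta> (R p) Y q = 0" for p q Y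
    using VR by auto
  let ?R = "\<lambda>p. R p p"
  have eq: "?R q = R p q" if "q \<in> V p" for p q
    by (rule reeb_unique[OF R R]) (use that V t d in auto)
  have "?R \<in> cvfields A"
  proof (rule cvfields_local)
    fix p
    show "\<exists>W X'. open W \<and> p \<in> W \<and> X' \<in> cvfields A \<and> (\<forall>q\<in>W. ?R q = X' q)"
      using V eq vfields_cvfields[OF R] by (intro exI[of _ "V p"] exI[of _ "R p"] conjI ballI) auto
  qed
  then have Rv: "?R \<in> vfields A"
    using vfields_tangent[OF R] by (simp add: vfields_iff)
  have PR: "?P ?R"
    using Rv t V d d\<theta>_cong_left[OF Rv R] by simp
  show ?thesis unfolding reeb_def
  proof (rule theI[of ?P, OF PR])
    fix S assume "?P S"
    then have "S p = ?R p" for p using PR by (intro reeb_unique) blast+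
    then show "S = ?R" by blast
  qed
qed

lemma reeb_vfield: "\<xi> \<in> vfields A" and th_reeb [simp]: "\<theta> p (\<xi> p) = 1"
  using reeb_props by auto

end

section \<open>The splitting of the complexified tangent bundle\<close>

context ph_manifold
begin

text \<open>Complex linear extension of \<theta>; it reads off the Reeb coefficient in the
  splitting.\<close>

definition tc :: "'a \<Rightarrow> 'a cvec \<Rightarrow> complex" where
  "tc p v = of_real (\<theta> p (re_vec v)) + \<i> * of_real (\<theta> p (im_vec v))"

lemma tc_add: "u \<in> ctangent A p \<Longrightarrow> v \<in> ctangent A p \<Longrightarrow> tc p (u + v) = tc p u + tc p v"
proof -
  assume uv: "u \<in> ctangent A p" "v \<in> ctangent A p"
  have "re_vec (u + v) = re_vec u + re_vec v" "im_vec (u + v) = im_vec u + im_vec v"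
    by (simp_all add: re_vec_def im_vec_def fun_eq_iff)
  then show ?thesis using uv by (simp add: tc_def th_add re_vec_tangent im_vec_tangent algebra_simps)
qed

lemma tc_scale: "v \<in> ctangent A p \<Longrightarrow> tc p (cscale c v) = c * tc p v"
proof -
  assume v: "v \<in> ctangent A p"
  have "re_vec (cscale c v) = cscale (of_real (Re c)) (re_vec v) + cscale (of_real (- Im c)) (im_vec v)"
    "im_vec (cscale c v) = cscale (of_real (Im c)) (re_vec v) + cscale (of_real (Re c)) (im_vec v)"
    by (simp_all add: re_vec_def im_vec_def fun_eq_iff complex_eq_iff)
  then have "tc p (cscale c v) = of_real (Re c * \<theta> p (re_vec v) - Im c * \<theta> p (im_vec v)) +
      \<i> * of_real (Im c * \<theta> p (re_vec v) + Re c * \<theta> p (im_vec v))"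
    using v by (simp add: tc_def th_add th_scale tangent_scale re_vec_tangent im_vec_tangent del: of_real_minus)
  also have "\<dots> = c * tc p v" by (simp add: tc_def complex_eq_iff)
  finally show ?thesis .
qed

lemma tc_zero [simp]: "tc p 0 = 0"
  using tc_scale[OF ctangent_zero, of p 0] by simp

lemma tc_tangent: "v \<in> tangent A p \<Longrightarrow> tc p v = of_real (\<theta> p v)"
proof -
  assume v: "v \<in> tangent A p"
  have "re_vec v = v" "im_vec v = 0"
    using tangent_real[OF v] by (simp_all add: re_vec_def im_vec_def fun_eq_iff complex_eq_iff)
  then show ?thesis by (simp add: tc_def)
qed

lemma tc_reeb [simp]: "tc p (\<xi> p) = 1"
  using tc_tangent[OF vfields_tangent[OF reeb_vfield]] by simp

lemma tc_conj: "v \<in> ctangent A p \<Longrightarrow> tc p (cconj v) = cnj (tc p v)"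
proof -
  assume v: "v \<in> ctangent A p"
  have "re_vec (cconj v) = re_vec v" "im_vec (cconj v) = - im_vec v"
    by (simp_all add: re_vec_def im_vec_def fun_eq_iff)
  then show ?thesis using v by (simp add: tc_def th_uminus im_vec_tangent)
qed

lemma tc_E [simp]: "v \<in> E p \<Longrightarrow> tc p v = 0"
proof -
  assume v: "v \<in> E p"
  have z: "\<theta> p (re_vec v) = 0" if "v \<in> E p" for v
  proof -
    have "dbl v = cscale (of_real 2) (re_vec v)" by (simp add: dbl_def re_vec_def fun_eq_iff complex_eq_iff)
    then have "2 * \<theta> p (re_vec v) = 0"
      using dbl_H[OF that] th_scale[OF re_vec_tangent[OF E_ctangent[OF that]], of 2] by (simp add: H_iff)
    then show ?thesis by simp
  qed
  have "re_vec (cscale \<i> v) = - im_vec v" by (simp add: re_vec_def im_vec_def fun_eq_iff)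
  then have "\<theta> p (im_vec v) = 0"
    using z[OF E_scale[OF v, of \<i>]] v by (simp add: th_uminus im_vec_tangent E_ctangent)
  then show ?thesis using z[OF v] by (simp add: tc_def)
qed

lemma reeb_ctangent: "\<xi> p \<in> ctangent A p"
  by (rule tangent_ctangent[OF vfields_tangent[OF reeb_vfield]])

lemma reeb_conj [simp]: "cconj (\<xi> p) = \<xi> p"
  using vfields_fconj[OF reeb_vfield] by (metis fconj_apply)

text \<open>\<open>tc\<close> isolates the Reeb coefficient; what remains is a vector lying in both
  E and its conjugate.\<close>

lemma splitting_unique:
  assumes "a \<in> E p" "b \<in> E p" "a + cconj b + cscale c (\<xi> p) = 0"
  shows "a = 0 \<and> b = 0 \<and> c = 0"
proof -
  note ct = E_ctangent[OF assms(1)] E_ctangent[OF assms(2)]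
  have "tc p (a + cconj b + cscale c (\<xi> p)) = c"
    using assms(1,2) ct reeb_ctangent
    by (simp add: tc_add tc_scale tc_conj ctangent_add ctangent_conj ctangent_scale)
  then have c: "c = 0" using assms(3) by simp
  then have "cconj b = - a" using assms(3) by (simp add: eq_neg_iff_add_eq_0 add.commute)
  then have "b = 0" using assms E_uminus by (intro E_bar_zero) auto
  then show ?thesis using c assms(3) by simp
qed

lemma splitting_exists:
  assumes v: "v \<in> ctangent A p"
  shows "\<exists>a\<in>E p. \<exists>b\<in>E p. v = a + cconj b + cscale (tc p v) (\<xi> p)"
proof -
  have real: "\<exists>w\<in>E p. x = w + cconj w + cscale (tc p x) (\<xi> p)" if x: "x \<in> tangent A p" for x
  proof -
    have xt: "\<xi> p \<in> tangent A p" by (rule vfields_tangent[OF reeb_vfield])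
    have "x - cscale (of_real (\<theta> p x)) (\<xi> p) \<in> H p"
      using x xt by (simp add: H_iff tangent_diff tangent_scale th_diff th_scale)
    then obtain w where w: "w \<in> E p" "x - cscale (of_real (\<theta> p x)) (\<xi> p) = w + cconj w"
      using H_dbl unfolding dbl_def by blast
    then have "x = w + cconj w + cscale (tc p x) (\<xi> p)"
      by (simp add: tc_tangent[OF x] algebra_simps)
    with w(1) show ?thesis by blast
  qed
  obtain x y where xy: "x \<in> tangent A p" "y \<in> tangent A p" "v = x + cscale \<i> y"
    using v by (elim ctangentE)
  obtain w where w: "w \<in> E p" "x = w + cconj w + cscale (tc p x) (\<xi> p)" using real xy by blast
  obtain z where z: "z \<in> E p" "y = z + cconj z + cscale (tc p y) (\<xi> p)" using real xy by blast
  have t: "tc p v = tc p x + \<i> * tc p y"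
    using xy by (simp add: tc_add tc_scale tangent_ctangent ctangent_scale)
  have "v f = ((w + cscale \<i> z) + cconj (w - cscale \<i> z) + cscale (tc p v) (\<xi> p)) f" for f
    using fun_cong[OF w(2), of f] fun_cong[OF z(2), of f] by (simp add: xy(3)[THEN fun_cong] t algebra_simps)
  then have "v = (w + cscale \<i> z) + cconj (w - cscale \<i> z) + cscale (tc p v) (\<xi> p)" by blast
  then show ?thesis using w z E_add E_diff E_scale by blast
qed

abbreviation P :: "'a \<Rightarrow> 'a cvec \<Rightarrow> 'a cvec" where "P \<equiv> pi_plus A E \<theta>"
abbreviation N :: "'a \<Rightarrow> 'a cvec \<Rightarrow> 'a cvec" where "N \<equiv> pi_minus A E \<theta>"

lemma splitting_eq:
  assumes "a \<in> E p" "b \<in> E p" "a' \<in> E p" "b' \<in> E p"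
    "a + cconj b + cscale c (\<xi> p) = a' + cconj b' + cscale c' (\<xi> p)"
  shows "a = a' \<and> b = b' \<and> c = c'"
proof -
  have "(a - a') + cconj (b - b') + cscale (c - c') (\<xi> p) =
      (a + cconj b + cscale c (\<xi> p)) - (a' + cconj b' + cscale c' (\<xi> p))"
    by (simp add: fun_eq_iff algebra_simps)
  also have "\<dots> = 0" using assms(5) by simp
  finally show ?thesis
    using splitting_unique[OF E_diff[OF assms(1,3)] E_diff[OF assms(2,4)], of "c - c'"] by simp
qed

lemma P_split:
  assumes "a \<in> E p" "b \<in> E p"
  shows "P p (a + cconj b + cscale c (\<xi> p)) = a"
  unfolding pi_plus_def
proof (rule the_equality)
  show "a \<in> E p \<and> (\<exists>b'\<in>bar E p. \<exists>c'. a + cconj b + cscale c (\<xi> p) = a + b' + cscale c' (\<xi> p))"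
    using assms by (auto simp: bar_def)
  fix a' assume "a' \<in> E p \<and> (\<exists>b'\<in>bar E p. \<exists>c'. a + cconj b + cscale c (\<xi> p) = a' + b' + cscale c' (\<xi> p))"
  then obtain b' c' where "a' \<in> E p" "b' \<in> E p" "a + cconj b + cscale c (\<xi> p) = a' + cconj b' + cscale c' (\<xi> p)"
    by (auto simp: bar_def)
  then show "a' = a" using splitting_eq assms by blast
qed

lemma N_split:
  assumes "a \<in> E p" "b \<in> E p"
  shows "N p (a + cconj b + cscale c (\<xi> p)) = cconj b"
  unfolding pi_minus_def
proof (rule the_equality)
  show "cconj b \<in> bar E p \<and> (\<exists>a'\<in>E p. \<exists>c'. a + cconj b + cscale c (\<xi> p) = a' + cconj b + cscale c' (\<xi> p))"
    using assms by (auto simp: bar_def)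
  fix b' assume "b' \<in> bar E p \<and> (\<exists>a'\<in>E p. \<exists>c'. a + cconj b + cscale c (\<xi> p) = a' + b' + cscale c' (\<xi> p))"
  then obtain a' b'' c' where "a' \<in> E p" "b'' \<in> E p" "b' = cconj b''"
    "a + cconj b + cscale c (\<xi> p) = a' + cconj b'' + cscale c' (\<xi> p)"
    by (auto simp: bar_def)
  then show "b' = cconj b" using splitting_eq assms by blast
qed

lemma P_E: "v \<in> ctangent A p \<Longrightarrow> P p v \<in> E p"
  using splitting_exists P_split by metis

text \<open>Replaces the (0,1) projection by \<open>P\<close> and conjugation, so that linearity and
  smoothness are proved for \<open>P\<close> only.\<close>

lemma N_conj: "v \<in> ctangent A p \<Longrightarrow> N p v = cconj (P p (cconj v))"
proof -
  assume "v \<in> ctangent A p"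
  then obtain a b where ab: "a \<in> E p" "b \<in> E p" "v = a + cconj b + cscale (tc p v) (\<xi> p)"
    using splitting_exists by blast
  have "cconj v = b + cconj a + cscale (cnj (tc p v)) (\<xi> p)"
    by (subst ab(3)) (simp add: cconj_add cconj_cscale add.commute)
  then have "P p (cconj v) = b" using P_split ab by simp
  moreover have "N p v = cconj b" using N_split[OF ab(1,2)] ab(3) by metis
  ultimately show ?thesis by simp
qed

lemma splitting: "v \<in> ctangent A p \<Longrightarrow> v = P p v + N p v + cscale (tc p v) (\<xi> p)"
  using splitting_exists P_split N_split by metis

lemma splitting_conj:
  "v \<in> ctangent A p \<Longrightarrow> v = P p v + cconj (P p (cconj v)) + cscale (tc p v) (\<xi> p)"
  using splitting N_conj by metis

lemma P_add: "u \<in> ctangent A p \<Longrightarrow> v \<in> ctangent A p \<Longrightarrow> P p (u + v) = P p u + P p v"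
proof -
  assume u: "u \<in> ctangent A p" and v: "v \<in> ctangent A p"
  have "u + v = (P p u + cconj (P p (cconj u)) + cscale (tc p u) (\<xi> p)) +
      (P p v + cconj (P p (cconj v)) + cscale (tc p v) (\<xi> p))"
    using splitting_conj[OF u] splitting_conj[OF v] by simp
  also have "\<dots> = (P p u + P p v) + cconj (P p (cconj u) + P p (cconj v)) + cscale (tc p u + tc p v) (\<xi> p)"
    by (simp add: cconj_add cscale_add_left algebra_simps)
  finally show ?thesis
    using P_split E_add P_E u v ctangent_conj by presburger
qed

lemma P_scale: "v \<in> ctangent A p \<Longrightarrow> P p (cscale c v) = cscale c (P p v)"
proof -
  assume v: "v \<in> ctangent A p"
  have "cscale c v = cscale c (P p v + cconj (P p (cconj v)) + cscale (tc p v) (\<xi> p))"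
    using splitting_conj[OF v] by simp
  also have "\<dots> = cscale c (P p v) + cconj (cscale (cnj c) (P p (cconj v))) + cscale (c * tc p v) (\<xi> p)"
    by (simp add: cconj_cscale cscale_add)
  finally show ?thesis
    using P_split E_scale P_E v ctangent_conj by presburger
qed

lemma P_id [simp]: "v \<in> E p \<Longrightarrow> P p v = v"
  using P_split[of v p 0 0] by (simp add: E_zero)

lemma P_conj_E [simp]: "v \<in> E p \<Longrightarrow> P p (cconj v) = 0"
  using P_split[of 0 p v 0] by (simp add: E_zero)

lemma P_reeb [simp]: "P p (\<xi> p) = 0"
  using P_split[of 0 p 0 1] by (simp add: E_zero)

lemma P_zero [simp]: "P p 0 = 0"
  by (simp add: E_zero)

lemma P_uminus: "v \<in> ctangent A p \<Longrightarrow> P p (- v) = - P p v"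
  using P_scale[of v p "-1"] by (simp add: cscale_minus_left)

lemma P_diff: "u \<in> ctangent A p \<Longrightarrow> v \<in> ctangent A p \<Longrightarrow> P p (u - v) = P p u - P p v"
  using P_add[OF _ ctangent_uminus, of u p v] by (simp add: P_uminus)

lemma tangent_conj: "v \<in> tangent A p \<Longrightarrow> cconj v = v"
  using tangent_real by (simp add: fun_eq_iff complex_eq_iff)

lemma tangent_splitting:
  "v \<in> tangent A p \<Longrightarrow> v = dbl (P p v) + cscale (of_real (\<theta> p v)) (\<xi> p)"
  using splitting_conj[OF tangent_ctangent] by (metis dbl_def tangent_conj tc_tangent)

lemma pi_H_eq: "v \<in> tangent A p \<Longrightarrow> pi_H A E \<theta> p v = dbl (P p v)"
proof -
  assume v: "v \<in> tangent A p"
  note vP = P_E[OF tangent_ctangent[OF v]]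
  show ?thesis unfolding pi_H_def
  proof (rule the_equality)
    show "dbl (P p v) \<in> H p \<and> (\<exists>c. v = dbl (P p v) + cscale (of_real c) (\<xi> p))"
      using tangent_splitting[OF v] dbl_H[OF vP] by blast
    fix u assume "u \<in> H p \<and> (\<exists>c. v = u + cscale (of_real c) (\<xi> p))"
    then obtain w c where w: "w \<in> E p" "u = dbl w" "v = w + cconj w + cscale (of_real c) (\<xi> p)"
      using H_dbl unfolding dbl_def by blast
    then have "P p v = w" using P_split by simp
    then show "u = dbl (P p v)" using w by simp
  qed
qed

lemma h_tensor_eq:
  "u \<in> tangent A p \<Longrightarrow> v \<in> tangent A p \<Longrightarrow> h_tensor A E \<theta> h p u v = Re (K p (P p u) (P p v))"
  by (simp add: h_tensor_def pi_H_eq K_def)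

lemma J_endo_eq: "v \<in> tangent A p \<Longrightarrow> J_endo A E \<theta> p v = dbl (cscale \<i> (P p v))"
  by (simp add: J_endo_def pi_H_eq Jb_dbl P_E tangent_ctangent)

lemma P_dbl: "v \<in> E p \<Longrightarrow> P p (dbl v) = v"
  using P_split[of v p v 0] by (simp add: dbl_def)

definition fP :: "'a cfield \<Rightarrow> 'a cfield" where "fP X = (\<lambda>p. P p (X p))"

lemma fP_apply [simp]: "fP X p = P p (X p)"
  by (simp add: fP_def)

lemma smooth_tc: "X \<in> cvfields A \<Longrightarrow> smooth (\<lambda>p. tc p (X p))"
proof -
  assume X: "X \<in> cvfields A"
  show ?thesis
    unfolding tc_def
    using th_smooth[OF re_field_vfields[OF X]] th_smooth[OF im_field_vfields[OF X]]
    by (intro smooth_intros) (simp_all add: re_field_vec im_field_vec)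
qed

text \<open>For a real field Y the difference Y - \<theta>(Y) \<xi> is a smooth section of H(M)
  whose (1,0) half is the projection of Y, so \<open>smooth_undouble\<close> applies. Complex fields
  follow by real and imaginary parts.\<close>

lemma fP_\<Gamma>:
  assumes X: "X \<in> cvfields A"
  shows "fP X \<in> \<Gamma>"
proof -
  have real: "fP Y \<in> \<Gamma>" if Y: "Y \<in> vfields A" for Y
  proof (rule smooth_undouble)
    let ?Y = "Y - fscale (\<lambda>p. \<theta> p (Y p)) \<xi>"
    have "?Y \<in> vfields A" by (intro vfields_diff vfields_fscale th_smooth Y reeb_vfield)
    moreover have "\<theta> p (?Y p) = 0" for p
      using Y reeb_vfield
      by (simp add: th_diff th_fscale vfields_tangent vfields_tangent[OF vfields_fscale] th_smooth)
    ultimately show "?Y \<in> sections A H" by (simp add: sections_H_iff)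
    show "fP Y p \<in> E p" for p using Y by (simp add: P_E tangent_ctangent vfields_tangent)
    show "?Y p = dbl (fP Y p)" for p
      using tangent_splitting[OF vfields_tangent[OF Y], of p] by (simp add: fscale_def algebra_simps)
  qed
  have "fP X = fP (re_field X) + cfscale (\<lambda>_. \<i>) (fP (im_field X))"
  proof
    fix p
    have t: "re_vec (X p) \<in> ctangent A p" "im_vec (X p) \<in> ctangent A p"
      using cvfields_ctangent[OF X] by (simp_all add: tangent_ctangent re_vec_tangent im_vec_tangent)
    have "P p (X p) = P p (re_vec (X p) + cscale \<i> (im_vec (X p)))" by (simp add: re_im_vec)
    also have "\<dots> = P p (re_vec (X p)) + cscale \<i> (P p (im_vec (X p)))"
      using t by (simp add: P_add P_scale ctangent_scale)
    finally show "fP X p = (fP (re_field X) + cfscale (\<lambda>_. \<i>) (fP (im_field X))) p"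
      by (simp add: re_field_vec im_field_vec)
  qed
  then show ?thesis
    using X by (simp add: \<Gamma>_add \<Gamma>_cfscale smooth_fun_on_const real re_field_vfields im_field_vfields)
qed

subsection \<open>Riesz representation of sections\<close>

lemma \<Gamma>_extend:
  assumes "e \<in> E p"
  shows "\<exists>V\<in>\<Gamma>. V p = e"
proof -
  obtain V W U where d: "p \<in> V" "dual_frames V W U" using dual_frames_exist by blast
  let ?X = "\<Sum>i<m. cfscale (\<lambda>_. K p e (W i p)) (U i)"
  have "?X \<in> \<Gamma>"
    using d by (intro \<Gamma>_sum \<Gamma>_cfscale smooth_fun_on_const) (auto simp: dual_frames_def)
  moreover have "?X p = e"
    using d assms by (simp add: dual_frames_def sum_fun_apply2)
  ultimately show ?thesis by blast
qed

text \<open>Near a point the representing section is the sum of F(W i) U i over dual frames. Since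
  every (1,0) vector extends to a section, representing vectors are unique at each point, and the
  local solutions glue.\<close>

lemma riesz:
  fixes F :: "'a cfield \<Rightarrow> 'a \<Rightarrow> complex"
  assumes sm: "\<And>V. V \<in> \<Gamma> \<Longrightarrow> smooth (F V)"
    and add: "\<And>V V' p. V \<in> \<Gamma> \<Longrightarrow> V' \<in> \<Gamma> \<Longrightarrow> F (V + V') p = F V p + F V' p"
    and scale: "\<And>u V p. smooth u \<Longrightarrow> V \<in> \<Gamma> \<Longrightarrow> F (cfscale u V) p = cnj (u p) * F V p"
  shows "\<exists>X\<in>\<Gamma>. \<forall>V\<in>\<Gamma>. \<forall>p. K p (X p) (V p) = F V p"
proof -
  have F_sum: "F (\<Sum>i\<in>I. V i) p = (\<Sum>i\<in>I. F (V i) p)" if "finite I" "\<And>i. i \<in> I \<Longrightarrow> V i \<in> \<Gamma>"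
    for I :: "nat set" and V p
    using that
  proof induction
    case empty
    have "F 0 p = 0" using add[OF \<Gamma>_zero \<Gamma>_zero, of p] unfolding add_0_left by simp
    then show ?case by (simp only: sum.empty)
  qed (simp add: add \<Gamma>_sum)
  have local: "\<exists>V X. open V \<and> p \<in> V \<and> X \<in> \<Gamma> \<and> (\<forall>q\<in>V. \<forall>Z\<in>\<Gamma>. K q (X q) (Z q) = F Z q)" for p
  proof -
    obtain V W U where pV: "p \<in> V" and d: "dual_frames V W U" using dual_frames_exist by blast
    have V: "open V" and W: "\<And>i. i < m \<Longrightarrow> W i \<in> \<Gamma>" and U: "\<And>i. i < m \<Longrightarrow> U i \<in> \<Gamma>"
      using d by (auto simp: dual_frames_def)
    define X where "X = (\<Sum>i<m. cfscale (F (W i)) (U i))"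
    have X: "X \<in> \<Gamma>" unfolding X_def by (intro \<Gamma>_sum \<Gamma>_cfscale sm) (simp_all add: W U)
    have "K q (X q) (Z q) = F Z q" if q: "q \<in> V" and Z: "Z \<in> \<Gamma>" for q Z
    proof -
      obtain b :: "'a \<Rightarrow> real" and V' C where b: "smooth b" "q \<in> V'"
        "\<And>q. q \<in> V' \<Longrightarrow> b q = 1" "C \<subseteq> V" "\<And>q. q \<notin> C \<Longrightarrow> b q = 0"
        using bump[OF V q] by metis
      have sb: "smooth (\<lambda>q. complex_of_real (b q))" by (intro smooth_intros b(1))
      \<comment> \<open>The expansion of b Z in the frame W, with the coefficients K(Z, U i).
        Conjugate linearity of F turns these into K(U i, Z), the factors that also occur in K(X,
        Z).\<close>
      let ?Z = "\<Sum>i<m. cfscale (\<lambda>r. of_real (b r) * K r (Z r) (U i r)) (W i)"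
      have s: "smooth (\<lambda>r. of_real (b r) * K r (Z r) (U i r))" if "i < m" for i
        by (intro smooth_fun_on_mult[OF open_UNIV] sb smooth_K Z U that)
      have "cfscale (\<lambda>r. of_real (b r)) Z r = ?Z r" for r
      proof (cases "r \<in> V")
        case True
        have "cscale (of_real (b r)) (Z r) = cscale (of_real (b r)) (\<Sum>i<m. cscale (K r (Z r) (U i r)) (W i r))"
          using dual_frames_adjoint[OF d True \<Gamma>_E[OF Z]] by simp
        then show ?thesis by (simp add: sum_fun_apply2 cvec.scale_sum_right)
      next
        case False
        then have "b r = 0" using b by blast
        then show ?thesis by (simp add: sum_fun_apply2)
      qed
      then have "F (cfscale (\<lambda>r. of_real (b r)) Z) q = F ?Z q" by (metis ext)
      also have "\<dots> = (\<Sum>i<m. F (cfscale (\<lambda>r. of_real (b r) * K r (Z r) (U i r)) (W i)) q)"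
        by (rule F_sum) (auto intro: \<Gamma>_cfscale s W)
      also have "\<dots> = (\<Sum>i<m. K q (U i q) (Z q) * F (W i) q)"
        using b(3)[OF b(2)] by (intro sum.cong refl) (simp add: scale s W K_herm \<Gamma>_E U Z)
      finally have "F Z q = (\<Sum>i<m. K q (U i q) (Z q) * F (W i) q)"
        using b(3)[OF b(2)] by (simp add: scale[OF sb Z])
      moreover have "K q (X q) (Z q) = (\<Sum>i<m. F (W i) q * K q (U i q) (Z q))"
      proof -
        have "X q = (\<Sum>i<m. cscale (F (W i) q) (U i q))" by (simp add: X_def sum_fun_apply2)
        then show ?thesis by (simp only:) (rule K_lincomb_left, simp_all add: \<Gamma>_E U Z)
      qed
      ultimately show ?thesis by (simp add: mult.commute)
    qed
    then show ?thesis using V pV X by blast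
  qed
  have uniq: "u = v" if "u \<in> E p" "v \<in> E p" "\<And>Z. Z \<in> \<Gamma> \<Longrightarrow> K p u (Z p) = K p v (Z p)" for u v p
  proof (rule K_eqI[OF that(1,2)])
    fix w assume w: "w \<in> E p"
    obtain Z where "Z \<in> \<Gamma>" "Z p = w" using \<Gamma>_extend[OF w] by blast
    then have "K p u w = K p v w" using that(3) by blast
    then show "K p w u = K p w v" using K_herm that(1,2) w by metis
  qed
  have "\<forall>p. \<exists>V X. open V \<and> p \<in> V \<and> X \<in> \<Gamma> \<and> (\<forall>q\<in>V. \<forall>Z\<in>\<Gamma>. K q (X q) (Z q) = F Z q)"
    using local by blast
  then obtain V X where VX: "\<forall>p. open (V p) \<and> p \<in> V p \<and> X p \<in> \<Gamma> \<and> (\<forall>q\<in>V p. \<forall>Z\<in>\<Gamma>. K q (X p q) (Z q) = F Z q)"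
    unfolding choice_iff by (elim exE) (rule that)
  then have V: "open (V p)" "p \<in> V p" and X: "X p \<in> \<Gamma>"
    and KX: "q \<in> V p \<Longrightarrow> Z \<in> \<Gamma> \<Longrightarrow> K q (X p q) (Z q) = F Z q" for p q Z
    by auto
  let ?X = "\<lambda>p. X p p"
  have eq: "?X q = X p q" if "q \<in> V p" for p q
    by (rule uniq[OF \<Gamma>_E[OF X] \<Gamma>_E[OF X]]) (use that V KX in simp)
  have "?X \<in> \<Gamma>"
  proof (rule \<Gamma>I[OF cvfields_local])
    fix p
    show "\<exists>W X'. open W \<and> p \<in> W \<and> X' \<in> cvfields A \<and> (\<forall>q\<in>W. ?X q = X' q)"
      using V eq \<Gamma>_cvfields[OF X] by (intro exI[of _ "V p"] exI[of _ "X p"] conjI ballI) auto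
  qed (simp add: \<Gamma>_E X)
  then show ?thesis using KX V by (intro bexI[of _ ?X]) auto
qed

end

section \<open>The partial connections\<close>

locale ph_form = ph_manifold A m E \<theta> h
  for A :: "('a::{t2_space, second_countable_topology}, 'n::finite) chart set"
    and m :: nat
    and E :: "'a \<Rightarrow> 'a cvec set"
    and \<theta> :: "'a \<Rightarrow> 'a cvec \<Rightarrow> real"
    and h :: "'a \<Rightarrow> 'a cvec \<Rightarrow> 'a cvec \<Rightarrow> real" +
  fixes \<Psi> :: "'a \<Rightarrow> 'a cvec \<Rightarrow> 'a cvec \<Rightarrow> 'a cvec"
  assumes form: "complex_two_form A E \<Psi>"
    and form11: "is_11_form A E \<theta> \<Psi>"
begin

lemma \<Psi>_add_left: "u \<in> ctangent A p \<Longrightarrow> v \<in> ctangent A p \<Longrightarrow> w \<in> ctangent A p \<Longrightarrow>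
    \<Psi> p (u + v) w = \<Psi> p u w + \<Psi> p v w"
  and \<Psi>_scale_left: "u \<in> ctangent A p \<Longrightarrow> v \<in> ctangent A p \<Longrightarrow> \<Psi> p (cscale c u) v = cscale c (\<Psi> p u v)"
  and \<Psi>_antisym: "u \<in> ctangent A p \<Longrightarrow> v \<in> ctangent A p \<Longrightarrow> \<Psi> p u v = - \<Psi> p v u"
  and \<Psi>_\<Gamma>: "Z \<in> cvfields A \<Longrightarrow> W \<in> cvfields A \<Longrightarrow> (\<lambda>p. \<Psi> p (Z p) (W p)) \<in> \<Gamma>"
  using form unfolding complex_two_form_def by blast+

lemma \<Psi>_reeb: "v \<in> ctangent A p \<Longrightarrow> \<Psi> p (\<xi> p) v = 0"
  using form11 ctangent_zero unfolding is_11_form_def by blast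

lemma \<Psi>_EE: "u \<in> E p \<Longrightarrow> v \<in> E p \<Longrightarrow> \<Psi> p u v = 0"
  using form11 P_id E_ctangent unfolding is_11_form_def by metis

lemma \<Psi>_bar: "u \<in> E p \<Longrightarrow> v \<in> E p \<Longrightarrow> \<Psi> p (cconj u) (cconj v) = 0"
proof -
  assume uv: "u \<in> E p" "v \<in> E p"
  then have "N p (cconj u) = cconj u" "N p (cconj v) = cconj v"
    by (simp_all add: N_conj E_ctangent ctangent_conj)
  then show ?thesis using form11 uv E_ctangent ctangent_conj unfolding is_11_form_def by metis
qed

lemma \<Psi>_add_right:
  assumes "u \<in> ctangent A p" "v \<in> ctangent A p" "w \<in> ctangent A p"
  shows "\<Psi> p u (v + w) = \<Psi> p u v + \<Psi> p u w"
  using \<Psi>_add_left[OF assms(2,3,1)] \<Psi>_antisym[OF assms(1) ctangent_add[OF assms(2,3)]]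
    \<Psi>_antisym[OF assms(1,2)] \<Psi>_antisym[OF assms(1,3)] by simp

lemma \<Psi>_scale_right:
  assumes "u \<in> ctangent A p" "v \<in> ctangent A p"
  shows "\<Psi> p u (cscale c v) = cscale c (\<Psi> p u v)"
  using \<Psi>_scale_left[OF assms(2,1)] \<Psi>_antisym[OF assms(1) ctangent_scale[OF assms(2)]]
    \<Psi>_antisym[OF assms] by (simp add: cscale_minus)

lemma \<Psi>_splitting:
  assumes u: "u \<in> ctangent A p" and v: "v \<in> ctangent A p"
  shows "\<Psi> p u v = \<Psi> p (P p u) (N p v) + \<Psi> p (N p u) (P p v)"
proof -
  have c: "P p w \<in> ctangent A p" "N p w \<in> ctangent A p" "cscale k (\<xi> p) \<in> ctangent A p"
    if "w \<in> ctangent A p" for w k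
    using that by (auto simp: P_E E_ctangent N_conj ctangent_conj ctangent_scale reeb_ctangent)
  have b: "N p w = cconj (P p (cconj w))" "P p (cconj w) \<in> E p" "P p w \<in> E p" if "w \<in> ctangent A p" for w
    using that by (simp_all add: N_conj P_E ctangent_conj)
  have r: "\<Psi> p (\<xi> p) w = 0" "\<Psi> p w (\<xi> p) = 0" if "w \<in> ctangent A p" for w
    using \<Psi>_reeb[OF that] \<Psi>_antisym[OF that reeb_ctangent] by simp_all
  have "\<Psi> p u v = \<Psi> p (P p u + N p u + cscale (tc p u) (\<xi> p)) (P p v + N p v + cscale (tc p v) (\<xi> p))"
    using splitting[OF u] splitting[OF v] by simp
  also have "\<dots> = \<Psi> p (P p u) (P p v) + \<Psi> p (P p u) (N p v) + (\<Psi> p (N p u) (P p v) + \<Psi> p (N p u) (N p v))"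
    using c[OF u] c[OF v] reeb_ctangent
    by (simp add: \<Psi>_add_left \<Psi>_add_right \<Psi>_scale_left \<Psi>_scale_right r ctangent_add)
  also have "\<dots> = \<Psi> p (P p u) (N p v) + \<Psi> p (N p u) (P p v)"
    using \<Psi>_EE[OF b(3)[OF u] b(3)[OF v]] \<Psi>_bar[OF b(2)[OF u] b(2)[OF v]] b(1)[OF u] b(1)[OF v]
    by simp
  finally show ?thesis .
qed

text \<open>The (0,1) part of the connection is forced by the torsion condition. The Reeb direction is
  shared evenly between the (0,1) part \<open>anti X\<close> of a field and its complement, so that one formula
  covers all directions.\<close>
definition anti :: "'a cfield \<Rightarrow> 'a cfield" where
  "anti X = fconj (fP (fconj X)) + cfscale (\<lambda>p. 1 / 2 * tc p (X p)) \<xi>"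

lemma anti_apply: "anti X p = cconj (P p (cconj (X p))) + cscale (1 / 2 * tc p (X p)) (\<xi> p)"
  by (simp add: anti_def)

lemma reeb_cvfield: "\<xi> \<in> cvfields A"
  by (rule vfields_cvfields[OF reeb_vfield])

lemma anti_cvfields: "X \<in> cvfields A \<Longrightarrow> anti X \<in> cvfields A"
  unfolding anti_def
  by (intro cvfields_add cvfields_fconj cvfields_cfscale fP_\<Gamma>[THEN \<Gamma>_cvfields] reeb_cvfield
      smooth_fun_on_mult[OF open_UNIV] smooth_fun_on_const smooth_tc)

lemma P_anti: "X \<in> cvfields A \<Longrightarrow> P p (anti X p) = 0"
  using P_split[OF E_zero P_E[OF ctangent_conj[OF cvfields_ctangent]], of X p "1 / 2 * tc p (X p)"]
  by (simp add: anti_apply)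

lemma anti_add: "X \<in> cvfields A \<Longrightarrow> Y \<in> cvfields A \<Longrightarrow> anti (X + Y) = anti X + anti Y"
  by (rule ext) (simp add: anti_apply cconj_add P_add ctangent_conj cvfields_ctangent tc_add
      cscale_add_left distrib_left add.assoc add.left_commute)

lemma anti_cfscale: "X \<in> cvfields A \<Longrightarrow> anti (cfscale u X) = cfscale u (anti X)"
  by (rule ext) (simp add: anti_apply cconj_cscale P_scale ctangent_conj cvfields_ctangent tc_scale
      cscale_add mult.left_commute)

text \<open>The complement of \<open>anti X\<close> is conj (anti (conj X)): the (1,0) part together
  with the other half of the Reeb part. Conjugating twice keeps it complex linear in X.\<close>

lemma anti_sum: "X \<in> cvfields A \<Longrightarrow> X p = anti X p + cconj (anti (fconj X) p)"
proof -
  assume X: "X \<in> cvfields A"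
  note x = cvfields_ctangent[OF X, of p]
  have "cscale (tc p (X p)) (\<xi> p) = cscale (1 / 2 * tc p (X p)) (\<xi> p) + cscale (1 / 2 * tc p (X p)) (\<xi> p)"
    by (simp add: fun_eq_iff)
  then show ?thesis
    using splitting_conj[OF x] x
    by (simp add: anti_apply tc_conj cconj_add cconj_cscale algebra_simps)
qed

lemma anti_\<Gamma>: "W \<in> \<Gamma> \<Longrightarrow> anti W = 0"
  by (rule ext) (simp add: anti_apply \<Gamma>_E)

lemma anti_bar: "W \<in> \<Gamma> \<Longrightarrow> anti (fconj W) = fconj W"
  by (rule ext) (simp add: anti_apply \<Gamma>_E tc_conj E_ctangent)

lemma anti_reeb: "anti \<xi> = cfscale (\<lambda>_. 1 / 2) \<xi>"
  by (rule ext) (simp add: anti_apply)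

section \<open>The prescribed derivatives and the values of K(\<nabla>_X W, V)\<close>

text \<open>On (0,1) fields Y this is the derivative that the torsion condition prescribes. On \<xi>
  the form \<Psi> drops out and the (1,0) part of the Lie derivative remains.\<close>

definition B :: "'a cfield \<Rightarrow> 'a cfield \<Rightarrow> 'a cfield" where
  "B Y W = fP (lie_bracket Y W) + (\<lambda>p. \<Psi> p (Y p) (W p))"

lemma B_\<Gamma>: "Y \<in> cvfields A \<Longrightarrow> W \<in> \<Gamma> \<Longrightarrow> B Y W \<in> \<Gamma>"
  unfolding B_def by (intro \<Gamma>_add fP_\<Gamma> \<Psi>_\<Gamma> lie_bracket_cvfields) (simp_all add: \<Gamma>_cvfields)

lemma B_E: "Y \<in> cvfields A \<Longrightarrow> W \<in> \<Gamma> \<Longrightarrow> B Y W p \<in> E p"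
  by (rule \<Gamma>_E[OF B_\<Gamma>])

lemma B_add_right:
  assumes "Y \<in> cvfields A" "W \<in> \<Gamma>" "W' \<in> \<Gamma>"
  shows "B Y (W + W') p = B Y W p + B Y W' p"
  using assms
  by (simp add: B_def lie_bracket_add_right \<Gamma>_cvfields P_add \<Psi>_add_right
      cvfields_ctangent[OF lie_bracket_cvfields] cvfields_ctangent[OF \<Gamma>_cvfields] cvfields_ctangent)

lemma B_cfscale_right:
  assumes "Y \<in> cvfields A" "W \<in> \<Gamma>" "smooth u"
  shows "B Y (cfscale u W) p = cscale (capply (Y p) u) (W p) + cscale (u p) (B Y W p)"
  using assms
  by (simp add: B_def lie_bracket_cfscale_right \<Gamma>_cvfields P_add P_scale \<Psi>_scale_right \<Gamma>_E ctangent_scale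
      cvfields_ctangent[OF lie_bracket_cvfields] cvfields_ctangent[OF \<Gamma>_cvfields] cvfields_ctangent
      cscale_add add.assoc E_scale)

lemma B_add_left:
  assumes "Y \<in> cvfields A" "Y' \<in> cvfields A" "W \<in> \<Gamma>"
  shows "B (Y + Y') W p = B Y W p + B Y' W p"
  using assms
  by (simp add: B_def lie_bracket_add_left \<Gamma>_cvfields P_add \<Psi>_add_left
      cvfields_ctangent[OF lie_bracket_cvfields] cvfields_ctangent[OF \<Gamma>_cvfields] cvfields_ctangent)

text \<open>The bracket of u Y with W contains the extra term -(W u) Y, which \<open>P\<close>
  removes when Y has no (1,0) part. So \<open>B\<close> is tensorial exactly in the directions in
  which it is used as a derivative.\<close>

lemma B_cfscale_left:
  assumes "Y \<in> cvfields A" "W \<in> \<Gamma>" "smooth u" "P p (Y p) = 0"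
  shows "B (cfscale u Y) W p = cscale (u p) (B Y W p)"
  using assms
  by (simp add: B_def lie_bracket_cfscale_left \<Gamma>_cvfields P_diff P_scale \<Psi>_scale_left ctangent_scale
      cvfields_ctangent[OF lie_bracket_cvfields] cvfields_ctangent[OF \<Gamma>_cvfields] cvfields_ctangent
      cscale_add)

lemma B_zero_left: "W \<in> \<Gamma> \<Longrightarrow> B 0 W p = 0"
  using B_add_left[OF cvfields_zero cvfields_zero, of W p] unfolding add_0_left by simp

text \<open>The intended value of K(\<nabla>_X W, V). Along \<open>anti X\<close> the derivative is
  taken to be \<open>B\<close>. Along the complement Z it is moved to V by K(\<nabla>_Z W, V) = Z
  K(W, V) - K(W, \<nabla>_Z' V), where the conjugate Z' = anti (conj X) is again a direction for
  \<open>B\<close>. In the Reeb direction the errors made in the two halves offset each other when S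
  is symmetric.\<close>

definition F :: "'a cfield \<Rightarrow> 'a cfield \<Rightarrow> 'a cfield \<Rightarrow> 'a \<Rightarrow> complex" where
  "F X W V p = K p (B (anti X) W p) (V p)
     + capply (cconj (anti (fconj X) p)) (\<lambda>q. K q (W q) (V q))
     - K p (W p) (B (anti (fconj X)) V p)"

lemma anti_conj_ctangent: "X \<in> cvfields A \<Longrightarrow> cconj (anti (fconj X) p) \<in> ctangent A p"
  by (intro ctangent_conj cvfields_ctangent anti_cvfields cvfields_fconj)

lemma F_smooth:
  assumes "X \<in> cvfields A" "W \<in> \<Gamma>" "V \<in> \<Gamma>"
  shows "smooth (F X W V)"
proof -
  have "smooth (\<lambda>p. capply (fconj (anti (fconj X)) p) (\<lambda>q. K q (W q) (V q)))"
    by (intro smooth_capply cvfields_fconj anti_cvfields smooth_K assms)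
  then have "smooth (\<lambda>p. K p (B (anti X) W p) (V p)
     + capply (fconj (anti (fconj X)) p) (\<lambda>q. K q (W q) (V q))
     - K p (W p) (B (anti (fconj X)) V p))"
    by (intro smooth_fun_on_diff[OF open_UNIV] smooth_fun_on_add[OF open_UNIV] smooth_K B_\<Gamma>
        anti_cvfields cvfields_fconj assms)
  then show ?thesis by (simp add: F_def[abs_def])
qed

lemma F_add_V:
  assumes "X \<in> cvfields A" "W \<in> \<Gamma>" "V \<in> \<Gamma>" "V' \<in> \<Gamma>"
  shows "F X W (V + V') p = F X W V p + F X W V' p"
  using assms
  by (simp add: F_def B_add_right anti_cvfields cvfields_fconj K_add_right \<Gamma>_E B_E
      capply_fun_add[OF anti_conj_ctangent[OF assms(1)]] smooth_K)

text \<open>Derivatives of u enter from the product rule for K(W, u V) and from the Leibniz rule of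
  \<open>B\<close> in the last term. They cancel, which leaves the conjugate linearity that
  \<open>riesz\<close> asks for.\<close>

lemma F_cfscale_V:
  assumes "X \<in> cvfields A" "W \<in> \<Gamma>" "V \<in> \<Gamma>" "smooth u"
  shows "F X W (cfscale u V) p = cnj (u p) * F X W V p"
proof -
  have su: "smooth (\<lambda>q. cnj (u q))" by (intro smooth_intros assms)
  have c: "capply (cconj (anti (fconj X) p)) (\<lambda>q. cnj (u q)) = cnj (capply (anti (fconj X) p) u)"
    using assms by (intro capply_cnj[where p = p] cvfields_ctangent anti_cvfields cvfields_fconj)
  have "capply (cconj (anti (fconj X) p)) (\<lambda>q. K q (W q) (cfscale u V q)) =
      cnj (u p) * capply (cconj (anti (fconj X) p)) (\<lambda>q. K q (W q) (V q)) +
      K p (W p) (V p) * cnj (capply (anti (fconj X) p) u)"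
    using assms su
    by (simp add: K_scale_right \<Gamma>_E capply_fun_mult[OF anti_conj_ctangent[OF assms(1)]] smooth_K c)
  moreover have "K p (W p) (B (anti (fconj X)) (cfscale u V) p) =
      cnj (capply (anti (fconj X) p) u) * K p (W p) (V p) + cnj (u p) * K p (W p) (B (anti (fconj X)) V p)"
    using assms
    by (simp add: B_cfscale_right anti_cvfields cvfields_fconj K_add_right K_scale_right \<Gamma>_E B_E E_scale)
  ultimately show ?thesis
    using assms by (simp add: F_def K_scale_right \<Gamma>_E B_E anti_cvfields algebra_simps)
qed

lemma F_add_X:
  assumes "X \<in> cvfields A" "X' \<in> cvfields A" "W \<in> \<Gamma>" "V \<in> \<Gamma>"
  shows "F (X + X') W V p = F X W V p + F X' W V p"
proof -
  have f: "fconj (X + X') = fconj X + fconj X'" by (simp add: fun_eq_iff)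
  show ?thesis using assms
    by (simp add: F_def f anti_add B_add_left anti_cvfields cvfields_fconj K_add_left K_add_right \<Gamma>_E B_E
        cconj_add capply_add)
qed

lemma F_cfscale_X:
  assumes "X \<in> cvfields A" "W \<in> \<Gamma>" "V \<in> \<Gamma>" "smooth u"
  shows "F (cfscale u X) W V p = u p * F X W V p"
proof -
  have f: "fconj (cfscale u X) = cfscale (\<lambda>q. cnj (u q)) (fconj X)" by (simp add: fun_eq_iff)
  have su: "smooth (\<lambda>q. cnj (u q))" by (intro smooth_intros assms)
  show ?thesis using assms su
    by (simp add: F_def f anti_cfscale B_cfscale_left anti_cvfields cvfields_fconj P_anti K_scale_left K_scale_right \<Gamma>_E B_E
        cconj_cscale capply_cscale algebra_simps)
qed

lemma F_add_W:
  assumes "X \<in> cvfields A" "W \<in> \<Gamma>" "W' \<in> \<Gamma>" "V \<in> \<Gamma>"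
  shows "F X (W + W') V p = F X W V p + F X W' V p"
  using assms
  by (simp add: F_def B_add_right anti_cvfields cvfields_fconj K_add_left \<Gamma>_E B_E
      capply_fun_add[OF anti_conj_ctangent[OF assms(1)]] smooth_K)

text \<open>Here the derivatives of u along \<open>anti X\<close> and along its complement add up to
  X u, which is the Leibniz rule of a connection.\<close>

lemma F_cfscale_W:
  assumes "X \<in> cvfields A" "W \<in> \<Gamma>" "V \<in> \<Gamma>" "smooth u"
  shows "F X (cfscale u W) V p = capply (X p) u * K p (W p) (V p) + u p * F X W V p"
proof -
  have "capply (X p) u = capply (anti X p) u + capply (cconj (anti (fconj X) p)) u"
    unfolding capply_add[symmetric] using anti_sum[OF assms(1)] by simp
  then show ?thesis using assms
    by (simp add: F_def B_cfscale_right anti_cvfields cvfields_fconj K_add_left K_scale_left \<Gamma>_E B_E E_scale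
        capply_fun_mult[OF anti_conj_ctangent[OF assms(1)]] smooth_K algebra_simps)
qed

section \<open>The covariant derivative of (1,0) sections\<close>

definition nabla :: "'a cfield \<Rightarrow> 'a cfield \<Rightarrow> 'a cfield" where
  "nabla X W = (SOME U. U \<in> \<Gamma> \<and> (\<forall>V\<in>\<Gamma>. \<forall>p. K p (U p) (V p) = F X W V p))"

lemma nabla_props:
  assumes "X \<in> cvfields A" "W \<in> \<Gamma>"
  shows "nabla X W \<in> \<Gamma> \<and> (\<forall>V\<in>\<Gamma>. \<forall>p. K p (nabla X W p) (V p) = F X W V p)"
proof -
  have "\<exists>U\<in>\<Gamma>. \<forall>V\<in>\<Gamma>. \<forall>p. K p (U p) (V p) = F X W V p"
    using assms by (intro riesz F_smooth F_add_V F_cfscale_V)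
  then have "\<exists>U. U \<in> \<Gamma> \<and> (\<forall>V\<in>\<Gamma>. \<forall>p. K p (U p) (V p) = F X W V p)" by blast
  from someI_ex[OF this] show ?thesis unfolding nabla_def .
qed

lemma nabla_\<Gamma>: "X \<in> cvfields A \<Longrightarrow> W \<in> \<Gamma> \<Longrightarrow> nabla X W \<in> \<Gamma>"
  and nabla_K: "X \<in> cvfields A \<Longrightarrow> W \<in> \<Gamma> \<Longrightarrow> V \<in> \<Gamma> \<Longrightarrow> K p (nabla X W p) (V p) = F X W V p"
  using nabla_props by blast+

lemma nabla_E: "X \<in> cvfields A \<Longrightarrow> W \<in> \<Gamma> \<Longrightarrow> nabla X W p \<in> E p"
  by (rule \<Gamma>_E[OF nabla_\<Gamma>])

text \<open>Testing with the difference of the two sections suffices because \<open>K\<close> is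
  definite. The algebraic rules for \<open>nabla\<close> thus reduce to those for
  \<open>F\<close>.\<close>

lemma nabla_unique:
  assumes "X \<in> cvfields A" "W \<in> \<Gamma>" "U \<in> \<Gamma>" "\<And>V p. V \<in> \<Gamma> \<Longrightarrow> K p (U p) (V p) = F X W V p"
  shows "nabla X W = U"
proof
  fix p
  let ?D = "nabla X W - U"
  have D: "?D \<in> \<Gamma>" by (intro \<Gamma>_diff nabla_\<Gamma> assms)
  have "K p (?D p) (?D p) = 0"
    using nabla_K[OF assms(1,2) D, of p] assms(4)[OF D, of p]
    by (simp add: K_diff_left \<Gamma>_E[OF D, of p, simplified] \<Gamma>_E assms(3) nabla_\<Gamma> assms(1,2) E_diff)
  then have "?D p = 0" by (rule K_zero_imp[OF \<Gamma>_E[OF D]])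
  then show "nabla X W p = U p" by simp
qed

lemma nabla_add_X:
  assumes "X \<in> cvfields A" "X' \<in> cvfields A" "W \<in> \<Gamma>"
  shows "nabla (X + X') W = nabla X W + nabla X' W"
  using assms
  by (intro nabla_unique cvfields_add \<Gamma>_add nabla_\<Gamma>) (simp_all add: K_add_left nabla_E \<Gamma>_E nabla_K F_add_X)

lemma nabla_cfscale_X:
  assumes "X \<in> cvfields A" "W \<in> \<Gamma>" "smooth u"
  shows "nabla (cfscale u X) W = cfscale u (nabla X W)"
  using assms
  by (intro nabla_unique cvfields_cfscale \<Gamma>_cfscale nabla_\<Gamma>) (simp_all add: K_scale_left nabla_E \<Gamma>_E nabla_K F_cfscale_X)

lemma nabla_add_W:
  assumes "X \<in> cvfields A" "W \<in> \<Gamma>" "W' \<in> \<Gamma>"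
  shows "nabla X (W + W') = nabla X W + nabla X W'"
  using assms
  by (intro nabla_unique \<Gamma>_add nabla_\<Gamma>) (simp_all add: K_add_left nabla_E \<Gamma>_E nabla_K F_add_W)

lemma nabla_cfscale_W:
  assumes "X \<in> cvfields A" "W \<in> \<Gamma>" "smooth u"
  shows "nabla X (cfscale u W) = cfscale (\<lambda>p. capply (X p) u) W + cfscale u (nabla X W)"
  using assms
  by (intro nabla_unique \<Gamma>_add \<Gamma>_cfscale nabla_\<Gamma> smooth_capply)
    (simp_all add: K_add_left K_scale_left E_scale nabla_E \<Gamma>_E nabla_K F_cfscale_W)

lemma nabla_zero_W: "X \<in> cvfields A \<Longrightarrow> nabla X 0 = 0"
  using nabla_add_W[OF _ \<Gamma>_zero \<Gamma>_zero, of X] unfolding add_0_left by simp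

lemma nabla_const_W:
  assumes "X \<in> cvfields A" "W \<in> \<Gamma>"
  shows "nabla X (cfscale (\<lambda>_. c) W) = cfscale (\<lambda>_. c) (nabla X W)"
  using nabla_cfscale_W[OF assms smooth_fun_on_const, of c] assms
  by (simp add: capply_fun_const[OF cvfields_ctangent[OF assms(1)]] fun_eq_iff)

text \<open>For real X, the conjugate of F X V W contains the two \<open>B\<close> terms of F X W V
  with opposite signs. In the sum only the derivatives along \<open>anti X\<close> and its conjugate
  remain, and these directions add up to X.\<close>

lemma nabla_metric:
  assumes X: "X \<in> vfields A" and W: "W \<in> \<Gamma>" and V: "V \<in> \<Gamma>"
  shows "capply (X p) (\<lambda>q. K q (W q) (V q)) = K p (nabla X W p) (V p) + K p (W p) (nabla X V p)"
proof -
  note cX = vfields_cvfields[OF X]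
  have f: "fconj X = X" by (rule vfields_fconj[OF X])
  have sw: "capply (cconj (anti X p)) (\<lambda>q. K q (V q) (W q)) = cnj (capply (anti X p) (\<lambda>q. K q (W q) (V q)))"
    using capply_cnj[OF cvfields_ctangent[OF anti_cvfields[OF cX]] smooth_K[OF W V], of p]
    by (simp add: K_herm \<Gamma>_E W V)
  have "K p (W p) (nabla X V p) = cnj (F X V W p)"
    using K_herm[OF nabla_E[OF cX V] \<Gamma>_E[OF W], of p] nabla_K[OF cX V W, of p] by simp
  also have "\<dots> = K p (W p) (B (anti X) V p) + capply (anti X p) (\<lambda>q. K q (W q) (V q))
      - K p (B (anti X) W p) (V p)"
    using W V by (simp add: F_def f sw K_herm B_E anti_cvfields cX \<Gamma>_E)
  finally have "K p (nabla X W p) (V p) + K p (W p) (nabla X V p) =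
      capply (cconj (anti X p)) (\<lambda>q. K q (W q) (V q)) + capply (anti X p) (\<lambda>q. K q (W q) (V q))"
    using nabla_K[OF cX W V, of p] by (simp add: F_def f)
  also have "\<dots> = capply (X p) (\<lambda>q. K q (W q) (V q))"
    unfolding capply_add[symmetric] using anti_sum[OF cX, of p] f by (simp add: add.commute)
  finally show ?thesis by simp
qed

text \<open>A conjugated section is its own \<open>anti\<close> part and has no complement, so F
  reduces to its first term.\<close>

lemma nabla_bar:
  assumes Z: "Z \<in> \<Gamma>" and W: "W \<in> \<Gamma>"
  shows "nabla (fconj Z) W = B (fconj Z) W"
proof (rule nabla_unique)
  show cZ: "fconj Z \<in> cvfields A" by (intro cvfields_fconj \<Gamma>_cvfields Z)
  show "B (fconj Z) W \<in> \<Gamma>" by (rule B_\<Gamma>[OF cZ W])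
  show "K p (B (fconj Z) W p) (V p) = F (fconj Z) W V p" if V: "V \<in> \<Gamma>" for V p
    using K_herm[OF E_zero \<Gamma>_E[OF W], of p]
    by (simp add: F_def anti_bar[OF Z] anti_\<Gamma>[OF Z] B_zero_left[OF V] \<Gamma>_E[OF W])
qed (rule W)

text \<open>This is where the evenly shared Reeb direction matters: \<open>nabla \<xi>\<close> deviates from the Lie derivative
  by a Hermitian symmetric endomorphism.\<close>
lemma nabla_reeb_symmetric:
  assumes W: "W \<in> \<Gamma>" and V: "V \<in> \<Gamma>"
  shows "K p (nabla \<xi> W p - P p (lie_bracket \<xi> W p)) (V p) =
    K p (W p) (nabla \<xi> V p - P p (lie_bracket \<xi> V p))"
proof -
  have f: "fconj \<xi> = \<xi>" by (rule vfields_fconj[OF reeb_vfield])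
  have L: "P p (lie_bracket \<xi> Z p) \<in> E p" if "Z \<in> \<Gamma>" for Z p
    using that by (intro P_E cvfields_ctangent lie_bracket_cvfields reeb_cvfield \<Gamma>_cvfields)
  have "B \<xi> Z p = P p (lie_bracket \<xi> Z p)" if "Z \<in> \<Gamma>" for Z p
    using \<Psi>_reeb[OF cvfields_ctangent[OF \<Gamma>_cvfields[OF that]], of p] by (simp add: B_def)
  then have Bz: "B (anti \<xi>) Z p = cscale (1 / 2) (P p (lie_bracket \<xi> Z p))" if "Z \<in> \<Gamma>" for Z p
    using that by (simp add: anti_reeb B_cfscale_left reeb_cvfield smooth_fun_on_const)
  have az: "cconj (anti \<xi> p) = cscale (1 / 2) (\<xi> p)" for p
    by (simp add: anti_reeb cconj_cscale)
  \<comment> \<open>With L = \<pi>_+ [\<xi>, .], the definition of F gives K(\<nabla>_\<xi> W, V) as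
    half of K(L W, V) + \<xi> K(W, V) - K(W, L V). Subtracting K(L W, V) leaves an expression that
    is Hermitian in W and V, because \<xi> is real.\<close>
  have half: "K p (nabla \<xi> W p - P p (lie_bracket \<xi> W p)) (V p) = 1 / 2 *
     (capply (\<xi> p) (\<lambda>q. K q (W q) (V q)) - K p (P p (lie_bracket \<xi> W p)) (V p) - K p (W p) (P p (lie_bracket \<xi> V p)))"
    if W: "W \<in> \<Gamma>" and V: "V \<in> \<Gamma>" for W V
  proof -
    have "K p (nabla \<xi> W p) (V p) = 1 / 2 * (K p (P p (lie_bracket \<xi> W p)) (V p) +
        capply (\<xi> p) (\<lambda>q. K q (W q) (V q)) - K p (W p) (P p (lie_bracket \<xi> V p)))"
      using nabla_K[OF reeb_cvfield W V, of p]
      by (simp add: F_def f az Bz W V capply_cscale L \<Gamma>_E K_scale_left K_scale_right algebra_simps)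
    then show ?thesis
      by (simp add: K_diff_left nabla_E reeb_cvfield L \<Gamma>_E W V field_simps)
  qed
  have sw: "cnj (capply (\<xi> p) (\<lambda>q. K q (V q) (W q))) = capply (\<xi> p) (\<lambda>q. K q (W q) (V q))"
    using capply_cnj[OF cvfields_ctangent[OF reeb_cvfield] smooth_K[OF V W], of p]
    by (simp add: K_herm \<Gamma>_E W V)
  have "K p (W p) (nabla \<xi> V p - P p (lie_bracket \<xi> V p)) = cnj (K p (nabla \<xi> V p - P p (lie_bracket \<xi> V p)) (W p))"
    by (intro K_herm[symmetric] E_diff nabla_E reeb_cvfield L \<Gamma>_E W V)
  also have "\<dots> = K p (nabla \<xi> W p - P p (lie_bracket \<xi> W p)) (V p)"
    using W V by (simp add: half sw K_herm L \<Gamma>_E)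
  finally show ?thesis by simp
qed

end

section \<open>Complex bilinear extensions\<close>

lemma ciscale_add: "ciscale (X + Y) = ciscale X + ciscale Y"
  and ciscale_diff: "ciscale (X - Y) = ciscale X - ciscale Y"
  and ciscale_minus: "ciscale (- X) = - ciscale X"
  and ciscale_ciscale [simp]: "ciscale (ciscale X) = - X"
  and ciscale_zero [simp]: "ciscale 0 = 0"
  by (auto simp: fun_eq_iff ciscale_def algebra_simps)

lemma re_field_add: "re_field (X + Y) = re_field X + re_field Y"
  and im_field_add: "im_field (X + Y) = im_field X + im_field Y"
  and re_field_ciscale: "re_field (ciscale X) = - im_field X"
  and im_field_ciscale: "im_field (ciscale X) = re_field X"
  and re_field_fconj: "re_field (fconj X) = re_field X"
  and im_field_fconj: "im_field (fconj X) = - im_field X"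
  by (auto simp: fun_eq_iff re_field_def im_field_def ciscale_def)

lemma ciscale_apply: "ciscale X p = cscale \<i> (X p)"
  by (simp add: ciscale_def)

lemma cbilinear_ext_torsion:
  "cbilinear_ext (torsion D) Z W = cbilinear_ext D Z W - cbilinear_ext D W Z - cbilinear_ext lie_bracket Z W"
  by (rule ext, rule ext) (simp add: cbilinear_ext_def torsion_def ciscale_def algebra_simps)

context smooth_manifold
begin

lemma vfields_uminus: "X \<in> vfields A \<Longrightarrow> - X \<in> vfields A"
  by (simp add: vfields_iff cvfields_uminus tangent_uminus)

lemma cvfields_ciscale: "X \<in> cvfields A \<Longrightarrow> ciscale X \<in> cvfields A"
  unfolding ciscale_cfscale by (intro cvfields_cfscale smooth_fun_on_const)

end

text \<open>Shared by an arbitrary connection and by the one constructed at the end. Additivity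
  suffices for the rules below, which only split arguments into real and imaginary parts or multiply
  them by i.\<close>

locale biadditive = smooth_manifold A
  for A :: "('a::{t2_space, second_countable_topology}, 'n::finite) chart set" +
  fixes D :: "'a cfield \<Rightarrow> 'a cfield \<Rightarrow> 'a cfield"
  assumes vfields: "\<And>X Y. X \<in> vfields A \<Longrightarrow> Y \<in> vfields A \<Longrightarrow> D X Y \<in> vfields A"
    and add_left: "\<And>X X' Y. X \<in> vfields A \<Longrightarrow> X' \<in> vfields A \<Longrightarrow> Y \<in> vfields A \<Longrightarrow> D (X + X') Y = D X Y + D X' Y"
    and add_right: "\<And>X Y Y'. X \<in> vfields A \<Longrightarrow> Y \<in> vfields A \<Longrightarrow> Y' \<in> vfields A \<Longrightarrow> D X (Y + Y') = D X Y + D X Y'"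
begin

lemma biadditive_zero_left: "Y \<in> vfields A \<Longrightarrow> D 0 Y = 0"
  using add_left[OF vfields_zero vfields_zero, of Y] unfolding add_0_left by simp

lemma biadditive_zero_right: "X \<in> vfields A \<Longrightarrow> D X 0 = 0"
  using add_right[OF _ vfields_zero vfields_zero, of X] unfolding add_0_left by simp

lemma biadditive_minus_left: "X \<in> vfields A \<Longrightarrow> Y \<in> vfields A \<Longrightarrow> D (- X) Y = - D X Y"
proof -
  assume X: "X \<in> vfields A" and Y: "Y \<in> vfields A"
  have "D X Y + D (- X) Y = 0"
    using add_left[OF X vfields_uminus[OF X] Y] biadditive_zero_left[OF Y] by simp
  then show ?thesis by (simp add: eq_neg_iff_add_eq_0 add.commute)
qed

lemma biadditive_minus_right: "X \<in> vfields A \<Longrightarrow> Y \<in> vfields A \<Longrightarrow> D X (- Y) = - D X Y"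
proof -
  assume X: "X \<in> vfields A" and Y: "Y \<in> vfields A"
  have "D X Y + D X (- Y) = 0"
    using add_right[OF X Y vfields_uminus[OF Y]] biadditive_zero_right[OF X] by simp
  then show ?thesis by (simp add: eq_neg_iff_add_eq_0 add.commute)
qed

lemma cbilinear_ext_add_left:
  "X \<in> cvfields A \<Longrightarrow> X' \<in> cvfields A \<Longrightarrow> Y \<in> cvfields A \<Longrightarrow>
    cbilinear_ext D (X + X') Y = cbilinear_ext D X Y + cbilinear_ext D X' Y"
  by (simp add: cbilinear_ext_def re_field_add im_field_add add_left re_field_vfields im_field_vfields
      ciscale_add algebra_simps)

lemma cbilinear_ext_ciscale_left:
  "X \<in> cvfields A \<Longrightarrow> Y \<in> cvfields A \<Longrightarrow> cbilinear_ext D (ciscale X) Y = ciscale (cbilinear_ext D X Y)"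
  by (simp add: cbilinear_ext_def re_field_ciscale im_field_ciscale biadditive_minus_left
      re_field_vfields im_field_vfields ciscale_add ciscale_diff ciscale_minus algebra_simps)

lemma cbilinear_ext_ciscale_right:
  "X \<in> cvfields A \<Longrightarrow> Y \<in> cvfields A \<Longrightarrow> cbilinear_ext D X (ciscale Y) = ciscale (cbilinear_ext D X Y)"
  by (simp add: cbilinear_ext_def re_field_ciscale im_field_ciscale biadditive_minus_right
      re_field_vfields im_field_vfields ciscale_add ciscale_diff ciscale_minus algebra_simps)

lemma cbilinear_ext_real_left:
  "X \<in> vfields A \<Longrightarrow> Y \<in> cvfields A \<Longrightarrow>
    cbilinear_ext D X Y = D X (re_field Y) + ciscale (D X (im_field Y))"
  by (simp add: cbilinear_ext_def re_field_vfield im_field_vfield biadditive_zero_left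
      re_field_vfields im_field_vfields)

lemma cbilinear_ext_real: "X \<in> vfields A \<Longrightarrow> Y \<in> vfields A \<Longrightarrow> cbilinear_ext D X Y = D X Y"
  by (simp add: cbilinear_ext_real_left vfields_cvfields re_field_vfield im_field_vfield biadditive_zero_right)

lemma cbilinear_ext_split_left:
  assumes "X \<in> cvfields A" "Y \<in> cvfields A"
  shows "cbilinear_ext D X Y = cbilinear_ext D (re_field X) Y + ciscale (cbilinear_ext D (im_field X) Y)"
proof -
  have "cbilinear_ext D X Y = cbilinear_ext D (re_field X + ciscale (im_field X)) Y"
    using re_im_field[of X] by simp
  also have "\<dots> = cbilinear_ext D (re_field X) Y + ciscale (cbilinear_ext D (im_field X) Y)"
    using assms re_field_vfields[THEN vfields_cvfields] im_field_vfields[THEN vfields_cvfields]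
    by (simp add: cbilinear_ext_add_left cbilinear_ext_ciscale_left cvfields_ciscale)
  finally show ?thesis .
qed

lemma cbilinear_ext_cvfields:
  assumes "X \<in> cvfields A" "Y \<in> cvfields A"
  shows "cbilinear_ext D X Y \<in> cvfields A"
  unfolding cbilinear_ext_def
  by (intro cvfields_add cvfields_diff cvfields_ciscale vfields_cvfields vfields
      re_field_vfields im_field_vfields assms)

lemma cbilinear_ext_fconj_right:
  assumes X: "X \<in> vfields A" and Y: "Y \<in> cvfields A"
  shows "cbilinear_ext D X (fconj Y) = fconj (cbilinear_ext D X Y)"
proof -
  have "cbilinear_ext D X (fconj Y) = D X (re_field Y) - ciscale (D X (im_field Y))"
    using X Y by (simp add: cbilinear_ext_real_left cvfields_fconj re_field_fconj im_field_fconj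
        biadditive_minus_right im_field_vfields ciscale_minus)
  moreover have "fconj (D X (re_field Y)) = D X (re_field Y)" "fconj (D X (im_field Y)) = D X (im_field Y)"
    using vfields_fconj[OF vfields[OF X re_field_vfields[OF Y]]]
      vfields_fconj[OF vfields[OF X im_field_vfields[OF Y]]] by simp_all
  then have "fconj (cbilinear_ext D X Y) = D X (re_field Y) - ciscale (D X (im_field Y))"
    unfolding cbilinear_ext_real_left[OF X Y] by (simp add: fun_eq_iff ciscale_def)
  ultimately show ?thesis by simp
qed

end

context smooth_manifold
begin

text \<open>The operator bracket is complex bilinear as it stands, so the extended torsion contains
  the brackets of the complex fields themselves.\<close>

lemma cbilinear_ext_lie_bracket:
  assumes X: "X \<in> cvfields A" and Y: "Y \<in> cvfields A"
  shows "cbilinear_ext lie_bracket X Y = lie_bracket X Y"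
proof
  fix p
  have v: "re_field X \<in> cvfields A" "im_field X \<in> cvfields A" "re_field Y \<in> cvfields A" "im_field Y \<in> cvfields A"
    using X Y re_field_vfields im_field_vfields vfields_cvfields by auto
  have r: "lie_bracket Z (ciscale Y) p = cscale \<i> (lie_bracket Z Y p)"
    if "Z \<in> cvfields A" "Y \<in> cvfields A" for Z Y
    using that by (simp add: ciscale_cfscale lie_bracket_cfscale_right smooth_fun_on_const
        capply_fun_const[OF cvfields_ctangent[OF that(1)]])
  have l: "lie_bracket (ciscale Z) Y p = cscale \<i> (lie_bracket Z Y p)"
    if "Z \<in> cvfields A" "Y \<in> cvfields A" for Z Y
    using that by (simp add: ciscale_cfscale lie_bracket_cfscale_left smooth_fun_on_const
        capply_fun_const[OF cvfields_ctangent[OF that(2)]])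
  have "lie_bracket X Y p = lie_bracket (re_field X + ciscale (im_field X)) (re_field Y + ciscale (im_field Y)) p"
    using re_im_field[of X] re_im_field[of Y] by simp
  also have "\<dots> = cbilinear_ext lie_bracket X Y p"
    using v by (simp add: lie_bracket_add_left lie_bracket_add_right cvfields_add cvfields_ciscale r l
        cbilinear_ext_def ciscale_apply cscale_add cscale_minus_left algebra_simps)
  finally show "cbilinear_ext lie_bracket X Y p = lie_bracket X Y p" by simp
qed

end

section \<open>Pseudo-Hermitian connections\<close>

context ph_manifold
begin

lemma K_zero_right [simp]: "v \<in> E p \<Longrightarrow> K p v 0 = 0"
  using K_herm[OF E_zero, of v p] by simp

lemma g_metric_eq:
  "u \<in> tangent A p \<Longrightarrow> v \<in> tangent A p \<Longrightarrow>
    g_metric A E \<theta> h p u v = Re (K p (P p u) (P p v)) + \<theta> p u * \<theta> p v"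
  by (simp add: g_metric_def h_tensor_eq)

lemma th_dbl [simp]: "v \<in> E p \<Longrightarrow> \<theta> p (dbl v) = 0"
  using dbl_H by (simp add: H_iff)

lemma P_dbl_reeb: "v \<in> E p \<Longrightarrow> P p (dbl v + cscale c (\<xi> p)) = v"
  using P_split[of v p v c] by (simp add: dbl_def)

lemma th_dbl_reeb: "v \<in> E p \<Longrightarrow> \<theta> p (dbl v + cscale (of_real c) (\<xi> p)) = c"
  by (simp add: th_add dbl_tangent E_ctangent tangent_scale vfields_tangent[OF reeb_vfield] th_scale)

lemma vfield_splitting:
  "Y \<in> vfields A \<Longrightarrow> Y = fdbl (fP Y) + fscale (\<lambda>p. \<theta> p (Y p)) \<xi>"
  by (rule ext) (simp add: fscale_def tangent_splitting[OF vfields_tangent, symmetric])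

lemma fP_fdbl: "W \<in> \<Gamma> \<Longrightarrow> fP (fdbl W) = W"
  by (rule ext) (simp add: P_dbl \<Gamma>_E)

lemma fP_\<Gamma>_id: "W \<in> \<Gamma> \<Longrightarrow> fP W = W"
  by (rule ext) (simp add: \<Gamma>_E)

lemma fP_bar: "W \<in> \<Gamma> \<Longrightarrow> fP (fconj W) = 0"
  by (rule ext) (simp add: \<Gamma>_E)

lemma fdbl_re_field: "fdbl W = re_field W + re_field W"
  by (simp add: fun_eq_iff fdbl_def re_field_def complex_eq_iff)

end

text \<open>An arbitrary pseudo-Hermitian connection. The results serve twice: for uniqueness, and,
  applied to the constructed connection, to verify its two torsion conditions.\<close>

locale ph_connection = ph_form +
  fixes D :: "'a cfield \<Rightarrow> 'a cfield \<Rightarrow> 'a cfield"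
  assumes phc: "pseudo_hermitian_connection A E \<theta> h D"
begin

lemma D_linear: "linear_connection A D"
  using phc by (simp add: pseudo_hermitian_connection_def)

lemma D_vfields: "X \<in> vfields A \<Longrightarrow> Y \<in> vfields A \<Longrightarrow> D X Y \<in> vfields A"
  and D_outside: "X \<notin> vfields A \<or> Y \<notin> vfields A \<Longrightarrow> D X Y = 0"
  and D_add_left: "X \<in> vfields A \<Longrightarrow> X' \<in> vfields A \<Longrightarrow> Y \<in> vfields A \<Longrightarrow> D (X + X') Y = D X Y + D X' Y"
  and D_scale_left: "smooth u \<Longrightarrow> X \<in> vfields A \<Longrightarrow> Y \<in> vfields A \<Longrightarrow> D (fscale u X) Y = fscale u (D X Y)"
  and D_add_right: "X \<in> vfields A \<Longrightarrow> Y \<in> vfields A \<Longrightarrow> Y' \<in> vfields A \<Longrightarrow> D X (Y + Y') = D X Y + D X Y'"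
  and D_scale_right: "smooth u \<Longrightarrow> X \<in> vfields A \<Longrightarrow> Y \<in> vfields A \<Longrightarrow>
    D X (fscale u Y) = fscale (\<lambda>p. Re (X p u)) Y + fscale u (D X Y)"
  using D_linear unfolding linear_connection_def by blast+

end

sublocale ph_connection \<subseteq> biadditive A D
  by unfold_locales (simp_all add: D_vfields D_add_left D_add_right)

context ph_connection
begin

abbreviation Dc :: "'a cfield \<Rightarrow> 'a cfield \<Rightarrow> 'a cfield" where "Dc \<equiv> cbilinear_ext D"

lemma Dc_\<Gamma>_real: "X \<in> vfields A \<Longrightarrow> W \<in> \<Gamma> \<Longrightarrow> Dc X W \<in> \<Gamma>"
  using phc unfolding pseudo_hermitian_connection_def preserves_def by blast

lemma Dc_\<Gamma>: "X \<in> cvfields A \<Longrightarrow> W \<in> \<Gamma> \<Longrightarrow> Dc X W \<in> \<Gamma>"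
  unfolding cbilinear_ext_split_left[OF _ \<Gamma>_cvfields] ciscale_cfscale
  by (intro \<Gamma>_add \<Gamma>_cfscale Dc_\<Gamma>_real smooth_fun_on_const re_field_vfields im_field_vfields)

lemma Dc_E: "X \<in> cvfields A \<Longrightarrow> W \<in> \<Gamma> \<Longrightarrow> Dc X W p \<in> E p"
  by (rule \<Gamma>_E[OF Dc_\<Gamma>])

text \<open>D is a real operator, so along real fields its extension commutes with conjugation and
  keeps conjugated sections in the (0,1) bundle. This removes one of the two covariant derivatives
  from the (1,0) part of the torsion.\<close>

lemma Dc_bar:
  assumes X: "X \<in> cvfields A" and W: "W \<in> \<Gamma>"
  shows "P p (Dc X (fconj W) p) = 0"
proof -
  have W': "W \<in> cvfields A" "fconj W \<in> cvfields A" using W by (simp_all add: \<Gamma>_cvfields cvfields_fconj)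
  have "Dc X (fconj W) p = cconj (Dc (re_field X) W p) + cscale \<i> (cconj (Dc (im_field X) W p))"
    using cbilinear_ext_split_left[OF X W'(2)] cbilinear_ext_fconj_right[OF re_field_vfields[OF X] W'(1)]
      cbilinear_ext_fconj_right[OF im_field_vfields[OF X] W'(1)] by (simp add: ciscale_apply)
  also have "\<dots> = cconj (Dc (re_field X) W p - cscale \<i> (Dc (im_field X) W p))"
    by (simp add: fun_eq_iff)
  finally show ?thesis
    using P_conj_E[OF E_diff[OF Dc_E[OF vfields_cvfields[OF re_field_vfields[OF X]] W]
      E_scale[OF Dc_E[OF vfields_cvfields[OF im_field_vfields[OF X]] W]]]] by simp
qed

lemma D_metric:
  "X \<in> vfields A \<Longrightarrow> Y \<in> vfields A \<Longrightarrow> Z \<in> vfields A \<Longrightarrow>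
    Re (X p (\<lambda>q. g_metric A E \<theta> h q (Y q) (Z q))) =
      g_metric A E \<theta> h p (D X Y p) (Z p) + g_metric A E \<theta> h p (Y p) (D X Z p)"
  using phc unfolding pseudo_hermitian_connection_def by blast

text \<open>Preservation of the Reeb line yields a multiple c \<xi>, and differentiating the
  constant g(\<xi>, \<xi>) = 1 gives c = 0.\<close>

lemma D_reeb:
  assumes X: "X \<in> vfields A"
  shows "D X \<xi> = 0"
proof
  fix p
  note r = reeb_vfield and t = vfields_tangent[OF reeb_vfield]
  let ?L = "\<lambda>p. {cscale c (\<xi> p) | c. True}"
  have "\<xi> p \<in> ?L p" for p
    by (rule CollectI, rule exI[of _ 1]) simp
  then have "\<xi> \<in> sections A ?L"
    unfolding sections_cvfields[of _ ?L] using reeb_cvfield by simp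
  moreover have "preserves A D ?L"
    using phc unfolding pseudo_hermitian_connection_def by (elim conjE)
  ultimately have "Dc X \<xi> \<in> sections A ?L"
    using X unfolding preserves_def by blast
  then have "D X \<xi> p \<in> ?L p"
    unfolding cbilinear_ext_real[OF X r] sections_cvfields[of _ ?L] by blast
  then obtain c where c: "D X \<xi> p = cscale c (\<xi> p)" by blast
  have Dt: "D X \<xi> p \<in> tangent A p" by (rule vfields_tangent[OF D_vfields[OF X r]])
  have "Re (X p (\<lambda>q. g_metric A E \<theta> h q (\<xi> q) (\<xi> q))) = 0"
    using tangent_fun_const[OF vfields_tangent[OF X]] t by (simp add: g_metric_eq E_zero)
  then have "\<theta> p (D X \<xi> p) = 0"
    using D_metric[OF X r r, of p] Dt t
    by (simp add: g_metric_eq P_E tangent_ctangent)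
  moreover have "tc p (D X \<xi> p) = c" using c by (simp add: tc_scale reeb_ctangent)
  ultimately have "c = 0" using tc_tangent[OF Dt] by simp
  then show "D X \<xi> p = 0 p" using c by simp
qed

text \<open>D is recovered from its extension on (1,0) sections, so two connections need to be
  compared only there. The same formula serves as the definition of \<open>conn\<close>.\<close>

lemma D_eq:
  assumes X: "X \<in> vfields A" and Y: "Y \<in> vfields A"
  shows "D X Y = fdbl (Dc X (fP Y)) + fscale (\<lambda>p. Re (X p (\<lambda>q. \<theta> q (Y q)))) \<xi>"
proof -
  have d: "D X (fdbl W) = fdbl (Dc X W)" if W: "W \<in> \<Gamma>" for W
  proof -
    note r = re_field_vfields[OF \<Gamma>_cvfields[OF W]] and i = im_field_vfields[OF \<Gamma>_cvfields[OF W]]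
    have 1: "D X (fdbl W) = D X (re_field W) + D X (re_field W)"
      by (simp only: fdbl_re_field D_add_right X r)
    have 2: "D X (re_field W) = re_field (Dc X W)"
      unfolding cbilinear_ext_real_left[OF X \<Gamma>_cvfields[OF W]] re_field_add re_field_ciscale
      by (simp add: re_field_vfield im_field_vfield D_vfields X r i)
    show ?thesis unfolding 1 2 by (simp only: fdbl_re_field)
  qed
  have W: "fP Y \<in> \<Gamma>" by (rule fP_\<Gamma>[OF vfields_cvfields[OF Y]])
  have 1: "D X Y = D X (fdbl (fP Y) + fscale (\<lambda>p. \<theta> p (Y p)) \<xi>)"
    using vfield_splitting[OF Y] by simp
  have 2: "D X (fdbl (fP Y) + fscale (\<lambda>p. \<theta> p (Y p)) \<xi>) = D X (fdbl (fP Y)) + D X (fscale (\<lambda>p. \<theta> p (Y p)) \<xi>)"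
    by (intro D_add_right X fdbl_vfields \<Gamma>_cvfields W vfields_fscale th_smooth Y reeb_vfield)
  have 3: "D X (fscale (\<lambda>p. \<theta> p (Y p)) \<xi>) = fscale (\<lambda>p. Re (X p (\<lambda>q. \<theta> q (Y q)))) \<xi>"
    using D_scale_right[OF th_smooth[OF Y] X reeb_vfield] D_reeb[OF X]
    by (simp add: fun_eq_iff fscale_def)
  show ?thesis unfolding 1 2 3 d[OF W] ..
qed

lemma P_D: "X \<in> vfields A \<Longrightarrow> Y \<in> vfields A \<Longrightarrow> P p (D X Y p) = Dc X (fP Y) p"
  by (simp add: D_eq fscale_def P_dbl_reeb Dc_E vfields_cvfields fP_\<Gamma>)

text \<open>Metric compatibility of D on \<open>fdbl W\<close> and \<open>fdbl V\<close> is the real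
  part of the claim. The imaginary part is the real part for iV in place of V.\<close>

lemma Dc_metric_real:
  assumes X: "X \<in> vfields A" and W: "W \<in> \<Gamma>" and V: "V \<in> \<Gamma>"
  shows "capply (X p) (\<lambda>q. K q (W q) (V q)) = K p (Dc X W p) (V p) + K p (W p) (Dc X V p)"
proof -
  have re: "Re (capply (X p) (\<lambda>q. K q (W q) (V q))) = Re (K p (Dc X W p) (V p) + K p (W p) (Dc X V p))"
    if W: "W \<in> \<Gamma>" and V: "V \<in> \<Gamma>" for W V
  proof -
    have w: "fdbl W \<in> vfields A" "fdbl V \<in> vfields A" using W V by (simp_all add: fdbl_vfields \<Gamma>_cvfields)
    have "g_metric A E \<theta> h q (fdbl W q) (fdbl V q) = Re (K q (W q) (V q))" for q
      using vfields_tangent[OF w(1), of q] vfields_tangent[OF w(2), of q] W V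
      by (simp add: g_metric_eq P_dbl \<Gamma>_E)
    moreover have "g_metric A E \<theta> h p (D X (fdbl W) p) (fdbl V p) = Re (K p (Dc X W p) (V p))"
      using vfields_tangent[OF D_vfields[OF X w(1)], of p] vfields_tangent[OF w(2), of p] W V
      by (simp add: g_metric_eq P_dbl \<Gamma>_E P_D X w(1) fP_fdbl)
    moreover have "g_metric A E \<theta> h p (fdbl W p) (D X (fdbl V) p) = Re (K p (W p) (Dc X V p))"
      using vfields_tangent[OF D_vfields[OF X w(2)], of p] vfields_tangent[OF w(1), of p] W V
      by (simp add: g_metric_eq P_dbl \<Gamma>_E P_D X w(2) fP_fdbl)
    ultimately show ?thesis
      using D_metric[OF X w, of p] by (simp add: capply_real[OF vfields_tangent[OF X]])
  qed
  have iV: "ciscale V \<in> \<Gamma>" unfolding ciscale_cfscale by (intro \<Gamma>_cfscale smooth_fun_on_const V)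
  have "capply (X p) (\<lambda>q. K q (W q) (ciscale V q)) = - \<i> * capply (X p) (\<lambda>q. K q (W q) (V q))"
    using capply_fun_cmult[OF cvfields_ctangent[OF vfields_cvfields[OF X]] smooth_K[OF W V], of p "- \<i>"]
    by (simp add: ciscale_apply K_scale_right \<Gamma>_E W V)
  moreover have "Dc X (ciscale V) p = cscale \<i> (Dc X V p)"
    using cbilinear_ext_ciscale_right[OF vfields_cvfields[OF X] \<Gamma>_cvfields[OF V]] by (simp add: ciscale_apply)
  ultimately have "Im (capply (X p) (\<lambda>q. K q (W q) (V q))) = Im (K p (Dc X W p) (V p) + K p (W p) (Dc X V p))"
    using re[OF W iV] W V
    by (simp add: ciscale_apply K_scale_right \<Gamma>_E Dc_E vfields_cvfields X)
  with re[OF W V] show ?thesis by (simp add: complex_eq_iff)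
qed

lemma Dc_metric:
  assumes X: "X \<in> cvfields A" and W: "W \<in> \<Gamma>" and V: "V \<in> \<Gamma>"
  shows "capply (X p) (\<lambda>q. K q (W q) (V q)) = K p (Dc X W p) (V p) + K p (W p) (Dc (fconj X) V p)"
proof -
  note r = re_field_vfields[OF X] and i = im_field_vfields[OF X]
  note cr = vfields_cvfields[OF r] and ci = vfields_cvfields[OF i]
  have "X p = re_field X p + cscale \<i> (im_field X p)"
    by (simp add: re_field_vec im_field_vec re_im_vec)
  then have 1: "capply (X p) (\<lambda>q. K q (W q) (V q)) = capply (re_field X p) (\<lambda>q. K q (W q) (V q)) +
      \<i> * capply (im_field X p) (\<lambda>q. K q (W q) (V q))"
    by (simp only: capply_add capply_cscale)
  have 2: "Dc X W p = Dc (re_field X) W p + cscale \<i> (Dc (im_field X) W p)"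
    using cbilinear_ext_split_left[OF X \<Gamma>_cvfields[OF W]] by (simp add: ciscale_apply)
  have "Dc (- im_field X) V = - Dc (im_field X) V"
  proof -
    have "Dc (im_field X) V + Dc (- im_field X) V = Dc 0 V"
      using cbilinear_ext_add_left[OF ci cvfields_uminus[OF ci] \<Gamma>_cvfields[OF V]] by simp
    also have "\<dots> = 0" using cbilinear_ext_add_left[OF cvfields_zero cvfields_zero \<Gamma>_cvfields[OF V]] unfolding add_0_left by simp
    finally show ?thesis by (simp add: eq_neg_iff_add_eq_0 add.commute)
  qed
  then have 3: "Dc (fconj X) V p = Dc (re_field X) V p - cscale \<i> (Dc (im_field X) V p)"
    using cbilinear_ext_split_left[OF cvfields_fconj[OF X] \<Gamma>_cvfields[OF V]]
    by (simp add: ciscale_apply re_field_fconj im_field_fconj cscale_minus)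
  show ?thesis
    unfolding 1 2 3 Dc_metric_real[OF r W V] Dc_metric_real[OF i W V]
    using W V cr ci
    by (simp add: K_add_left K_diff_right K_scale_left K_scale_right E_scale Dc_E \<Gamma>_E algebra_simps)
qed

subsection \<open>The torsion condition\<close>

lemma torsion_c:
  assumes "Z \<in> cvfields A" "W \<in> cvfields A"
  shows "cbilinear_ext (torsion D) Z W p = Dc Z W p - Dc W Z p - lie_bracket Z W p"
  by (simp add: cbilinear_ext_torsion cbilinear_ext_lie_bracket assms)

lemma torsion_bar:
  assumes Z: "Z \<in> \<Gamma>" and W: "W \<in> \<Gamma>"
  shows "P p (cbilinear_ext (torsion D) (fconj Z) W p) = Dc (fconj Z) W p - P p (lie_bracket (fconj Z) W p)"
proof -
  have c: "Z \<in> cvfields A" "W \<in> cvfields A" "fconj Z \<in> cvfields A"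
    using Z W by (simp_all add: \<Gamma>_cvfields cvfields_fconj)
  have t: "Dc (fconj Z) W p \<in> ctangent A p" "Dc W (fconj Z) p \<in> ctangent A p"
    "lie_bracket (fconj Z) W p \<in> ctangent A p"
    by (intro cvfields_ctangent cbilinear_ext_cvfields lie_bracket_cvfields c)+
  show ?thesis
    using t Dc_bar[OF c(2) Z, of p] Dc_E[OF c(3) W, of p]
    by (simp add: torsion_c c P_diff ctangent_diff)
qed

lemma Theta11_eq:
  assumes Z: "Z \<in> cvfields A" and W: "W \<in> cvfields A"
  shows "Theta11 A E \<theta> D Z W p =
    (Dc (fconj (fP (fconj Z))) (fP W) p - P p (lie_bracket (fconj (fP (fconj Z))) (fP W) p)) -
    (Dc (fconj (fP (fconj W))) (fP Z) p - P p (lie_bracket (fconj (fP (fconj W))) (fP Z) p))"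
proof -
  have n: "(\<lambda>p. N p (Z p)) = fconj (fP (fconj Z))" if "Z \<in> cvfields A" for Z
    using that by (simp add: fun_eq_iff N_conj cvfields_ctangent)
  have G: "fP Z \<in> \<Gamma>" "fP (fconj Z) \<in> \<Gamma>" "fP W \<in> \<Gamma>" "fP (fconj W) \<in> \<Gamma>"
    using Z W by (simp_all add: fP_\<Gamma> cvfields_fconj)
  note c = G[THEN \<Gamma>_cvfields]
  have "cbilinear_ext (torsion D) (fP Z) (fconj (fP (fconj W))) p =
      - cbilinear_ext (torsion D) (fconj (fP (fconj W))) (fP Z) p"
    using lie_bracket_antisym[of "fP Z" "fconj (fP (fconj W))" p]
    by (simp add: torsion_c c cvfields_fconj)
  moreover have "cbilinear_ext (torsion D) (fconj (fP (fconj W))) (fP Z) p \<in> ctangent A p"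
    unfolding torsion_c[OF cvfields_fconj[OF c(4)] c(1)]
    by (intro ctangent_diff cvfields_ctangent cbilinear_ext_cvfields lie_bracket_cvfields cvfields_fconj c)
  ultimately have "P p (cbilinear_ext (torsion D) (fP Z) (fconj (fP (fconj W))) p) =
      - P p (cbilinear_ext (torsion D) (fconj (fP (fconj W))) (fP Z) p)"
    by (simp add: P_uminus)
  then show ?thesis
    by (simp add: Theta11_def Theta_def n Z W fP_def[symmetric] torsion_bar[OF G(2,3)] torsion_bar[OF G(4,1)])
qed

text \<open>On a conjugated section and a (1,0) section only one of the two terms of
  \<open>Theta11\<close> survives, and it yields the equation for \<open>Dc\<close>. Conversely this
  equation evaluates both terms, which are the two mixed parts of \<Psi> in
  \<open>\<Psi>_splitting\<close>.\<close>

lemma Theta11_iff: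
  "(\<forall>Z\<in>cvfields A. \<forall>W\<in>cvfields A. Theta11 A E \<theta> D Z W = (\<lambda>p. \<Psi> p (Z p) (W p))) \<longleftrightarrow>
    (\<forall>Z\<in>\<Gamma>. \<forall>W\<in>\<Gamma>. Dc (fconj Z) W = B (fconj Z) W)" (is "?L \<longleftrightarrow> ?R")
proof
  assume L: ?L
  show ?R
  proof (intro ballI ext[of "Dc _ _"])
    fix Z W p assume Z: "Z \<in> \<Gamma>" and W: "W \<in> \<Gamma>"
    have c: "fconj Z \<in> cvfields A" "W \<in> cvfields A" using Z W by (simp_all add: \<Gamma>_cvfields cvfields_fconj)
    \<comment> \<open>In the second term of \<open>Theta11_eq\<close> both projections are the zero
      field for these arguments.\<close>
    have z: "Dc (fconj 0) 0 p = 0" "lie_bracket (fconj 0) 0 p = 0"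
    proof -
      have 0: "fconj (0 :: 'a cfield) = 0" by (simp add: fun_eq_iff)
      show "Dc (fconj 0) 0 p = 0"
        using cbilinear_ext_add_left[OF cvfields_zero cvfields_zero cvfields_zero] unfolding add_0_left 0 by simp
      show "lie_bracket (fconj 0) 0 p = 0" unfolding 0 by (simp add: lie_bracket_def fun_eq_iff)
    qed
    have "Theta11 A E \<theta> D (fconj Z) W p = \<Psi> p (cconj (Z p)) (W p)"
      using L c by simp
    then show "Dc (fconj Z) W p = B (fconj Z) W p"
      using z unfolding Theta11_eq[OF c]
      by (simp add: fP_bar fP_\<Gamma>_id Z W B_def algebra_simps)
  qed
next
  assume R: ?R
  show ?L
  proof (intro ballI ext[of "Theta11 A E \<theta> D _ _"])
    fix Z W p assume Z: "Z \<in> cvfields A" and W: "W \<in> cvfields A"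
    have G: "fP Z \<in> \<Gamma>" "fP (fconj Z) \<in> \<Gamma>" "fP W \<in> \<Gamma>" "fP (fconj W) \<in> \<Gamma>"
      using Z W by (simp_all add: fP_\<Gamma> cvfields_fconj)
    have t: "Z p \<in> ctangent A p" "W p \<in> ctangent A p" using Z W by (simp_all add: cvfields_ctangent)
    have 1: "Theta11 A E \<theta> D Z W p = \<Psi> p (N p (Z p)) (P p (W p)) - \<Psi> p (N p (W p)) (P p (Z p))"
      unfolding Theta11_eq[OF Z W] using R G t by (simp add: B_def N_conj)
    have 2: "\<Psi> p (N p (W p)) (P p (Z p)) = - \<Psi> p (P p (Z p)) (N p (W p))"
      using t by (intro \<Psi>_antisym) (simp_all add: N_conj P_E E_ctangent ctangent_conj)
    show "Theta11 A E \<theta> D Z W p = \<Psi> p (Z p) (W p)"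
      unfolding 1 2 \<Psi>_splitting[OF t] by simp
  qed
qed

subsection \<open>The condition on the pseudo-Hermitian torsion\<close>

text \<open>By \<open>P_tau\<close> this is the complex linear part of \<tau> on the (1,0) half of a
  field.\<close>

definition S :: "'a cfield \<Rightarrow> 'a cfield" where
  "S W = (\<lambda>p. Dc \<xi> W p - P p (lie_bracket \<xi> W p))"

lemma S_E: "W \<in> \<Gamma> \<Longrightarrow> S W p \<in> E p"
  unfolding S_def
  by (intro E_diff Dc_E P_E cvfields_ctangent[OF lie_bracket_cvfields] reeb_cvfield)
    (simp_all add: \<Gamma>_cvfields)

lemma S_ciscale: "W \<in> \<Gamma> \<Longrightarrow> S (ciscale W) p = cscale \<i> (S W p)"
proof -
  assume W: "W \<in> \<Gamma>"
  note cW = \<Gamma>_cvfields[OF W]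
  have "lie_bracket \<xi> (ciscale W) p = cscale \<i> (lie_bracket \<xi> W p)"
    unfolding ciscale_cfscale lie_bracket_cfscale_right[OF reeb_cvfield cW smooth_fun_on_const]
    by (simp add: capply_fun_const[OF reeb_ctangent])
  then show ?thesis
    using cbilinear_ext_ciscale_right[OF reeb_cvfield cW]
    by (simp add: S_def ciscale_apply P_scale cvfields_ctangent[OF lie_bracket_cvfields] reeb_cvfield cW cscale_diff)
qed

lemma tau_vfields: "Y \<in> vfields A \<Longrightarrow> tau_endo A \<theta> D Y \<in> vfields A"
  unfolding tau_endo_def torsion_def
  by (intro vfields_diff D_vfields lie_bracket_vfields reeb_vfield)

text \<open>D Y \<xi> vanishes and the bracket of \<xi> with \<theta>(Y) \<xi> is a multiple of
  \<xi>, so only the two halves of Y contribute. The first term is complex linear in the (1,0) half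
  of Y as far as i is concerned, the second conjugate linear.\<close>

lemma P_tau:
  assumes Y: "Y \<in> vfields A"
  shows "P p (tau_endo A \<theta> D Y p) = S (fP Y) p - P p (lie_bracket \<xi> (fconj (fP Y)) p)"
proof -
  have W: "fP Y \<in> \<Gamma>" by (rule fP_\<Gamma>[OF vfields_cvfields[OF Y]])
  note cW = \<Gamma>_cvfields[OF W]
  let ?u = "\<lambda>p. complex_of_real (\<theta> p (Y p))"
  have su: "smooth ?u" by (intro smooth_intros th_smooth Y)
  have "Y = (fP Y + fconj (fP Y)) + cfscale ?u \<xi>"
    using vfield_splitting[OF Y] by (simp add: fdbl_def fscale_cfscale)
  then have "lie_bracket \<xi> Y p = lie_bracket \<xi> ((fP Y + fconj (fP Y)) + cfscale ?u \<xi>) p" by simp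
  then have 1: "lie_bracket \<xi> Y p =
      lie_bracket \<xi> (fP Y) p + lie_bracket \<xi> (fconj (fP Y)) p + lie_bracket \<xi> (cfscale ?u \<xi>) p"
    by (simp only: lie_bracket_add_right reeb_cvfield cW cvfields_add cvfields_fconj cvfields_cfscale su)
  have 2: "lie_bracket \<xi> (cfscale ?u \<xi>) p = cscale (capply (\<xi> p) ?u) (\<xi> p)"
    unfolding lie_bracket_cfscale_right[OF reeb_cvfield reeb_cvfield su]
    by (simp add: lie_bracket_def fun_eq_iff)
  have L: "P p (lie_bracket \<xi> Y p) = P p (lie_bracket \<xi> (fP Y) p) + P p (lie_bracket \<xi> (fconj (fP Y)) p)"
    unfolding 1 2
    by (simp add: P_add P_scale ctangent_add ctangent_scale reeb_ctangent
        cvfields_ctangent[OF lie_bracket_cvfields] reeb_cvfield cW cvfields_fconj)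
  have "tau_endo A \<theta> D Y p = D \<xi> Y p - lie_bracket \<xi> Y p"
    by (simp add: tau_endo_def torsion_def D_reeb[OF Y])
  then have "P p (tau_endo A \<theta> D Y p) = Dc \<xi> (fP Y) p - P p (lie_bracket \<xi> Y p)"
    using P_diff[OF cvfields_ctangent cvfields_ctangent, OF vfields_cvfields[OF D_vfields[OF reeb_vfield Y]]
        vfields_cvfields[OF lie_bracket_vfields[OF reeb_vfield Y]], of p]
    by (simp add: P_D reeb_vfield Y)
  then show ?thesis by (simp add: L S_def)
qed

text \<open>J before \<tau> multiplies the \<open>S\<close> term by i and the bracket term by -i; J
  after \<tau> multiplies both by i. The sum keeps the \<open>S\<close> term twice and loses the
  bracket term.\<close>

lemma P_sigma:
  assumes X: "X \<in> vfields A"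
  shows "P p (sigma_endo A E \<theta> D X p) = cscale (2 * \<i>) (S (fP X) p)"
    and "sigma_endo A E \<theta> D X p \<in> tangent A p"
proof -
  have W: "fP X \<in> \<Gamma>" by (rule fP_\<Gamma>[OF vfields_cvfields[OF X]])
  have iW: "ciscale (fP X) \<in> \<Gamma>" unfolding ciscale_cfscale by (intro \<Gamma>_cfscale W smooth_fun_on_const)
  note cW = \<Gamma>_cvfields[OF W]
  have J: "(\<lambda>p. J_endo A E \<theta> p (X p)) = fdbl (ciscale (fP X))"
    using X by (simp add: fun_eq_iff J_endo_eq vfields_tangent ciscale_apply)
  have JX: "fdbl (ciscale (fP X)) \<in> vfields A" by (intro fdbl_vfields \<Gamma>_cvfields iW)
  have "fconj (ciscale (fP X)) = cfscale (\<lambda>_. - \<i>) (fconj (fP X))"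
    by (simp add: fun_eq_iff ciscale_def)
  then have L: "lie_bracket \<xi> (fconj (ciscale (fP X))) p = cscale (- \<i>) (lie_bracket \<xi> (fconj (fP X)) p)"
    using lie_bracket_cfscale_right[OF reeb_cvfield cvfields_fconj[OF cW] smooth_fun_on_const, of "- \<i>" p]
    by (simp add: capply_fun_const[OF reeb_ctangent])
  have t: "tau_endo A \<theta> D X p \<in> tangent A p" by (rule vfields_tangent[OF tau_vfields[OF X]])
  have tJ: "tau_endo A \<theta> D (fdbl (ciscale (fP X))) p \<in> tangent A p"
    by (rule vfields_tangent[OF tau_vfields[OF JX]])
  have tE: "P p (tau_endo A \<theta> D X p) \<in> E p" by (rule P_E[OF tangent_ctangent[OF t]])
  have s: "sigma_endo A E \<theta> D X p = tau_endo A \<theta> D (fdbl (ciscale (fP X))) p +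
      dbl (cscale \<i> (P p (tau_endo A \<theta> D X p)))"
    by (simp add: sigma_endo_def J J_endo_eq[OF t])
  show "sigma_endo A E \<theta> D X p \<in> tangent A p"
    unfolding s by (intro tangent_add tJ dbl_tangent E_ctangent E_scale tE)
  have "P p (sigma_endo A E \<theta> D X p) = P p (tau_endo A \<theta> D (fdbl (ciscale (fP X))) p) +
      cscale \<i> (P p (tau_endo A \<theta> D X p))"
    unfolding s using tJ tE
    by (simp add: P_add tangent_ctangent dbl_tangent E_ctangent E_scale P_dbl)
  also have "\<dots> = (cscale \<i> (S (fP X) p) - P p (cscale (- \<i>) (lie_bracket \<xi> (fconj (fP X)) p))) +
      cscale \<i> (S (fP X) p - P p (lie_bracket \<xi> (fconj (fP X)) p))"
    by (simp only: P_tau[OF JX] P_tau[OF X] fP_fdbl[OF iW] S_ciscale[OF W] L)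
  also have "\<dots> = cscale (2 * \<i>) (S (fP X) p)"
    unfolding P_scale[OF cvfields_ctangent[OF lie_bracket_cvfields[OF reeb_cvfield cvfields_fconj[OF cW]]]]
    by (simp add: fun_eq_iff algebra_simps)
  finally show "P p (sigma_endo A E \<theta> D X p) = cscale (2 * \<i>) (S (fP X) p)" .
qed

text \<open>As h is the real part of \<open>K\<close>, the factor 2i turns skewness of \<sigma> into
  equality of the imaginary parts of K(S W, V) and K(W, S V). Replacing V by iV gives the real
  parts.\<close>

lemma sigma_iff:
  "(\<forall>X\<in>vfields A. \<forall>Y\<in>vfields A. \<forall>p.
       h_tensor A E \<theta> h p (sigma_endo A E \<theta> D X p) (Y p) =
       - h_tensor A E \<theta> h p (X p) (sigma_endo A E \<theta> D Y p)) \<longleftrightarrow>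
   (\<forall>W\<in>\<Gamma>. \<forall>V\<in>\<Gamma>. \<forall>p. K p (S W p) (V p) = K p (W p) (S V p))" (is "?L \<longleftrightarrow> ?R")
proof -
  have l: "h_tensor A E \<theta> h p (sigma_endo A E \<theta> D X p) (Y p) = - 2 * Im (K p (S (fP X) p) (fP Y p))"
    "h_tensor A E \<theta> h p (X p) (sigma_endo A E \<theta> D Y p) = 2 * Im (K p (fP X p) (S (fP Y) p))"
    if X: "X \<in> vfields A" and Y: "Y \<in> vfields A" for X Y p
  proof -
    have G: "fP X \<in> \<Gamma>" "fP Y \<in> \<Gamma>" using X Y by (simp_all add: fP_\<Gamma> vfields_cvfields)
    note e = \<Gamma>_E[OF G(1), of p] \<Gamma>_E[OF G(2), of p] S_E[OF G(1), of p] S_E[OF G(2), of p]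
    show "h_tensor A E \<theta> h p (sigma_endo A E \<theta> D X p) (Y p) = - 2 * Im (K p (S (fP X) p) (fP Y p))"
      using K_scale_left[OF e(3) e(2), of "2 * \<i>"]
      by (simp add: h_tensor_eq P_sigma X vfields_tangent[OF Y])
    show "h_tensor A E \<theta> h p (X p) (sigma_endo A E \<theta> D Y p) = 2 * Im (K p (fP X p) (S (fP Y) p))"
      using K_scale_right[OF e(1) e(4), of "2 * \<i>"]
      by (simp add: h_tensor_eq P_sigma Y vfields_tangent[OF X])
  qed
  show ?thesis
  proof
    assume L: ?L
    show ?R
    proof (intro ballI allI)
      fix W V p assume W: "W \<in> \<Gamma>" and V: "V \<in> \<Gamma>"
      have im: "Im (K p (S W p) (V p)) = Im (K p (W p) (S V p))" if W: "W \<in> \<Gamma>" and V: "V \<in> \<Gamma>" for W V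
      proof -
        have v: "fdbl W \<in> vfields A" "fdbl V \<in> vfields A" using W V by (simp_all add: fdbl_vfields \<Gamma>_cvfields)
        have "h_tensor A E \<theta> h p (sigma_endo A E \<theta> D (fdbl W) p) (fdbl V p) =
            - h_tensor A E \<theta> h p (fdbl W p) (sigma_endo A E \<theta> D (fdbl V) p)"
          using L v by blast
        then show ?thesis unfolding l[OF v] fP_fdbl[OF W] fP_fdbl[OF V] by simp
      qed
      have iV: "ciscale V \<in> \<Gamma>" unfolding ciscale_cfscale by (intro \<Gamma>_cfscale V smooth_fun_on_const)
      have "Re (K p (S W p) (V p)) = Re (K p (W p) (S V p))"
        using im[OF W iV] W V
        by (simp add: S_ciscale ciscale_apply K_scale_right \<Gamma>_E S_E)
      with im[OF W V] show "K p (S W p) (V p) = K p (W p) (S V p)" by (simp add: complex_eq_iff)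
    qed
  next
    assume R: ?R
    show ?L
      using R by (auto simp: l fP_\<Gamma> vfields_cvfields simp del: fP_apply)
  qed
qed

lemma Dc_scale_reeb: "smooth u \<Longrightarrow> W \<in> \<Gamma> \<Longrightarrow> Dc (fscale u \<xi>) W = fscale u (Dc \<xi> W)"
  unfolding cbilinear_ext_real_left[OF vfields_fscale[OF _ reeb_vfield] \<Gamma>_cvfields] cbilinear_ext_real_left[OF reeb_vfield \<Gamma>_cvfields]
  by (simp add: D_scale_left reeb_vfield re_field_vfields im_field_vfields \<Gamma>_cvfields)
    (simp add: fun_eq_iff fscale_def ciscale_def algebra_simps)

text \<open>Along \<open>anti X\<close> the connection differs from \<open>B\<close> by half of
  \<theta>(X) S. Expanding K(Dc X W, V) with compatibility then gives F X W V except that K(S W, V)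
  stands where K(W, S V) should, and symmetry of S closes this gap.\<close>

lemma Dc_nabla:
  assumes T: "\<And>Z W. Z \<in> \<Gamma> \<Longrightarrow> W \<in> \<Gamma> \<Longrightarrow> Dc (fconj Z) W = B (fconj Z) W"
    and Sy: "\<And>W V p. W \<in> \<Gamma> \<Longrightarrow> V \<in> \<Gamma> \<Longrightarrow> K p (S W p) (V p) = K p (W p) (S V p)"
    and X: "X \<in> vfields A" and W: "W \<in> \<Gamma>"
  shows "nabla X W = Dc X W"
proof (rule nabla_unique)
  show cX: "X \<in> cvfields A" by (rule vfields_cvfields[OF X])
  show "Dc X W \<in> \<Gamma>" by (rule Dc_\<Gamma>[OF cX W])
  fix V p assume V: "V \<in> \<Gamma>"
  have f: "fconj X = X" by (rule vfields_fconj[OF X])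
  let ?u = "\<lambda>p. 1 / 2 * \<theta> p (X p)"
  have su: "smooth ?u" by (intro smooth_intros th_smooth X)
  have Z: "fP X \<in> \<Gamma>" by (rule fP_\<Gamma>[OF cX])
  have a: "anti X = fconj (fP X) + fscale ?u \<xi>"
    unfolding anti_def f
    by (simp add: fscale_cfscale tc_tangent[OF vfields_tangent[OF X]])
  have aX: "anti X \<in> cvfields A" by (rule anti_cvfields[OF cX])
  have Da: "Dc (anti X) V p = B (anti X) V p + cscale (of_real (?u p)) (S V p)" if V: "V \<in> \<Gamma>" for V
  proof -
    have cf: "fconj (fP X) \<in> cvfields A" "fscale ?u \<xi> \<in> cvfields A"
      by (intro cvfields_fconj \<Gamma>_cvfields Z vfields_cvfields vfields_fscale su reeb_vfield)+
    have "Dc (anti X) V p = B (fconj (fP X)) V p + cscale (of_real (?u p)) (Dc \<xi> V p)"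
      unfolding a using cbilinear_ext_add_left[OF cf \<Gamma>_cvfields[OF V]] T[OF Z V] Dc_scale_reeb[OF su V]
      by (simp add: fscale_def)
    moreover have "B (anti X) V p = B (fconj (fP X)) V p + cscale (of_real (?u p)) (P p (lie_bracket \<xi> V p))"
    proof -
      have "B (fscale ?u \<xi>) V p = cscale (of_real (?u p)) (B \<xi> V p)"
        unfolding fscale_cfscale
        by (rule B_cfscale_left[OF reeb_cvfield V smooth_fun_on_of_real[OF open_UNIV su] P_reeb])
      moreover have "B \<xi> V p = P p (lie_bracket \<xi> V p)"
        using \<Psi>_reeb[OF cvfields_ctangent[OF \<Gamma>_cvfields[OF V]], of p] by (simp add: B_def)
      ultimately show ?thesis unfolding a B_add_left[OF cf V] by simp
    qed
    ultimately show ?thesis by (simp add: S_def cscale_diff)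
  qed
  have "X = anti X + fconj (anti X)"
    by (rule ext) (use anti_sum[OF cX] f in simp)
  then have DX: "Dc X W p = Dc (anti X) W p + Dc (fconj (anti X)) W p"
    using cbilinear_ext_add_left[OF aX cvfields_fconj[OF aX] \<Gamma>_cvfields[OF W]] by (metis plus_fun_apply)
  have m: "capply (cconj (anti X p)) (\<lambda>q. K q (W q) (V q)) =
      K p (Dc (fconj (anti X)) W p) (V p) + K p (W p) (Dc (anti X) V p)"
    using Dc_metric[OF cvfields_fconj[OF aX] W V, of p] by simp
  have e: "B (anti X) W p \<in> E p" "B (anti X) V p \<in> E p" "S W p \<in> E p" "S V p \<in> E p"
    "Dc (fconj (anti X)) W p \<in> E p" "Dc (anti X) W p \<in> E p" "W p \<in> E p" "V p \<in> E p"
    using aX W V by (simp_all add: B_E S_E Dc_E cvfields_fconj \<Gamma>_E)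
  show "K p (Dc X W p) (V p) = F X W V p"
    unfolding F_def f m DX Da[OF W] Da[OF V]
    using e Sy[OF W V, of p] by (simp add: K_add_left K_add_right K_scale_left K_scale_right E_add E_scale)
qed (rule W)

end

section \<open>Existence and uniqueness\<close>

context ph_form
begin

text \<open>The formula of \<open>D_eq\<close> with \<open>nabla\<close> for the extended
  connection; the value 0 on other arguments is the convention of
  \<open>linear_connection\<close>.\<close>

definition conn :: "'a cfield \<Rightarrow> 'a cfield \<Rightarrow> 'a cfield" where
  "conn X Y = (if X \<in> vfields A \<and> Y \<in> vfields A
     then fdbl (nabla X (fP Y)) + fscale (\<lambda>p. Re (X p (\<lambda>q. \<theta> q (Y q)))) \<xi> else 0)"

lemma conn_apply:
  "X \<in> vfields A \<Longrightarrow> Y \<in> vfields A \<Longrightarrow>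
    conn X Y p = dbl (nabla X (fP Y) p) + cscale (of_real (Re (X p (\<lambda>q. \<theta> q (Y q))))) (\<xi> p)"
  by (simp add: conn_def fscale_def)

lemma conn_vfields: "X \<in> vfields A \<Longrightarrow> Y \<in> vfields A \<Longrightarrow> conn X Y \<in> vfields A"
  unfolding conn_def
  by (simp only: if_True simp_thms)
    (intro vfields_add fdbl_vfields \<Gamma>_cvfields nabla_\<Gamma> fP_\<Gamma> vfields_cvfields vfields_fscale reeb_vfield
      smooth_fun_on_Re[OF open_UNIV] smooth_app)

lemma conn_add_left:
  "X \<in> vfields A \<Longrightarrow> X' \<in> vfields A \<Longrightarrow> Y \<in> vfields A \<Longrightarrow> conn (X + X') Y = conn X Y + conn X' Y"
  by (rule ext) (simp add: conn_apply vfields_add nabla_add_X vfields_cvfields fP_\<Gamma> dbl_add cscale_add_left add.assoc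
      add.left_commute)

lemma conn_add_right:
  assumes "X \<in> vfields A" "Y \<in> vfields A" "Y' \<in> vfields A"
  shows "conn X (Y + Y') = conn X Y + conn X Y'"
proof
  fix p
  have 1: "fP (Y + Y') = fP Y + fP Y'"
    using assms by (simp add: fun_eq_iff P_add cvfields_ctangent vfields_cvfields)
  have 2: "X p (\<lambda>q. \<theta> q ((Y + Y') q)) = X p (\<lambda>q. \<theta> q (Y q)) + X p (\<lambda>q. \<theta> q (Y' q))"
    using tangent_fun_add[OF vfields_tangent[OF assms(1)] th_smooth[OF assms(2)] th_smooth[OF assms(3)]] assms
    by (simp add: th_add vfields_tangent)
  show "conn X (Y + Y') p = (conn X Y + conn X Y') p"
    unfolding conn_apply[OF assms(1) vfields_add[OF assms(2,3)]] 1 2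
    using assms by (simp add: conn_apply nabla_add_W vfields_cvfields fP_\<Gamma> dbl_add cscale_add_left algebra_simps)
qed

lemma conn_scale_left:
  assumes u: "smooth u" and X: "X \<in> vfields A" and Y: "Y \<in> vfields A"
  shows "conn (fscale u X) Y = fscale u (conn X Y)"
proof
  fix p
  have "nabla (fscale u X) (fP Y) = cfscale (\<lambda>p. of_real (u p)) (nabla X (fP Y))"
    unfolding fscale_cfscale using X Y
    by (intro nabla_cfscale_X smooth_fun_on_of_real[OF open_UNIV u]) (simp_all add: vfields_cvfields fP_\<Gamma>)
  then have "conn (fscale u X) Y p = dbl (cscale (of_real (u p)) (nabla X (fP Y) p)) +
      cscale (of_real (Re (fscale u X p (\<lambda>q. \<theta> q (Y q))))) (\<xi> p)"
    by (simp add: conn_apply vfields_fscale u X Y)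
  then show "conn (fscale u X) Y p = fscale u (conn X Y) p"
    by (simp add: fscale_def conn_apply X Y dbl_of_real cscale_add)
qed

lemma conn_scale_right:
  assumes u: "smooth u" and X: "X \<in> vfields A" and Y: "Y \<in> vfields A"
  shows "conn X (fscale u Y) = fscale (\<lambda>p. Re (X p u)) Y + fscale u (conn X Y)"
proof
  fix p
  note cX = vfields_cvfields[OF X] and W = fP_\<Gamma>[OF vfields_cvfields[OF Y]]
  have su: "smooth (\<lambda>p. complex_of_real (u p))" by (rule smooth_fun_on_of_real[OF open_UNIV u])
  have "fP (fscale u Y) = cfscale (\<lambda>p. of_real (u p)) (fP Y)"
    using Y by (simp add: fun_eq_iff[of "fP _"] fscale_def P_scale cvfields_ctangent vfields_cvfields)
  then have n: "nabla X (fP (fscale u Y)) p =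
      cscale (of_real (Re (X p u))) (fP Y p) + cscale (of_real (u p)) (nabla X (fP Y) p)"
    using nabla_cfscale_W[OF cX W su] capply_of_real[OF cvfields_ctangent[OF cX], of p u]
      tangent_of_Re[OF vfields_tangent[OF X], of p u]
    by simp
  have "X p (\<lambda>q. \<theta> q (fscale u Y q)) = of_real (u p) * X p (\<lambda>q. \<theta> q (Y q)) + of_real (\<theta> p (Y p)) * X p u"
    using tangent_fun_mult[OF vfields_tangent[OF X] u th_smooth[OF Y]] by (simp add: th_fscale Y)
  then have t: "Re (X p (\<lambda>q. \<theta> q (fscale u Y q))) = u p * Re (X p (\<lambda>q. \<theta> q (Y q))) + \<theta> p (Y p) * Re (X p u)"
    by simp
  have "conn X (fscale u Y) p = cscale (of_real (Re (X p u))) (dbl (P p (Y p)) + cscale (of_real (\<theta> p (Y p))) (\<xi> p)) +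
      cscale (of_real (u p)) (conn X Y p)"
    unfolding conn_apply[OF X vfields_fscale[OF u Y]] n t
    by (simp add: conn_apply X Y dbl_add dbl_of_real cscale_add cscale_add_left algebra_simps)
  then show "conn X (fscale u Y) p = (fscale (\<lambda>p. Re (X p u)) Y + fscale u (conn X Y)) p"
    using tangent_splitting[OF vfields_tangent[OF Y], of p] by (simp add: fscale_def)
qed

lemma conn_linear: "linear_connection A conn"
  unfolding linear_connection_def
  using conn_vfields conn_add_left conn_add_right conn_scale_left conn_scale_right
  by (auto simp: conn_def)

sublocale conn: biadditive A conn
  by unfold_locales (simp_all add: conn_vfields conn_add_left conn_add_right)

text \<open>With N = nabla X W, the real and imaginary parts of W contribute dbl (N/2) and i dbl
  (-iN/2). The conjugate parts cancel and N remains.\<close>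

lemma conn_nabla_real:
  assumes X: "X \<in> vfields A" and W: "W \<in> \<Gamma>"
  shows "cbilinear_ext conn X W = nabla X W"
proof
  fix p
  note cX = vfields_cvfields[OF X] and cW = \<Gamma>_cvfields[OF W]
  note r = re_field_vfields[OF cW] and i = im_field_vfields[OF cW]
  \<comment> \<open>The real part of W is half of \<open>fdbl\<close> W and the imaginary part half
    of \<open>fdbl\<close> (-iW). Their (1,0) halves are W/2 and -iW/2, and \<theta> vanishes on
    both, so the Reeb terms of \<open>conn\<close> disappear.\<close>
  have "re_field W = cfscale (\<lambda>_. 1 / 2) (fdbl W)" "im_field W = cfscale (\<lambda>_. 1 / 2) (fdbl (cfscale (\<lambda>_. - \<i>) W))"
    by (simp_all add: fun_eq_iff fdbl_def re_field_def im_field_def complex_eq_iff)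
  moreover have "cfscale (\<lambda>_. - \<i>) W \<in> \<Gamma>" by (intro \<Gamma>_cfscale W smooth_fun_on_const)
  ultimately have "fP (re_field W) = cfscale (\<lambda>_. 1 / 2) W" "fP (im_field W) = cfscale (\<lambda>_. - \<i> / 2) W"
    using W by (simp_all add: fun_eq_iff[of "fP _"] P_scale dbl_tangent[THEN tangent_ctangent] E_ctangent \<Gamma>_E
        E_scale P_dbl del: cvec.scale_minus_left)
  moreover have "\<theta> q (re_field W q) = 0" "\<theta> q (im_field W q) = 0" for q
    using tc_E[OF \<Gamma>_E[OF W], of q] by (simp_all add: tc_def re_field_vec im_field_vec complex_eq_iff)
  ultimately have c: "conn X (re_field W) p = dbl (cscale (1 / 2) (nabla X W p))"
    "conn X (im_field W) p = dbl (cscale (- \<i> / 2) (nabla X W p))"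
    using tangent_fun_const[OF vfields_tangent[OF X], of p 0]
    by (simp_all add: conn_apply X r i nabla_const_W cX W del: cvec.scale_minus_left)
  show "cbilinear_ext conn X W p = nabla X W p"
    unfolding conn.cbilinear_ext_real_left[OF X cW] plus_fun_apply ciscale_apply c
    by (simp add: dbl_def fun_eq_iff algebra_simps)
qed

lemma conn_nabla:
  assumes X: "X \<in> cvfields A" and W: "W \<in> \<Gamma>"
  shows "cbilinear_ext conn X W = nabla X W"
proof -
  note r = re_field_vfields[OF X] and i = im_field_vfields[OF X]
  have "nabla X W = nabla (re_field X + ciscale (im_field X)) W"
    using re_im_field[of X] by simp
  also have "\<dots> = nabla (re_field X) W + ciscale (nabla (im_field X) W)"
    using r i W
    by (simp add: nabla_add_X vfields_cvfields cvfields_ciscale)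
      (simp add: ciscale_cfscale nabla_cfscale_X vfields_cvfields smooth_fun_on_const)
  finally show ?thesis
    unfolding conn.cbilinear_ext_split_left[OF X \<Gamma>_cvfields[OF W]]
    by (simp add: conn_nabla_real r i W)
qed

text \<open>The real and imaginary parts of a field along the Reeb line are real multiples of \<xi>;
  their (1,0) halves vanish, and only the Reeb term of \<open>conn\<close> remains.\<close>

lemma conn_preserves_reeb: "preserves A conn (\<lambda>p. {cscale c (\<xi> p) | c. True})"
  unfolding preserves_def
proof (intro ballI)
  let ?L = "\<lambda>p. {cscale c (\<xi> p) | c. True}"
  fix X Z assume X: "X \<in> vfields A" and "Z \<in> sections A ?L"
  then have Z: "Z \<in> cvfields A" and L: "\<And>p. Z p \<in> ?L p" unfolding sections_cvfields[of _ ?L] by blast+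
  note r = re_field_vfields[OF Z] and i = im_field_vfields[OF Z]
  have "P p (re_field Z p) = 0 \<and> P p (im_field Z p) = 0" for p
  proof -
    obtain c where c: "Z p = cscale c (\<xi> p)" using L by blast
    have x: "Im (\<xi> p f) = 0" for f by (rule vfields_Im[OF reeb_vfield])
    have "re_field Z p = cscale (of_real (Re c)) (\<xi> p)" "im_field Z p = cscale (of_real (Im c)) (\<xi> p)"
      by (simp_all add: re_field_def im_field_def c fun_eq_iff complex_eq_iff x)
    then show ?thesis by (simp add: P_scale reeb_ctangent)
  qed
  then have "fP (re_field Z) = 0" "fP (im_field Z) = 0" by (simp_all add: fun_eq_iff[of "fP _"])
  then have "cbilinear_ext conn X Z p = cscale (of_real (Re (X p (\<lambda>q. \<theta> q (re_field Z q)))) +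
      \<i> * of_real (Re (X p (\<lambda>q. \<theta> q (im_field Z q))))) (\<xi> p)" for p
    unfolding conn.cbilinear_ext_real_left[OF X Z]
    by (simp add: conn_apply X r i nabla_zero_W vfields_cvfields ciscale_apply cscale_add_left)
  then have "cbilinear_ext conn X Z p \<in> ?L p" for p by blast
  then show "cbilinear_ext conn X Z \<in> sections A ?L"
    unfolding sections_cvfields[of _ ?L]
    using conn.cbilinear_ext_cvfields[OF vfields_cvfields[OF X] Z] by blast
qed

lemma conn_preserves_bar: "preserves A conn (bar E)"
  unfolding preserves_def
proof (intro ballI)
  fix X Z assume X: "X \<in> vfields A" and "Z \<in> sections A (bar E)"
  then have Z: "Z \<in> cvfields A" and L: "\<And>p. cconj (Z p) \<in> E p"
    unfolding sections_cvfields[of _ "bar E"] bar_iff by blast+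
  have W: "fconj Z \<in> \<Gamma>" by (intro \<Gamma>I cvfields_fconj Z) (simp add: L)
  have "cbilinear_ext conn X Z = fconj (nabla X (fconj Z))"
    using conn.cbilinear_ext_fconj_right[OF X cvfields_fconj[OF Z]] conn_nabla_real[OF X W] by simp
  moreover have N: "nabla X (fconj Z) \<in> \<Gamma>" by (rule nabla_\<Gamma>[OF vfields_cvfields[OF X] W])
  ultimately show "cbilinear_ext conn X Z \<in> sections A (bar E)"
    unfolding sections_cvfields[of _ "bar E"] bar_iff
    by (simp add: cvfields_fconj \<Gamma>_cvfields \<Gamma>_E)
qed

text \<open>The real part of \<open>nabla_metric\<close> for the (1,0) halves, plus the product rule
  for \<theta>(Y) \<theta>(Z).\<close>

lemma conn_metric:
  assumes X: "X \<in> vfields A" and Y: "Y \<in> vfields A" and Z: "Z \<in> vfields A"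
  shows "Re (X p (\<lambda>q. g_metric A E \<theta> h q (Y q) (Z q))) =
      g_metric A E \<theta> h p (conn X Y p) (Z p) + g_metric A E \<theta> h p (Y p) (conn X Z p)"
proof -
  have G: "fP Y \<in> \<Gamma>" "fP Z \<in> \<Gamma>" using Y Z by (simp_all add: fP_\<Gamma> vfields_cvfields)
  note cX = vfields_cvfields[OF X] and tX = vfields_tangent[OF X]
  note sK = smooth_K[OF G]
  have P_conn: "P p (conn X Y p) = nabla X (fP Y) p" "\<theta> p (conn X Y p) = Re (X p (\<lambda>q. \<theta> q (Y q)))"
    if "Y \<in> vfields A" for Y
    using that nabla_E[OF cX fP_\<Gamma>[OF vfields_cvfields[OF that]], of p]
    by (simp_all add: conn_apply X P_dbl_reeb th_dbl_reeb)
  have "(\<lambda>q. g_metric A E \<theta> h q (Y q) (Z q)) = (\<lambda>q. Re (K q (fP Y q) (fP Z q)) + \<theta> q (Y q) * \<theta> q (Z q))"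
    by (simp add: g_metric_eq vfields_tangent Y Z)
  then have "X p (\<lambda>q. g_metric A E \<theta> h q (Y q) (Z q)) = X p (\<lambda>q. Re (K q (fP Y q) (fP Z q))) +
      (of_real (\<theta> p (Y p)) * X p (\<lambda>q. \<theta> q (Z q)) + of_real (\<theta> p (Z p)) * X p (\<lambda>q. \<theta> q (Y q)))"
    using tangent_fun_add[OF tX smooth_fun_on_Re[OF open_UNIV sK] smooth_fun_on_mult[OF open_UNIV th_smooth[OF Y] th_smooth[OF Z]]]
      tangent_fun_mult[OF tX th_smooth[OF Y] th_smooth[OF Z]] by simp
  moreover have "Re (X p (\<lambda>q. Re (K q (fP Y q) (fP Z q)))) =
      Re (K p (nabla X (fP Y) p) (fP Z p)) + Re (K p (fP Y p) (nabla X (fP Z) p))"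
    using nabla_metric[OF X G, of p] capply_real[OF tX, of p "\<lambda>q. K q (fP Y q) (fP Z q)"] by simp
  ultimately show ?thesis
    using vfields_tangent[OF conn_vfields[OF X Y], of p] vfields_tangent[OF conn_vfields[OF X Z], of p]
    by (simp add: g_metric_eq vfields_tangent Y Z P_conn)
qed

lemma conn_pseudo_hermitian: "pseudo_hermitian_connection A E \<theta> h conn"
  unfolding pseudo_hermitian_connection_def
proof (intro conjI ballI allI conn_linear conn_preserves_bar conn_preserves_reeb conn_metric)
  show "preserves A conn E"
    unfolding preserves_def by (simp add: conn_nabla_real nabla_\<Gamma> vfields_cvfields)
qed

sublocale conn: ph_connection A m E \<theta> h \<Psi> conn
  by unfold_locales (rule conn_pseudo_hermitian)

text \<open>Through the two criteria, the conditions become \<open>nabla_bar\<close> and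
  \<open>nabla_reeb_symmetric\<close>.\<close>

lemma conn_conditions:
  "(\<forall>Z\<in>cvfields A. \<forall>W\<in>cvfields A. Theta11 A E \<theta> conn Z W = (\<lambda>p. \<Psi> p (Z p) (W p))) \<and>
    (\<forall>X\<in>vfields A. \<forall>Y\<in>vfields A. \<forall>p.
       h_tensor A E \<theta> h p (sigma_endo A E \<theta> conn X p) (Y p) =
       - h_tensor A E \<theta> h p (X p) (sigma_endo A E \<theta> conn Y p))"
  unfolding conn.Theta11_iff conn.sigma_iff
  by (simp add: conn_nabla nabla_bar cvfields_fconj \<Gamma>_cvfields conn.S_def reeb_cvfield nabla_reeb_symmetric)

end

text \<open>On vector fields both sides are given by the formula of \<open>D_eq\<close> with the
  same derivative of (1,0) sections; elsewhere both are 0 by convention.\<close>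

lemma (in ph_connection) D_eq_conn:
  assumes "\<forall>Z\<in>cvfields A. \<forall>W\<in>cvfields A. Theta11 A E \<theta> D Z W = (\<lambda>p. \<Psi> p (Z p) (W p))"
    and "\<forall>X\<in>vfields A. \<forall>Y\<in>vfields A. \<forall>p.
       h_tensor A E \<theta> h p (sigma_endo A E \<theta> D X p) (Y p) =
       - h_tensor A E \<theta> h p (X p) (sigma_endo A E \<theta> D Y p)"
  shows "D = conn"
proof (rule ext, rule ext)
  fix X Y
  have "nabla X W = Dc X W" if "X \<in> vfields A" "W \<in> \<Gamma>" for X W
    using assms that unfolding Theta11_iff sigma_iff by (intro Dc_nabla) blast+
  then show "D X Y = conn X Y"
    by (cases "X \<in> vfields A \<and> Y \<in> vfields A")
      (auto simp: conn_def D_eq fP_\<Gamma> vfields_cvfields D_outside)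
qed

theorem theorem1:
  fixes A :: "('a::{t2_space, second_countable_topology}, 'n::finite) chart set"
    and m :: nat
    and E :: "'a \<Rightarrow> 'a cvec set"
    and \<theta> :: "'a \<Rightarrow> 'a cvec \<Rightarrow> real"
    and h :: "'a \<Rightarrow> 'a cvec \<Rightarrow> 'a cvec \<Rightarrow> real"
    and \<Psi> :: "'a \<Rightarrow> 'a cvec \<Rightarrow> 'a cvec \<Rightarrow> 'a cvec"
  assumes "pseudo_hermitian_manifold A m E \<theta> h"
    and "complex_two_form A E \<Psi>"
    and "is_11_form A E \<theta> \<Psi>"
  shows "\<exists>!D. pseudo_hermitian_connection A E \<theta> h D \<and>
    (\<forall>Z\<in>cvfields A. \<forall>W\<in>cvfields A. Theta11 A E \<theta> D Z W = (\<lambda>p. \<Psi> p (Z p) (W p))) \<and>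
    (\<forall>X\<in>vfields A. \<forall>Y\<in>vfields A. \<forall>p.
       h_tensor A E \<theta> h p (sigma_endo A E \<theta> D X p) (Y p) =
       - h_tensor A E \<theta> h p (X p) (sigma_endo A E \<theta> D Y p))"
proof -
  interpret ph_form A m E \<theta> h \<Psi>
    by unfold_locales (use assms in auto)
  show ?thesis
  proof (rule ex1I[of _ conn])
    show "pseudo_hermitian_connection A E \<theta> h conn \<and>
      (\<forall>Z\<in>cvfields A. \<forall>W\<in>cvfields A. Theta11 A E \<theta> conn Z W = (\<lambda>p. \<Psi> p (Z p) (W p))) \<and>
      (\<forall>X\<in>vfields A. \<forall>Y\<in>vfields A. \<forall>p.
         h_tensor A E \<theta> h p (sigma_endo A E \<theta> conn X p) (Y p) =
         - h_tensor A E \<theta> h p (X p) (sigma_endo A E \<theta> conn Y p))"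
      using conn_pseudo_hermitian conn_conditions by blast
  next
    fix D
    assume D: "pseudo_hermitian_connection A E \<theta> h D \<and>
      (\<forall>Z\<in>cvfields A. \<forall>W\<in>cvfields A. Theta11 A E \<theta> D Z W = (\<lambda>p. \<Psi> p (Z p) (W p))) \<and>
      (\<forall>X\<in>vfields A. \<forall>Y\<in>vfields A. \<forall>p.
         h_tensor A E \<theta> h p (sigma_endo A E \<theta> D X p) (Y p) =
         - h_tensor A E \<theta> h p (X p) (sigma_endo A E \<theta> D Y p))"
    then interpret D: ph_connection A m E \<theta> h \<Psi> D
      by unfold_locales blast
    show "D = conn" using D by (intro D.D_eq_conn) blast+
  qed
qed

end
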